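(* Let $k\geq 2$, $r\geq 2$, and let $H_1,\dots,H_r$ be non-empty $k$-graphs with $m_k(H_1) \geq \cdots \geq m_k(H_r)$ and $m_k(H_2) > 1$, and suppose that $(H_1,H_2)$ is a heart. If for all $k$-graphs $G$ we have that $m(G) \leq m_k(H_1,H_2)$ implies $G \not\to (H_1,H_2)$, then there exists a constant $b > 0$ such that, for every $p=p(n)$ with $p \leq bn^{-1/m_k(H_1,H_2)}$, $$\lim_{n \to \infty} \mathbb{P}[G^k_{n,p} \to (H_1, \ldots, H_r)] = 0.$$
   Context: A $k$-graph is a finite $k$-uniform hypergraph; it is non-empty if it has at least one edge; $v(H),e(H)$ are the numbers of vertices and edges; $J \subseteq H$ means $J$ is a (not necessarily induced) subhypergraph. $G^k_{n,p}$ is the binomial random $k$-graph on $n$ vertices with edge probability $p$. $G \to (H_1,\dots,H_r)$ means: for every colouring of the edges of $G$ with colours from $\{1,\dots,r\}$ there is $i$ and a copy of $H_i$ in $G$ all of whose edges have colour $i$. Densities: $d(H)=e(H)/v(H)$ if $v(H)\ge 1$ and $0$ otherwise; $m(H)=\max\{d(J):J\subseteq H\}$. $d_k(H)=(e(H)-1)/(v(H)-k)$ if $H$ is non-empty with $v(H)\geq k+1$, $d_k(H)=1/k$ if $H\cong K_k$ (a single edge on $k$ vertices), and $d_k(H)=0$ otherwise; $m_k(H)=\max\{d_k(J):J\subseteq H\}$. $H$ is strictly $k$-balanced if $d_k(J)<m_k(H)$ for all proper subhypergraphs $J\subsetneq H$. For $k$-graphs with $m_k(H_1)\geq m_k(H_2)$: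 $d_k(H_1,H_2)=\frac{e(H_1)}{v(H_1)-k+1/m_k(H_2)}$ if $H_2$ is non-empty and $v(H_1)\geq k$, and $0$ otherwise (the same formula defines $d_k(J,H_2)$ for $J\subseteq H_1$); $m_k(H_1,H_2)=\max\{d_k(J,H_2):J\subseteq H_1\}$. $H_1$ is strictly balanced with respect to $d_k(\cdot,H_2)$ if $d_k(J,H_2)<m_k(H_1,H_2)$ for all proper $J\subsetneq H_1$. Heart: a pair $(H_1,H_2)$ with $m_k(H_1)\geq m_k(H_2)$ is a heart if $H_2$ is strictly $k$-balanced; $H_1$ is strictly $k$-balanced when $m_k(H_1)=m_k(H_2)$; and $H_1$ is strictly balanced with respect to $d_k(\cdot,H_2)$ when $m_k(H_1)>m_k(H_2)$. *)

theory Defs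
  imports "HOL-Library.Ramsey" "HOL-Probability.Probability"
begin

type_synonym 'v hypergraph = "'v set \<times> 'v set set"

abbreviation verts :: "'v hypergraph \<Rightarrow> 'v set" where "verts H \<equiv> fst H"
abbreviation edges :: "'v hypergraph \<Rightarrow> 'v set set" where "edges H \<equiv> snd H"

abbreviation nv :: "'v hypergraph \<Rightarrow> nat" where "nv H \<equiv> card (verts H)"
abbreviation ne :: "'v hypergraph \<Rightarrow> nat" where "ne H \<equiv> card (edges H)"

definition kgraph :: "nat \<Rightarrow> 'v hypergraph \<Rightarrow> bool" where
  "kgraph k H \<longleftrightarrow> finite (verts H) \<and> edges H \<subseteq> nsets (verts H) k"

abbreviation nonempty_hg :: "'v hypergraph \<Rightarrow> bool" where
  "nonempty_hg H \<equiv> edges H \<noteq> {}"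

text \<open>The last conjunct makes \<open>J\<close> itself a hypergraph; \<open>J\<close> need not be induced
  and may have isolated vertices or no vertices at all.\<close>

definition subhypergraph :: "'v hypergraph \<Rightarrow> 'v hypergraph \<Rightarrow> bool" where
  "subhypergraph J H \<longleftrightarrow> verts J \<subseteq> verts H \<and> edges J \<subseteq> edges H \<and> \<Union> (edges J) \<subseteq> verts J"

definition proper_subhypergraph :: "'v hypergraph \<Rightarrow> 'v hypergraph \<Rightarrow> bool" where
  "proper_subhypergraph J H \<longleftrightarrow> subhypergraph J H \<and> J \<noteq> H"

definition hg_iso :: "'v hypergraph \<Rightarrow> 'w hypergraph \<Rightarrow> bool" where
  "hg_iso H J \<longleftrightarrow> (\<exists>f. bij_betw f (verts H) (verts J) \<and> edges J = (\<lambda>e. f ` e) ` edges H)"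

definition copy_of :: "'w hypergraph \<Rightarrow> 'v hypergraph \<Rightarrow> 'w hypergraph \<Rightarrow> bool" where
  "copy_of J H G \<longleftrightarrow> subhypergraph J G \<and> hg_iso H J"

text \<open>\<open>arrows G r H\<close> is $G \to (H_1,\dots,H_r)$, so \<open>arrows G 2 H\<close> is $G \to (H_1,H_2)$.\<close>

definition arrows :: "'w hypergraph \<Rightarrow> nat \<Rightarrow> (nat \<Rightarrow> 'v hypergraph) \<Rightarrow> bool" where
  "arrows G r H \<longleftrightarrow> (\<forall>c :: 'w set \<Rightarrow> nat. c ` edges G \<subseteq> {1..r} \<longrightarrow>
     (\<exists>i\<in>{1..r}. \<exists>J. copy_of J (H i) G \<and> (\<forall>e\<in>edges J. c e = i)))"

definition dens :: "'v hypergraph \<Rightarrow> real" where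
  "dens H = (if nv H \<ge> 1 then real (ne H) / real (nv H) else 0)"

definition max_dens :: "'v hypergraph \<Rightarrow> real" where
  "max_dens H = Max {dens J | J. subhypergraph J H}"

text \<open>The second case is that of a single edge on \<open>k\<close> vertices.\<close>

definition kdens :: "nat \<Rightarrow> 'v hypergraph \<Rightarrow> real" where
  "kdens k H =
    (if nonempty_hg H \<and> nv H \<ge> k + 1 then (real (ne H) - 1) / (real (nv H) - real k)
     else if nv H = k \<and> edges H = {verts H} then 1 / real k
     else 0)"

definition max_kdens :: "nat \<Rightarrow> 'v hypergraph \<Rightarrow> real" where
  "max_kdens k H = Max {kdens k J | J. subhypergraph J H}"

definition strictly_k_balanced :: "nat \<Rightarrow> 'v hypergraph \<Rightarrow> bool" where
  "strictly_k_balanced k H \<longleftrightarrow> (\<forall>J. proper_subhypergraph J H \<longrightarrow> kdens k J < max_kdens k H)"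

definition kdens2 :: "nat \<Rightarrow> 'v hypergraph \<Rightarrow> 'w hypergraph \<Rightarrow> real" where
  "kdens2 k H1 H2 =
    (if nonempty_hg H2 \<and> nv H1 \<ge> k
     then real (ne H1) / (real (nv H1) - real k + 1 / max_kdens k H2)
     else 0)"

definition max_kdens2 :: "nat \<Rightarrow> 'v hypergraph \<Rightarrow> 'w hypergraph \<Rightarrow> real" where
  "max_kdens2 k H1 H2 = Max {kdens2 k J H2 | J. subhypergraph J H1}"

definition strictly_balanced_wrt :: "nat \<Rightarrow> 'v hypergraph \<Rightarrow> 'w hypergraph \<Rightarrow> bool" where
  "strictly_balanced_wrt k H1 H2 \<longleftrightarrow>
    (\<forall>J. proper_subhypergraph J H1 \<longrightarrow> kdens2 k J H2 < max_kdens2 k H1 H2)"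

definition heart :: "nat \<Rightarrow> 'v hypergraph \<Rightarrow> 'w hypergraph \<Rightarrow> bool" where
  "heart k H1 H2 \<longleftrightarrow>
    max_kdens k H1 \<ge> max_kdens k H2 \<and>
    strictly_k_balanced k H2 \<and>
    (max_kdens k H1 = max_kdens k H2 \<longrightarrow> strictly_k_balanced k H1) \<and>
    (max_kdens k H1 > max_kdens k H2 \<longrightarrow> strictly_balanced_wrt k H1 H2)"

definition random_kgraph :: "nat \<Rightarrow> nat \<Rightarrow> real \<Rightarrow> nat hypergraph pmf" where
  "random_kgraph k n p =
    map_pmf (\<lambda>X. ({1..n}, {e \<in> nsets {1..n} k. X e}))
      (Pi_pmf (nsets {1..n} k) False (\<lambda>_. bernoulli_pmf p))"

text \<open>The maxima above range over finite non-empty sets.\<close>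

lemma finite_subhypergraphs:
  assumes "kgraph k H"
  shows "finite {J. subhypergraph J H}"
proof (rule finite_subset)
  show "{J. subhypergraph J H} \<subseteq> Pow (verts H) \<times> Pow (Pow (verts H))"
    using assms by (fastforce simp: subhypergraph_def kgraph_def nsets_def)
  show "finite (Pow (verts H) \<times> Pow (Pow (verts H)))"
    using assms by (simp add: kgraph_def)
qed

lemma subhypergraph_empty: "subhypergraph ({}, {}) H"
  by (simp add: subhypergraph_def)

end

theory Submission
  imports Defs "HOL-Real_Asymp.Real_Asymp"
begin

text \<open>If $G$ arrows $(H_1, H_2)$, take a minimal pair of families of copies of $H_1$ and of $H_2$ in $G$
  such that no colouring avoids both a red member of the first and a blue member of the second.
  By minimality, every edge of a copy in one family is the only common edge with some copy in the
  other. Explore the union of these copies: attach a copy of $H_2$ along an explored edge and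
  then a copy of $H_1$ along each of its new edges. For $p = n^{-1/m}$ with $m = m_k(H_1, H_2)$ such a
  step preserves the order of the expected number of explored graphs if all the attached copies
  are otherwise disjoint (a regular step), and loses a power of $n$ if not (a degenerate step).

  Regular steps leave more and more edges that still lack a copy, and a degenerate step can only
  repair boundedly many of them. So an exploration that ends with boundedly many degenerate steps
  has bounded size. By minimality the explored graph then arrows $(H_1, H_2)$ itself, and by
  hypothesis it has a subgraph of bounded size and density above $m$, which $G^k_{n,p}$ is unlikely to
  contain. Otherwise there are many degenerate steps, or at least logarithmically many regular ones,
  each of which costs a factor that is small with $b$; a first moment computation excludes both.\<close>

section \<open>Attaching copies of $H_1$ and $H_2$\<close>

text \<open>The order of the constants is what makes the counting work. A regular step gains only a
  constant factor \<open>b\<close>, so the number of its choices must be bounded before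
  \<open>b\<close> is fixed, although explorations grow to logarithmic size. States in which any
  explored edge may be continued are therefore kept below a size \<open>K\<close> that depends on
  the number \<open>D\<close> of tolerated degenerate steps, but not on the number \<open>L\<close>
  of regular ones. Thus \<open>M\<close>, the density gap and \<open>D\<close> determine
  \<open>K\<close>, \<open>K\<close> determines \<open>b\<close>, and \<open>L\<close> is free to
  grow with \<open>n\<close>. The asymmetric case shapes the step itself. A new edge of a copy of H2
  has to be counted with weight \<open>1/m2\<close> and not \<open>1/m\<close>: the copy of H1
  placed on it brings \<open>v1 - k\<close> vertices and \<open>e1\<close> edges, a net change of
  \<open>-1/m2\<close> in \<open>lam\<close>. Copies of H1 that share edges are handled as one
  cluster. The condition \<open>m2 > 1\<close> matters in two ways. H2 has at least three edges, so
  a regular step that attaches H2 leaves at least two fresh copies of H1 while it can spoil only one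
  old copy; and no vertex of H2 lies in exactly one edge, so an intact copy of H1 always forces
  unexplored edges.\<close>

text \<open>\<open>m\<close> and \<open>m2\<close> stand for $m_k(H_1, H_2)$ and $m_k(H_2)$, \<open>HA\<close> and \<open>HB\<close> for the
  copies of $H_1$ and $H_2$ on vertices in the natural numbers.\<close>

locale ramsey_pair =
  fixes k v1 e1 v2 e2 :: nat and m m2 :: real and HA HB :: "nat hypergraph set"
  assumes k_ge2: "k \<ge> 2" and m2_gt1: "m2 > 1" and m2_le_m: "m2 \<le> m"
    and HA_kgraph: "\<And>A. A \<in> HA \<Longrightarrow> kgraph k A"
    and HA_nv: "\<And>A. A \<in> HA \<Longrightarrow> nv A = v1"
    and HA_ne: "\<And>A. A \<in> HA \<Longrightarrow> ne A = e1"
    and e1_ge2: "e1 \<ge> 2"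
    and HA_lam: "real v1 - real e1 / m = real k - 1 / m2"
    and HA_sub: "\<And>A J. A \<in> HA \<Longrightarrow> subhypergraph J A \<Longrightarrow> nv J \<ge> k \<Longrightarrow>
      real (nv J) - real (ne J) / m \<ge> real k - 1 / m2"
    and HA_sub_eq: "\<And>A J. A \<in> HA \<Longrightarrow> subhypergraph J A \<Longrightarrow> nv J \<ge> k \<Longrightarrow>
      real (nv J) - real (ne J) / m = real k - 1 / m2 \<Longrightarrow>
      J = A \<or> nv J = k \<and> ne J = 1 \<and> m = m2"
    and HB_kgraph: "\<And>B. B \<in> HB \<Longrightarrow> kgraph k B"
    and HB_nv: "\<And>B. B \<in> HB \<Longrightarrow> nv B = v2"
    and HB_ne: "\<And>B. B \<in> HB \<Longrightarrow> ne B = e2"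
    and v2_gt_k: "v2 > k"
    and HB_eqn: "real e2 - 1 = m2 * (real v2 - real k)"
    and HB_sub: "\<And>B J. B \<in> HB \<Longrightarrow> subhypergraph J B \<Longrightarrow> edges J \<noteq> {} \<Longrightarrow>
      real (ne J) - 1 \<le> m2 * (real (nv J) - real k)"
    and HB_sub_eq: "\<And>B J. B \<in> HB \<Longrightarrow> subhypergraph J B \<Longrightarrow> edges J \<noteq> {} \<Longrightarrow>
      real (ne J) - 1 = m2 * (real (nv J) - real k) \<Longrightarrow> J = B \<or> nv J = k"
begin

text \<open>With $p = n^{-1/m}$ the expected number of copies of a fixed $(V, E)$ in $G^k_{n,p}$ is of
  order $n$ to the power \<open>lam V E\<close>.\<close>

definition lam :: "nat set \<Rightarrow> nat set set \<Rightarrow> real" where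
  "lam V E = real (card V) - real (card E) / m"

lemma m_pos: "m > 0" and m2_pos: "m2 > 0"
  using m2_gt1 m2_le_m by auto

text \<open>Inclusion-exclusion on vertices and on edges: attaching a graph changes
  \<open>lam\<close> by the \<open>lam\<close> of that graph minus the \<open>lam\<close> of the
  overlap. Every gain or loss below is read off from this.\<close>

lemma lam_Un:
  assumes "finite V" "finite V'" "finite E" "finite E'"
  shows "lam (V \<union> V') (E \<union> E') = lam V E + lam V' E' - lam (V \<inter> V') (E \<inter> E')"
proof -
  have "real (card (V \<union> V')) = real (card V) + real (card V') - real (card (V \<inter> V'))"
    using card_Un_Int[OF assms(1,2)] by linarith
  moreover have "real (card (E \<union> E')) = real (card E) + real (card E') - real (card (E \<inter> E'))"
    using card_Un_Int[OF assms(3,4)] by linarith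
  ultimately show ?thesis by (simp add: lam_def diff_divide_distrib add_divide_distrib)
qed

lemma e2_ge3: "e2 \<ge> 3"
proof -
  have "1 * (real v2 - real k) < m2 * (real v2 - real k)"
    using m2_gt1 v2_gt_k by (intro mult_strict_right_mono) auto
  then have "real v2 - real k < real e2 - 1" using HB_eqn by simp
  moreover have "1 \<le> real v2 - real k" using v2_gt_k by linarith
  ultimately have "real e2 > 2" by linarith
  then show ?thesis by linarith
qed

lemma HA_fin: "A \<in> HA \<Longrightarrow> finite (verts A)" "A \<in> HA \<Longrightarrow> finite (edges A)"
  "A \<in> HA \<Longrightarrow> e \<in> edges A \<Longrightarrow> card e = k" "A \<in> HA \<Longrightarrow> e \<in> edges A \<Longrightarrow> e \<subseteq> verts A"
  "A \<in> HA \<Longrightarrow> e \<in> edges A \<Longrightarrow> finite e"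
  using HA_kgraph[of A] by (auto simp: kgraph_def nsets_def finite_subset intro: finite_subset[of _ "Pow (verts A)"])

lemma HB_fin: "A \<in> HB \<Longrightarrow> finite (verts A)" "A \<in> HB \<Longrightarrow> finite (edges A)"
  "A \<in> HB \<Longrightarrow> e \<in> edges A \<Longrightarrow> card e = k" "A \<in> HB \<Longrightarrow> e \<in> edges A \<Longrightarrow> e \<subseteq> verts A"
  "A \<in> HB \<Longrightarrow> e \<in> edges A \<Longrightarrow> finite e"
  using HB_kgraph[of A] by (auto simp: kgraph_def nsets_def finite_subset intro: finite_subset[of _ "Pow (verts A)"])

text \<open>The equation says that H1 attains the maximum \<open>m\<close>, with denominators
  cleared. Relative to the \<open>k\<close> vertices of an edge, a copy of H1 thus weighs
  \<open>-1/m2\<close>, as an edge would if \<open>m2\<close> replaced \<open>m\<close>.\<close>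

lemma lam_HA: "A \<in> HA \<Longrightarrow> lam (verts A) (edges A) = real k - 1 / m2"
  using HA_lam HA_nv HA_ne by (simp add: lam_def)

lemma lam_inter_HA:
  assumes "A \<in> HA" "\<Union>E \<subseteq> V" "card (V \<inter> verts A) \<ge> k"
  shows "lam (V \<inter> verts A) (E \<inter> edges A) \<ge> real k - 1 / m2"
    and "lam (V \<inter> verts A) (E \<inter> edges A) = real k - 1 / m2 \<Longrightarrow> \<not> subhypergraph A (V, E) \<Longrightarrow>
      card (V \<inter> verts A) = k \<and> card (E \<inter> edges A) = 1 \<and> m = m2"
proof -
  let ?J = "(V \<inter> verts A, E \<inter> edges A)"
  have s: "subhypergraph ?J A"
    using assms(2) HA_fin(4)[OF assms(1)] by (fastforce simp: subhypergraph_def)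
  show "lam (V \<inter> verts A) (E \<inter> edges A) \<ge> real k - 1 / m2"
    using HA_sub[OF assms(1) s] assms(3) by (simp add: lam_def)
  show "card (V \<inter> verts A) = k \<and> card (E \<inter> edges A) = 1 \<and> m = m2"
    if "lam (V \<inter> verts A) (E \<inter> edges A) = real k - 1 / m2" "\<not> subhypergraph A (V, E)"
  proof -
    have "?J \<noteq> A"
    proof
      assume "?J = A"
      then have "V \<inter> verts A = verts A" "E \<inter> edges A = edges A" by (metis fst_conv, metis snd_conv)
      then have "subhypergraph A (V, E)"
        using HA_fin(4)[OF assms(1)] by (auto simp: subhypergraph_def)
      then show False using that by simp
    qed
    then show ?thesis using HA_sub_eq[OF assms(1) s] that(1) assms(3) by (auto simp: lam_def)
  qed
qed

lemma card_inter_edge: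
  assumes "finite V" "f \<subseteq> V" "f \<subseteq> W" "card f = k"
  shows "card (V \<inter> W) \<ge> k"
  using card_mono[of "V \<inter> W" f] assms by auto

lemma inter_eq_edge:
  assumes "finite V" "f \<subseteq> V" "f \<subseteq> W" "card f = k" "card (V \<inter> W) = k"
  shows "V \<inter> W = f"
  using assms by (metis Int_greatest card_subset_eq finite_Int)

text \<open>The overlap contains an edge, so it has at least \<open>k\<close> vertices and
  balancedness of H1 bounds its \<open>lam\<close> from below by that of \<open>A\<close>. If
  \<open>A\<close> is not contained, equality leaves only a single edge as overlap, and its
  \<open>lam\<close>, which is \<open>k - 1/m\<close>, equals \<open>k - 1/m2\<close> only for
  \<open>m = m2\<close>.\<close>

lemma attach_HA:
  assumes "A \<in> HA" "finite V" "finite E" "\<Union>E \<subseteq> V" "E \<inter> edges A \<noteq> {}"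
  shows "lam (V \<union> verts A) (E \<union> edges A) \<le> lam V E"
    and "lam (V \<union> verts A) (E \<union> edges A) = lam V E \<Longrightarrow> \<not> subhypergraph A (V, E) \<Longrightarrow>
      m = m2 \<and> (\<exists>g. V \<inter> verts A = g \<and> E \<inter> edges A = {g})"
proof -
  obtain g where g: "g \<in> E" "g \<in> edges A" using assms(5) by auto
  have gs: "g \<subseteq> V" "g \<subseteq> verts A" "card g = k"
    using g assms(4) HA_fin[OF assms(1)] by auto
  have c: "card (V \<inter> verts A) \<ge> k" using card_inter_edge[OF assms(2) gs] .
  have u: "lam (V \<union> verts A) (E \<union> edges A) =
      lam V E + (real k - 1 / m2) - lam (V \<inter> verts A) (E \<inter> edges A)"
    using lam_Un[OF assms(2) HA_fin(1)[OF assms(1)] assms(3) HA_fin(2)[OF assms(1)]] lam_HA[OF assms(1)]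
    by simp
  show "lam (V \<union> verts A) (E \<union> edges A) \<le> lam V E"
    using u lam_inter_HA(1)[OF assms(1,4) c] by linarith
  show "m = m2 \<and> (\<exists>g. V \<inter> verts A = g \<and> E \<inter> edges A = {g})"
    if eq: "lam (V \<union> verts A) (E \<union> edges A) = lam V E" "\<not> subhypergraph A (V, E)"
  proof -
    have *: "card (V \<inter> verts A) = k" "card (E \<inter> edges A) = 1" "m = m2"
      using lam_inter_HA(2)[OF assms(1,4) c _ eq(2)] u eq(1) by auto
    have "V \<inter> verts A = g" using inter_eq_edge[OF assms(2) gs *(1)] .
    moreover have "E \<inter> edges A = {g}" using *(2) g by (metis IntI card_1_singletonE singletonD)
    ultimately show ?thesis using *(3) by blast
  qed
qed

text \<open>The step of the exploration: a copy \<open>B\<close> of $H_2$ is attached along an edge, and a copy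
  \<open>Af f\<close> of $H_1$ is attached to each new edge \<open>f\<close> of \<open>B\<close>. For $m > m_k(H_2)$ attaching \<open>B\<close>
  alone may increase \<open>lam\<close>; only the whole step is guaranteed not to.\<close>

context
  fixes V :: "nat set" and E :: "nat set set" and B :: "nat hypergraph"
    and e :: "nat set"
  assumes finV: "finite V" and finE: "finite E" and EV: "\<Union>E \<subseteq> V"
    and B: "B \<in> HB" and e: "e \<in> E" "e \<in> edges B" and nsub: "\<not> subhypergraph B (V, E)"
begin

abbreviation "new_edges \<equiv> edges B - E"

lemma finite_new_edges: "finite new_edges" using HB_fin(2)[OF B] by simp

lemma B_inter_sub: "subhypergraph (V \<inter> verts B, E \<inter> edges B) B"
  using EV HB_fin(4)[OF B] by (fastforce simp: subhypergraph_def)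

text \<open>The weight is \<open>1/m2\<close>, not the \<open>1/m\<close> of \<open>lam\<close>,
  because each new edge will enter together with a copy of H1. In this weighting the claim is
  k-balancedness of H2, applied to the part of \<open>B\<close> that is already explored.\<close>

lemma HB_density:
  shows "real (card (verts B - V)) - real (card new_edges) / m2 \<le> 0"
    and "real (card (verts B - V)) - real (card new_edges) / m2 = 0 \<Longrightarrow> V \<inter> verts B = e \<and> E \<inter> edges B = {e}"
proof -
  let ?J = "(V \<inter> verts B, E \<inter> edges B)"
  have ne: "edges ?J \<noteq> {}" using e by auto
  have cV: "real (card (verts B - V)) = real v2 - real (card (V \<inter> verts B))"
    using card_Diff_subset_Int[of "verts B" V] HB_fin(1)[OF B] HB_nv[OF B] finV
      card_mono[of "verts B" "V \<inter> verts B"]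
    by (simp add: Int_commute)
  have cE: "real (card new_edges) = real e2 - real (card (E \<inter> edges B))"
    using card_Diff_subset_Int[of "edges B" E] HB_fin(2)[OF B] HB_ne[OF B] finE
      card_mono[of "edges B" "E \<inter> edges B"]
    by (simp add: Int_commute)
  have es: "e \<subseteq> V" "e \<subseteq> verts B" "card e = k" using e EV HB_fin[OF B] by auto
  have key: "real (card (verts B - V)) - real (card new_edges) / m2 =
    ((real (card (E \<inter> edges B)) - 1) - m2 * (real (card (V \<inter> verts B)) - real k)) / m2"
  proof -
    have "m2 * (real (card (verts B - V)) - real (card new_edges) / m2) =
      m2 * real (card (verts B - V)) - real (card new_edges)"
      using m2_pos by (simp add: right_diff_distrib)
    also have "\<dots> = (real (card (E \<inter> edges B)) - 1) - m2 * (real (card (V \<inter> verts B)) - real k)"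
      using HB_eqn unfolding cV cE by (simp add: algebra_simps)
    finally have "m2 * (real (card (verts B - V)) - real (card new_edges) / m2) =
      (real (card (E \<inter> edges B)) - 1) - m2 * (real (card (V \<inter> verts B)) - real k)" .
    moreover have "x = y / m2" if "m2 * x = y" for x y using that m2_pos by auto
    ultimately show ?thesis by blast
  qed
  show "real (card (verts B - V)) - real (card new_edges) / m2 \<le> 0"
    unfolding key using HB_sub[OF B B_inter_sub ne] m2_pos
    by (intro divide_nonpos_pos) auto
  assume "real (card (verts B - V)) - real (card new_edges) / m2 = 0"
  then have "real (ne ?J) - 1 = m2 * (real (nv ?J) - real k)"
    unfolding key using m2_pos by simp
  moreover have "?J \<noteq> B"
  proof
    assume "?J = B"
    then have "V \<inter> verts B = verts B" "E \<inter> edges B = edges B" by (metis fst_conv, metis snd_conv)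
    then have "subhypergraph B (V, E)" using HB_fin(4)[OF B] by (auto simp: subhypergraph_def)
    then show False using nsub by simp
  qed
  ultimately have c: "card (V \<inter> verts B) = k" using HB_sub_eq[OF B B_inter_sub ne] by auto
  then have i: "V \<inter> verts B = e" using inter_eq_edge[OF finV es] by simp
  have "E \<inter> edges B \<subseteq> {e}"
  proof
    fix h assume h: "h \<in> E \<inter> edges B"
    then have "h \<subseteq> V \<inter> verts B" "card h = k" using EV HB_fin[OF B] by auto
    then have "h = e" using i es by (metis HB_fin(5)[OF B] card_subset_eq e(2))
    then show "h \<in> {e}" by simp
  qed
  then show "V \<inter> verts B = e \<and> E \<inter> edges B = {e}" using i e by auto
qed

text \<open>For \<open>m = m2\<close> the two weightings agree, so attaching \<open>B\<close> alone
  is already controlled.\<close>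

lemma lam_B_sym:
  assumes "m = m2"
  shows "lam (V \<union> verts B) (E \<union> edges B) =
    lam V E + (real (card (verts B - V)) - real (card new_edges) / m2)"
proof -
  have "real (card (V \<union> verts B)) = real (card V) + real (card (verts B - V))"
    using card_Un_disjoint[of V "verts B - V"] finV HB_fin(1)[OF B] by simp
  moreover have "real (card (E \<union> edges B)) = real (card E) + real (card new_edges)"
    using card_Un_disjoint[of E "edges B - E"] finE HB_fin(2)[OF B] by simp
  ultimately show ?thesis by (simp add: lam_def add_divide_distrib flip: assms)
qed

lemma attach_HB_sym:
  assumes "m = m2"
  shows "lam (V \<union> verts B) (E \<union> edges B) \<le> lam V E"
    and "lam (V \<union> verts B) (E \<union> edges B) = lam V E \<Longrightarrow> V \<inter> verts B = e \<and> E \<inter> edges B = {e}"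
  using HB_density lam_B_sym[OF assms] by auto

section \<open>Clusters of copies of H1 on the new edges of a copy of H2\<close>

context
  fixes Af :: "nat set \<Rightarrow> nat hypergraph"
  assumes Af: "\<And>f. f \<in> new_edges \<Longrightarrow> Af f \<in> HA"
    and AfB: "\<And>f. f \<in> new_edges \<Longrightarrow> edges (Af f) \<inter> edges B = {f}"
    and disj: "\<And>f. f \<in> new_edges \<Longrightarrow> edges (Af f) \<inter> E = {}"
begin

abbreviation verts_of :: "nat set set \<Rightarrow> nat set" where "verts_of S \<equiv> (\<Union>f\<in>S. verts (Af f))"
abbreviation edges_of :: "nat set set \<Rightarrow> nat set set" where "edges_of S \<equiv> (\<Union>f\<in>S. edges (Af f))"


lemma cluster_finite:
  assumes "S \<subseteq> new_edges" shows "finite S" "finite (verts_of S)" "finite (edges_of S)" "\<Union>(edges_of S) \<subseteq> verts_of S"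
proof -
  show "finite S" using assms finite_new_edges by (rule finite_subset)
  then show "finite (verts_of S)" "finite (edges_of S)" using assms Af HA_fin by blast+
  show "\<Union>(edges_of S) \<subseteq> verts_of S" using assms Af HA_fin(4) by blast
qed

lemma f_in_Af: "f \<in> new_edges \<Longrightarrow> f \<in> edges (Af f)" "f \<in> new_edges \<Longrightarrow> f \<subseteq> verts (Af f)"
  "f \<in> new_edges \<Longrightarrow> f \<subseteq> verts B" "f \<in> new_edges \<Longrightarrow> card f = k"
proof -
  show f: "f \<in> edges (Af f)" if "f \<in> new_edges" for f using AfB[OF that] by blast
  show "f \<in> new_edges \<Longrightarrow> f \<subseteq> verts (Af f)" using HA_fin(4)[OF Af f] .
  show "f \<in> new_edges \<Longrightarrow> f \<subseteq> verts B" "f \<in> new_edges \<Longrightarrow> card f = k" using HB_fin(3,4)[OF B] by auto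
qed

text \<open>Connectedness through common edges, grown one copy at a time so that
  \<open>attach_HA\<close> applies to each insertion. Different maximal clusters can then share
  vertices only.\<close>

inductive conn :: "nat set set \<Rightarrow> bool" where
  conn_single: "f \<in> new_edges \<Longrightarrow> conn {f}"
| conn_insert: "conn S \<Longrightarrow> f \<in> new_edges \<Longrightarrow> f \<notin> S \<Longrightarrow> edges_of S \<inter> edges (Af f) \<noteq> {} \<Longrightarrow> conn (insert f S)"

lemma conn_sub: "conn S \<Longrightarrow> S \<subseteq> new_edges"
  by (induction rule: conn.induct) auto

text \<open>Every insertion shares an edge with the union so far and cannot raise
  \<open>lam\<close>, so a cluster stays at or below the value of its first copy.\<close>

lemma conn_lam: "conn S \<Longrightarrow> lam (verts_of S) (edges_of S) \<le> real k - 1 / m2"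
proof (induction rule: conn.induct)
  case (conn_single f)
  then show ?case using lam_HA[OF Af] by simp
next
  case (conn_insert S f)
  have "lam (verts_of S \<union> verts (Af f)) (edges_of S \<union> edges (Af f)) \<le> lam (verts_of S) (edges_of S)"
    using cluster_finite[OF conn_sub[OF conn_insert(1)]] conn_insert(2,4)
    by (intro attach_HA(1) Af) auto
  then show ?case using conn_insert by (simp add: Un_ac)
qed

lemma conn_maximal:
  assumes "R' \<subseteq> new_edges" "f \<in> R'"
  obtains S where "conn S" "f \<in> S" "S \<subseteq> R'" "edges_of (R' - S) \<inter> edges_of S = {}"
proof -
  let ?P = "\<lambda>S. conn S \<and> f \<in> S \<and> S \<subseteq> R'"
  have "?P {f}" using assms conn_single[of f] by auto
  moreover have "\<forall>S. ?P S \<longrightarrow> card S < Suc (card R')"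
    using card_mono[OF finite_subset[OF assms(1) finite_new_edges]] by (simp add: less_Suc_eq_le)
  ultimately have "\<exists>S. ?P S \<and> (\<forall>S'. ?P S' \<longrightarrow> card S' \<le> card S)"
    by (rule ex_has_greatest_nat)
  then obtain S where S: "conn S" "f \<in> S" "S \<subseteq> R'" and max: "\<And>S'. ?P S' \<Longrightarrow> card S' \<le> card S"
    by blast
  have "edges_of (R' - S) \<inter> edges_of S = {}"
  proof (rule ccontr)
    assume "edges_of (R' - S) \<inter> edges_of S \<noteq> {}"
    then obtain f' where f': "f' \<in> R'" "f' \<notin> S" "edges_of S \<inter> edges (Af f') \<noteq> {}" by blast
    have "conn (insert f' S)" using S(1,3) f' assms(1) by (intro conn_insert) auto
    then have "?P (insert f' S)" using S f' by blast
    then have "card (insert f' S) \<le> card S" by (rule max)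
    then show False using f'(2) cluster_finite(1)[OF conn_sub[OF S(1)]] by simp
  qed
  then show ?thesis using that[OF S] by blast
qed

text \<open>Balancedness of $H_2$ compensates the \<open>card S\<close> edges of \<open>B\<close> that share the
  connected cluster \<open>S\<close>: they span at least $k + (|S| - 1) / m_k(H_2)$ vertices.\<close>

lemma cluster_step:
  assumes "R' \<subseteq> new_edges" "conn S" "S \<subseteq> R'" "edges_of (R' - S) \<inter> edges_of S = {}" "f \<in> S"
  defines "W \<equiv> V \<union> verts B \<union> verts_of (R' - S)"
  shows "lam (V \<union> verts B \<union> verts_of R') (E \<union> edges_of R') \<le> lam W (E \<union> edges_of (R' - S)) - real (card S) / m2"
    and "lam (V \<union> verts B \<union> verts_of R') (E \<union> edges_of R') = lam W (E \<union> edges_of (R' - S)) - real (card S) / m2 \<Longrightarrow>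
      S = {f} \<and> W \<inter> verts (Af f) = f"
proof -
  have sub: "R' - S \<subseteq> new_edges" "S \<subseteq> new_edges" using assms by auto
  have fin: "finite W" "finite (E \<union> edges_of (R' - S))"
    using cluster_finite[OF sub(1)] finV finE HB_fin(1)[OF B] unfolding W_def by auto
  have u1: "verts_of R' = verts_of (R' - S) \<union> verts_of S" "edges_of R' = edges_of (R' - S) \<union> edges_of S" using assms(3) by blast+
  \<comment> \<open>No edge is shared, so the overlap in \<open>lam_Un\<close> counts through its
    vertices only.\<close>
  have "(E \<union> edges_of (R' - S)) \<inter> edges_of S = {}" using assms(4) disj sub(2) by blast
  then have eq: "lam (V \<union> verts B \<union> verts_of R') (E \<union> edges_of R') =
      lam W (E \<union> edges_of (R' - S)) + lam (verts_of S) (edges_of S) - real (card (W \<inter> verts_of S))"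
    using lam_Un[OF fin(1) cluster_finite(2)[OF sub(2)] fin(2) cluster_finite(3)[OF sub(2)]]
    by (simp add: u1 W_def Un_ac lam_def)
  \<comment> \<open>The edges of \<open>S\<close> seen inside \<open>B\<close>: balancedness of H2
    makes them span many vertices, all of which lie in the overlap.\<close>
  let ?J = "(\<Union>S, S)"
  have J: "subhypergraph ?J B" "edges ?J \<noteq> {}"
    using sub(2) HB_fin(4)[OF B] assms(5) by (auto simp: subhypergraph_def)
  have US: "\<Union>S \<subseteq> W \<inter> verts_of S" using sub(2) f_in_Af(2,3) unfolding W_def by blast
  have c1: "card (\<Union>S) \<le> card (W \<inter> verts_of S)" using card_mono[OF _ US] fin(1) by simp
  have c2: "(real (card S) - 1) / m2 \<le> real (card (\<Union>S)) - real k"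
    using HB_sub[OF B J] m2_pos by (simp add: field_simps)
  have c3: "(real (card S) - 1) / m2 = real (card S) / m2 - 1 / m2" by (simp add: diff_divide_distrib)
  show "lam (V \<union> verts B \<union> verts_of R') (E \<union> edges_of R') \<le> lam W (E \<union> edges_of (R' - S)) - real (card S) / m2"
    using eq conn_lam[OF assms(2)] c1 c2 c3 by linarith
  assume "lam (V \<union> verts B \<union> verts_of R') (E \<union> edges_of R') = lam W (E \<union> edges_of (R' - S)) - real (card S) / m2"
  then have t: "real (card (W \<inter> verts_of S)) \<le> real (card S) / m2 - 1 / m2 + real k"
    using eq conn_lam[OF assms(2)] by linarith
  then have "(real (card S) - 1) / m2 = real (card (\<Union>S)) - real k" using c1 c2 c3 by linarith
  then have "real (ne ?J) - 1 = m2 * (real (nv ?J) - real k)" using m2_pos by (simp add: field_simps)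
  \<comment> \<open>The edge \<open>e\<close> belongs to \<open>B\<close> and is not new, so it is
    missing from \<open>S\<close>.\<close>
  moreover have "?J \<noteq> B" using sub(2) e by (metis Diff_iff snd_conv subsetD)
  ultimately have ck: "card (\<Union>S) = k" using HB_sub_eq[OF B J] by auto
  have fU: "finite (\<Union>S)" using US fin(1) by (meson finite_Int finite_subset)
  have all: "h = \<Union>S" if "h \<in> S" for h
    using that f_in_Af(4)[of h] sub(2) ck fU by (metis Sup_upper card_subset_eq subsetD)
  then have S: "S = {f}" using assms(5) by auto
  have "real (card (W \<inter> verts_of S)) \<le> real k" using t S by simp
  then have "card (W \<inter> verts_of S) = k" using c1 ck by linarith
  then have "W \<inter> verts_of S = \<Union>S" using US ck fin(1) by (metis card_subset_eq finite_Int)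
  then show "S = {f} \<and> W \<inter> verts (Af f) = f" using S by simp
qed

text \<open>Maximal clusters are peeled off one by one. The right-hand side has the vertices of
  \<open>B\<close> but none of its new edges, since each new edge \<open>f\<close> is an edge of
  \<open>Af f\<close> and enters with it.\<close>

lemma cluster_le:
  assumes "R' \<subseteq> new_edges"
  shows "lam (V \<union> verts B \<union> verts_of R') (E \<union> edges_of R') \<le> lam (V \<union> verts B) E - real (card R') / m2"
  using assms
proof (induction "card R'" arbitrary: R' rule: less_induct)
  case less
  show ?case
  proof (cases "R' = {}")
    case False
    then obtain f where f: "f \<in> R'" by auto
    obtain S where S: "conn S" "f \<in> S" "S \<subseteq> R'" "edges_of (R' - S) \<inter> edges_of S = {}"
      using conn_maximal[OF less(2) f] by blast
    have fin: "finite R'" "finite S" using less(2) S(3) finite_new_edges by (auto dest: finite_subset)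
    have lt: "card (R' - S) < card R'"
      using S f fin by (intro psubset_card_mono) auto
    have "real (card (R' - S)) = real (card R') - real (card S)"
      using card_Diff_subset[OF fin(2) S(3)] card_mono[OF fin(1) S(3)] by simp
    moreover have "R' - S \<subseteq> new_edges" using less(2) by blast
    ultimately show ?thesis
      using less(1)[OF lt] cluster_step(1)[OF less(2) S(1,3,4,2)]
      by (auto simp: diff_divide_distrib)
  qed simp
qed

text \<open>The new vertices of \<open>B\<close> raise \<open>lam\<close> and each new edge lowers
  it by \<open>1/m2\<close> through its cluster; the balance is the quantity of
  \<open>HB_density\<close>. If nothing is lost, all inequalities are tight in whatever order the
  clusters are peeled off, so the analysis of \<open>f\<close> starts with the cluster of
  \<open>f\<close>.\<close>

lemma attach_pair:
  defines "V' \<equiv> V \<union> verts B \<union> verts_of new_edges" and "E' \<equiv> E \<union> edges_of new_edges"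
  shows "lam V' E' \<le> lam V E"
    and "lam V' E' = lam V E \<Longrightarrow> V \<inter> verts B = e \<and> E \<inter> edges B = {e} \<and>
      (\<forall>f\<in>new_edges. (V \<union> verts B \<union> verts_of (new_edges - {f})) \<inter> verts (Af f) = f)"
proof -
  have l0: "lam (V \<union> verts B) E = lam V E + real (card (verts B - V))"
    using card_Un_disjoint[of V "verts B - V"] finV HB_fin(1)[OF B] by (simp add: lam_def)
  have le: "lam V' E' \<le> lam (V \<union> verts B) E - real (card new_edges) / m2"
    using cluster_le[of new_edges] unfolding V'_def E'_def by simp
  show "lam V' E' \<le> lam V E" using le l0 HB_density(1) by linarith
  assume eq0: "lam V' E' = lam V E"
  then have z: "real (card (verts B - V)) - real (card new_edges) / m2 = 0"
    and eq: "lam V' E' = lam (V \<union> verts B) E - real (card new_edges) / m2"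
    using le l0 HB_density(1) by linarith+
  have fresh: "(V \<union> verts B \<union> verts_of (new_edges - {f})) \<inter> verts (Af f) = f" if f: "f \<in> new_edges" for f
  proof -
    obtain S where S: "conn S" "f \<in> S" "S \<subseteq> new_edges" "edges_of (new_edges - S) \<inter> edges_of S = {}"
      using conn_maximal[OF _ f] by blast
    have fin: "finite S" using S(3) finite_new_edges by (auto dest: finite_subset)
    have "real (card (new_edges - S)) = real (card new_edges) - real (card S)"
      using card_Diff_subset[OF fin S(3)] card_mono[OF finite_new_edges S(3)] by simp
    then have "lam (V \<union> verts B \<union> verts_of (new_edges - S)) (E \<union> edges_of (new_edges - S)) \<le>
        lam (V \<union> verts B) E - real (card new_edges) / m2 + real (card S) / m2"
      using cluster_le[of "new_edges - S"] by (auto simp: diff_divide_distrib)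
    then have "lam V' E' = lam (V \<union> verts B \<union> verts_of (new_edges - S)) (E \<union> edges_of (new_edges - S)) - real (card S) / m2"
      using eq cluster_step(1)[OF order_refl S(1,3,4,2)] unfolding V'_def E'_def by linarith
    then have "S = {f}" and W: "(V \<union> verts B \<union> verts_of (new_edges - S)) \<inter> verts (Af f) = f"
      using cluster_step(2)[OF order_refl S(1,3,4,2)] unfolding V'_def E'_def by auto
    show ?thesis using W unfolding \<open>S = {f}\<close> .
  qed
  show "V \<inter> verts B = e \<and> E \<inter> edges B = {e} \<and>
      (\<forall>f\<in>new_edges. (V \<union> verts B \<union> verts_of (new_edges - {f})) \<inter> verts (Af f) = f)"
  proof (intro conjI ballI)
    show "V \<inter> verts B = e" "E \<inter> edges B = {e}" using HB_density(2)[OF z] by simp_all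
    show "(V \<union> verts B \<union> verts_of (new_edges - {f})) \<inter> verts (Af f) = f" if "f \<in> new_edges" for f
      using that by (rule fresh)
  qed
qed

end
end
end

section \<open>The exploration of a core\<close>

text \<open>A state \<open>(V, E, I)\<close> consists of the explored subgraph \<open>(V, E)\<close> and a set \<open>I\<close> of
  pairs \<open>(Q, f)\<close>: \<open>Q\<close> is the edge set of an explored copy of $H_1$, attached along its edge \<open>f\<close>.
  Such a pair stays intact as long as every explored edge that meets one of its vertices outside \<open>f\<close>
  belongs to \<open>Q\<close>. Each edge of \<open>Q\<close> other than \<open>f\<close> then still lacks the copy of $H_2$ that it needs,
  so the exploration can continue at an edge chosen as a function of the state alone. This is what
  keeps the number of choices in a regular step bounded.\<close>

type_synonym rooted = "nat set set \<times> nat set"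
type_synonym state = "nat set \<times> nat set set \<times> rooted set"

definition intact :: "nat set set \<Rightarrow> rooted set \<Rightarrow> rooted set" where
  "intact E I = {(Q, f) \<in> I. \<forall>h\<in>E. h \<inter> (\<Union>Q - f) \<noteq> {} \<longrightarrow> h \<in> Q}"

text \<open>With an intact pair left, one non-root edge is singled out from \<open>I\<close> alone,
  so nothing is paid for the choice. Without pairs all explored edges are allowed, which is
  affordable because such states have bounded size.\<close>

definition active_edges :: "nat set set \<Rightarrow> rooted set \<Rightarrow> nat set set" where
  "active_edges E I = (if I = {} then E else {SOME g. \<exists>(Q, f)\<in>I. g \<in> Q \<and> g \<noteq> f})"

text \<open>Regular steps preserve \<open>lam\<close>, degenerate steps decrease it.\<close>

definition reg_step :: "nat \<Rightarrow> real \<Rightarrow> nat \<Rightarrow> state \<Rightarrow> state \<Rightarrow> bool" where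
  "reg_step k m M = (\<lambda>(V, E, I) (V', E', I').
     V \<subseteq> V' \<and> E \<subset> E' \<and> card (V' - V) \<le> M \<and>
     real (card (V' - V)) = real (card (E' - E)) / m \<and>
     (\<exists>g\<in>active_edges E I. card g = k \<and> E' - E \<subseteq> Pow (g \<union> (V' - V)) \<and>
       (\<exists>Y \<subseteq> Pow (Pow (g \<union> (V' - V))) \<times> Pow (g \<union> (V' - V)). I' = intact E' I \<union> Y)))"

definition deg_step :: "nat \<Rightarrow> real \<Rightarrow> nat \<Rightarrow> state \<Rightarrow> state \<Rightarrow> bool" where
  "deg_step k m M = (\<lambda>(V, E, I) (V', E', I').
     V \<subseteq> V' \<and> E \<subseteq> E' \<and> card (V' - V) \<le> M \<and> card (E' - E) \<le> M \<and> E' - E \<subseteq> nsets V' k \<and>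
     real (card (V' - V)) < real (card (E' - E)) / m \<and> I' = intact E' I)"

lemma intact_iff:
  "x \<in> intact E I \<longleftrightarrow> x \<in> I \<and> (\<forall>h\<in>E. h \<inter> (\<Union>(fst x) - snd x) \<noteq> {} \<longrightarrow> h \<in> fst x)"
  by (cases x) (simp add: intact_def)

text \<open>Bounds the vertices and the edges of anything a single step attaches: a copy of H1 or of
  H2, one of each, or a copy of H2 with a copy of H1 on up to \<open>e2\<close> of its
  edges.\<close>

definition (in ramsey_pair) M :: nat where
  "M = v1 + v2 + e1 + e2 + e2 * v1 + e2 * e1"

section \<open>Invariants of the explored states\<close>

locale ramsey_core = ramsey_pair +
  fixes AA BB :: "nat hypergraph set"
  assumes AA: "AA \<subseteq> HA" and BB: "BB \<subseteq> HB"
    and AA_edge: "\<And>A e. A \<in> AA \<Longrightarrow> e \<in> edges A \<Longrightarrow> \<exists>B\<in>BB. edges A \<inter> edges B = {e}"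
    and BB_edge: "\<And>B e. B \<in> BB \<Longrightarrow> e \<in> edges B \<Longrightarrow> \<exists>A\<in>AA. edges A \<inter> edges B = {e}"
begin

definition rooted_ok :: "nat set set \<Rightarrow> rooted \<Rightarrow> bool" where
  "rooted_ok E = (\<lambda>(Q, f). f \<in> Q \<and> Q \<subseteq> E \<and> Q \<in> edges ` AA \<and>
    (\<forall>h\<in>E. h \<inter> (\<Union>Q - f) \<noteq> {} \<longrightarrow> h \<in> Q))"

lemma rooted_ok_iff:
  "rooted_ok E x \<longleftrightarrow> snd x \<in> fst x \<and> fst x \<subseteq> E \<and> fst x \<in> edges ` AA \<and>
    (\<forall>h\<in>E. h \<inter> (\<Union>(fst x) - snd x) \<noteq> {} \<longrightarrow> h \<in> fst x)"
  by (cases x) (simp add: rooted_ok_def)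

lemma rooted_okD:
  assumes "rooted_ok E x"
  shows "snd x \<in> fst x" "fst x \<subseteq> E" "fst x \<in> edges ` AA"
    "\<And>h. h \<in> E \<Longrightarrow> h \<inter> (\<Union>(fst x) - snd x) \<noteq> {} \<Longrightarrow> h \<in> fst x"
  using assms unfolding rooted_ok_iff by simp_all

definition good :: "nat set \<Rightarrow> nat set set \<Rightarrow> rooted set \<Rightarrow> bool" where
  "good V E I \<longleftrightarrow> finite V \<and> E \<subseteq> nsets V k \<and> E \<noteq> {} \<and> finite I \<and> (\<forall>x\<in>I. rooted_ok E x) \<and>
     (\<forall>x\<in>I. \<forall>y\<in>I. x \<noteq> y \<longrightarrow> fst x \<inter> fst y = {})"

lemma goodD:
  assumes "good V E I"
  shows "finite V" "finite E" "\<Union>E \<subseteq> V" "\<And>e. e \<in> E \<Longrightarrow> card e = k" "\<And>e. e \<in> E \<Longrightarrow> finite e"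
    "finite I" "E \<subseteq> nsets V k"
    "\<And>x. x \<in> I \<Longrightarrow> rooted_ok E x"
    "\<And>x y. x \<in> I \<Longrightarrow> y \<in> I \<Longrightarrow> x \<noteq> y \<Longrightarrow> fst x \<inter> fst y = {}"
proof -
  show "finite E" using assms finite_imp_finite_nsets[of V k] by (auto simp: good_def dest: finite_subset)
qed (use assms in \<open>auto simp: good_def nsets_def\<close>)

lemma lam_diff:
  assumes "finite V'" "finite E'" "V \<subseteq> V'" "E \<subseteq> E'"
  shows "lam V' E' - lam V E = real (card (V' - V)) - real (card (E' - E)) / m"
proof -
  have "finite V" "finite E" using assms finite_subset by auto
  then show ?thesis
    using assms by (simp add: lam_def card_Diff_subset card_mono of_nat_diff diff_divide_distrib)
qed

text \<open>A common private vertex lies on an edge of \<open>fst x\<close>. This edge touches the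
  private part of \<open>y\<close>, so it belongs to \<open>fst y\<close> as well, against the
  disjointness of the edge sets.\<close>

lemma rooted_private_disjoint:
  assumes "good V E I" "x \<in> I" "y \<in> I" "x \<noteq> y"
  shows "(\<Union>(fst x) - snd x) \<inter> (\<Union>(fst y) - snd y) = {}"
proof (rule ccontr)
  assume "\<not> ?thesis"
  then obtain z h where z: "z \<in> h" "h \<in> fst x" "z \<in> \<Union>(fst y) - snd y" by blast
  then have "h \<in> E" using rooted_okD(2)[OF goodD(8)[OF assms(1,2)]] by auto
  moreover have "h \<inter> (\<Union>(fst y) - snd y) \<noteq> {}" using z by blast
  ultimately have "h \<in> fst y"
    using rooted_okD(4)[OF goodD(8)[OF assms(1,3)]] by auto
  then show False using goodD(9)[OF assms] z by blast
qed

lemma intact_sub: "intact E' I \<subseteq> I"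
  by (auto simp: intact_def)

lemma card_intact:
  assumes "finite I"
  shows "card I = card (I - intact E I) + card (intact E I)"
proof -
  have "finite (intact E I)" using assms intact_sub finite_subset by blast
  moreover have "(I - intact E I) \<union> intact E I = I" using intact_sub by blast
  ultimately show ?thesis
    using card_Un_disjoint[of "I - intact E I" "intact E I"] assms by (metis Diff_disjoint Int_commute finite_Diff)
qed

lemma good_intact:
  assumes "good V E I" "finite V'" "E \<subseteq> E'" "E' \<subseteq> nsets V' k"
  shows "good V' E' (intact E' I)"
  unfolding good_def
proof (intro conjI ballI impI)
  show "finite (intact E' I)" using intact_sub goodD(6)[OF assms(1)] by (rule finite_subset)
  show "rooted_ok E' x" if "x \<in> intact E' I" for x
  proof -
    have x: "x \<in> I" "\<And>h. h \<in> E' \<Longrightarrow> h \<inter> (\<Union>(fst x) - snd x) \<noteq> {} \<Longrightarrow> h \<in> fst x"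
      using that by (simp_all add: intact_iff)
    show ?thesis
      using rooted_okD[OF goodD(8)[OF assms(1) x(1)]] assms(3) x(2) unfolding rooted_ok_iff
      by (meson subset_trans)
  qed
  show "fst x \<inter> fst y = {}" if "x \<in> intact E' I" "y \<in> intact E' I" "x \<noteq> y" for x y
    using that goodD(9)[OF assms(1)] intact_sub by blast
qed (use assms in \<open>auto simp: good_def\<close>)

lemma broken_meets:
  assumes "good V E I" "x \<in> I - intact E' I"
  obtains h where "h \<in> E' - E" "h \<inter> (\<Union>(fst x) - snd x) \<noteq> {}"
proof -
  obtain h where h: "h \<in> E'" "h \<inter> (\<Union>(fst x) - snd x) \<noteq> {}" "h \<notin> fst x"
    using assms(2) by (auto simp only: intact_iff Diff_iff)
  moreover have "rooted_ok E x" using goodD(8)[OF assms(1)] assms(2) by blast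
  ultimately have "h \<notin> E" using rooted_okD(4) by blast
  then show ?thesis using h that by blast
qed

text \<open>Every broken pair has a private vertex on some new edge. Private parts are disjoint, so
  these vertices are distinct, and \<open>M\<close> new edges cover at most \<open>k * M\<close>
  vertices.\<close>

lemma card_broken:
  assumes "good V E I" "finite E'" "E' \<subseteq> nsets V' k" "card (E' - E) \<le> M"
  shows "card I \<le> card (intact E' I) + k * M"
proof -
  let ?D = "I - intact E' I" and ?U = "\<Union>(E' - E)"
  define z where "z x = (SOME z. z \<in> ?U \<inter> (\<Union>(fst x) - snd x))" for x :: rooted
  have z: "z x \<in> ?U \<inter> (\<Union>(fst x) - snd x)" if x: "x \<in> ?D" for x
  proof -
    obtain h where h: "h \<in> E' - E" "h \<inter> (\<Union>(fst x) - snd x) \<noteq> {}"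
      using broken_meets[OF assms(1) x] by metis
    then obtain y where y: "y \<in> h" "y \<in> \<Union>(fst x) - snd x" by (metis Int_emptyI)
    have "y \<in> ?U \<inter> (\<Union>(fst x) - snd x)" using h(1) y by (meson IntI UnionI)
    then show ?thesis unfolding z_def by (rule someI)
  qed
  have "inj_on z ?D"
  proof (rule inj_onI)
    fix x y assume xy: "x \<in> ?D" "y \<in> ?D" "z x = z y"
    show "x = y"
      using z[OF xy(1)] z[OF xy(2)] xy rooted_private_disjoint[OF assms(1), of x y] by auto
  qed
  have fU: "finite ?U" using assms(2,3) by (auto simp: nsets_def)
  have "card ?D \<le> card ?U"
    using z by (intro card_inj_on_le[OF \<open>inj_on z ?D\<close> _ fU]) (metis IntE image_subsetI)
  also have "\<dots> \<le> (\<Sum>h\<in>E' - E. card h)" by (rule card_Union_le_sum_card)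
  also have "\<dots> = k * card (E' - E)" using assms(3) by (auto simp: nsets_def subset_iff)
  also have "\<dots> \<le> k * M" using assms(4) by simp
  finally have "card ?D \<le> k * M" .
  moreover have "card I = card ?D + card (intact E' I)"
    using card_intact goodD(6)[OF assms(1)] .
  ultimately show ?thesis by linarith
qed

section \<open>Steps available to the exploration\<close>

definition world_V :: "nat set" where "world_V = \<Union>(verts ` (AA \<union> BB))"
definition world_E :: "nat set set" where "world_E = \<Union>(edges ` (AA \<union> BB))"

text \<open>The two bounds on \<open>card I\<close> give the bookkeeping
  \<open>r \<le> card I + k * M * d\<close> after \<open>r\<close> regular and \<open>d\<close>
  degenerate steps.\<close>

definition can_step :: "nat set \<Rightarrow> nat set set \<Rightarrow> rooted set \<Rightarrow> bool" where
  "can_step V E I \<longleftrightarrow> (\<exists>V' E' I'. good V' E' I' \<and> V \<subseteq> V' \<and> E \<subseteq> E' \<and>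
     V' \<subseteq> V \<union> world_V \<and> E' \<subseteq> E \<union> world_E \<and> card (V' - V) \<le> M \<and> card (E' - E) \<le> M \<and>
     (reg_step k m M (V, E, I) (V', E', I') \<and> card I + 1 \<le> card I' \<or>
      deg_step k m M (V, E, I) (V', E', I') \<and> card I \<le> card I' + k * M))"

lemma can_step_deg:
  assumes "good V E I" "finite V'" "V \<subseteq> V'" "E \<subseteq> E'" "E' \<subseteq> nsets V' k"
    "V' \<subseteq> V \<union> world_V" "E' \<subseteq> E \<union> world_E" "card (V' - V) \<le> M" "card (E' - E) \<le> M" "lam V' E' < lam V E"
  shows "can_step V E I"
proof -
  have fE: "finite E'" using assms(2,5) finite_imp_finite_nsets finite_subset by metis
  have "deg_step k m M (V, E, I) (V', E', intact E' I)"
    using assms lam_diff[OF assms(2) fE assms(3,4)] by (auto simp: deg_step_def)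
  then show ?thesis
    using good_intact[OF assms(1,2,4,5)] card_broken[OF assms(1) fE assms(5,9)] assms
    unfolding can_step_def by blast
qed

text \<open>The new edges lie on \<open>g\<close> and new vertices, so they can reach a private
  vertex of an old pair only inside \<open>g\<close>. Then \<open>g\<close> belongs to that pair,
  and as pairs are edge-disjoint at most one is lost. Hence two new pairs yield a net gain, and one
  suffices if \<open>I\<close> was empty; only in that case may a new pair contain explored
  edges.\<close>

lemma can_step_reg:
  assumes "good V E I" "finite V'" "V \<subseteq> V'" "E \<subset> E'" "E' \<subseteq> nsets V' k"
    "V' \<subseteq> V \<union> world_V" "E' \<subseteq> E \<union> world_E" "card (V' - V) \<le> M" "card (E' - E) \<le> M" "lam V' E' = lam V E"
    and g: "g \<in> active_edges E I" "g \<in> E" "E' - E \<subseteq> Pow (g \<union> (V' - V))"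
    and Y: "Y \<subseteq> Pow (Pow (g \<union> (V' - V))) \<times> Pow (g \<union> (V' - V))"
      "\<And>x. x \<in> Y \<Longrightarrow> rooted_ok E' x \<and> (I = {} \<or> fst x \<inter> E = {})"
      "\<And>x y. x \<in> Y \<Longrightarrow> y \<in> Y \<Longrightarrow> x \<noteq> y \<Longrightarrow> fst x \<inter> fst y = {}"
      "card Y \<ge> 2 \<or> I = {} \<and> card Y \<ge> 1"
  shows "can_step V E I"
proof -
  have fE: "finite E'" using assms(2,5) finite_imp_finite_nsets finite_subset by metis
  have gk: "card g = k" "finite g" using goodD[OF assms(1)] g by auto
  let ?I' = "intact E' I \<union> Y"
  have fY: "finite Y" by (rule finite_subset[OF Y(1)]) (use gk assms(2) in auto)
  have reg: "reg_step k m M (V, E, I) (V', E', ?I')"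
  proof -
    have "real (card (V' - V)) = real (card (E' - E)) / m"
      using lam_diff[OF assms(2) fE assms(3), of E] assms(4,10) by auto
    then show ?thesis
      using assms(3,4,8) g(1,3) gk(1) Y(1) unfolding reg_step_def split by blast
  qed
  have gi: "good V' E' (intact E' I)"
    by (rule good_intact[OF assms(1,2) _ assms(5)]) (use assms(4) in auto)
  have sep: "fst x \<inter> fst y = {}" if "x \<in> intact E' I" "y \<in> Y" for x y
  proof -
    have "x \<in> I" using that intact_sub by blast
    then have "fst x \<subseteq> E" "I \<noteq> {}"
      using rooted_okD(2)[OF goodD(8)[OF assms(1), of x]] by auto
    then show ?thesis using Y(2)[OF that(2)] by blast
  qed
  have good: "good V' E' ?I'"
    unfolding good_def
  proof (intro conjI ballI impI)
    show "finite ?I'" using fY goodD(6)[OF gi] by simp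
    show "rooted_ok E' x" if "x \<in> ?I'" for x using that goodD(8)[OF gi] Y(2) by blast
    show "fst x \<inter> fst y = {}" if "x \<in> ?I'" "y \<in> ?I'" "x \<noteq> y" for x y
      using that goodD(9)[OF gi, of x y] Y(3)[of x y] sep[of x y] sep[of y x] by blast
  qed (use assms(2,4,5) in auto)
  have "intact E' I \<inter> Y = {}"
  proof (rule ccontr)
    assume "intact E' I \<inter> Y \<noteq> {}"
    then obtain x where x: "x \<in> intact E' I" "x \<in> Y" by blast
    then show False using sep[OF x] rooted_okD(1)[of E' x] Y(2)[OF x(2)] by auto
  qed
  then have cI': "card ?I' = card (intact E' I) + card Y"
    using fY goodD(6)[OF gi] by (simp add: card_Un_disjoint)
  have "card (I - intact E' I) \<le> 1"
  proof -
    have "g \<in> fst x" if x: "x \<in> I - intact E' I" for x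
    proof -
      obtain h where h: "h \<in> E' - E" "h \<inter> (\<Union>(fst x) - snd x) \<noteq> {}"
        using broken_meets[OF assms(1) x] by metis
      have xok: "rooted_ok E x" using goodD(8)[OF assms(1)] x by simp
      have "\<Union>(fst x) \<subseteq> V" using goodD(3)[OF assms(1)] rooted_okD(2)[OF xok] by blast
      moreover have "h \<subseteq> g \<union> (V' - V)" using h(1) g(3) by blast
      ultimately have "g \<inter> (\<Union>(fst x) - snd x) \<noteq> {}" using h(2) by blast
      then show ?thesis using rooted_okD(4)[OF xok g(2)] by simp
    qed
    then have "x = y" if "x \<in> I - intact E' I" "y \<in> I - intact E' I" for x y
      using goodD(9)[OF assms(1), of x y] that by blast
    then show ?thesis using goodD(6)[OF assms(1)] by (simp add: card_le_Suc0_iff_eq)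
  qed
  moreover have "card I = card (I - intact E' I) + card (intact E' I)"
    using card_intact goodD(6)[OF assms(1)] .
  ultimately have "card I + 1 \<le> card ?I'" using Y(4) cI' by auto
  then show ?thesis using good reg assms unfolding can_step_def by blast
qed

lemma card_VS_le:
  assumes "card S \<le> e2" "finite S" "\<And>f. f \<in> S \<Longrightarrow> Af f \<in> HA"
  shows "card (\<Union>f\<in>S. verts (Af f)) \<le> e2 * v1" "card (\<Union>f\<in>S. edges (Af f)) \<le> e2 * e1"
proof -
  have "card (\<Union>f\<in>S. verts (Af f)) \<le> (\<Sum>f\<in>S. v1)"
    using card_UN_le[OF assms(2), of "\<lambda>f. verts (Af f)"] assms(3) HA_nv by simp
  also have "\<dots> \<le> e2 * v1" using assms(1) by simp
  finally show "card (\<Union>f\<in>S. verts (Af f)) \<le> e2 * v1" .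
  have "card (\<Union>f\<in>S. edges (Af f)) \<le> (\<Sum>f\<in>S. e1)"
    using card_UN_le[OF assms(2), of "\<lambda>f. edges (Af f)"] assms(3) HA_ne by simp
  also have "\<dots> \<le> e2 * e1" using assms(1) by simp
  finally show "card (\<Union>f\<in>S. edges (Af f)) \<le> e2 * e1" .
qed

lemma nsets_HA: "A \<in> HA \<Longrightarrow> verts A \<subseteq> V \<Longrightarrow> edges A \<subseteq> nsets V k"
  using HA_kgraph[of A] by (auto simp: kgraph_def nsets_def)

lemma nsets_HB: "A \<in> HB \<Longrightarrow> verts A \<subseteq> V \<Longrightarrow> edges A \<subseteq> nsets V k"
  using HB_kgraph[of A] by (auto simp: kgraph_def nsets_def)

lemma nsets_grow: "E \<subseteq> nsets V k \<Longrightarrow> V \<subseteq> W \<Longrightarrow> E \<subseteq> nsets W k"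
  unfolding nsets_def by blast

lemma world_AA: "A \<in> AA \<Longrightarrow> verts A \<subseteq> world_V" "A \<in> AA \<Longrightarrow> edges A \<subseteq> world_E"
  and world_BB: "A \<in> BB \<Longrightarrow> verts A \<subseteq> world_V" "A \<in> BB \<Longrightarrow> edges A \<subseteq> world_E"
  by (auto simp: world_V_def world_E_def)

lemma card_Diff_le: "finite W \<Longrightarrow> V' \<subseteq> V \<union> W \<Longrightarrow> card (V' - V) \<le> card W"
  by (rule card_mono) auto

lemma can_step_deg_Un:
  assumes "good V E I" "finite W" "W \<subseteq> world_V" "card W \<le> M" "finite X" "X \<subseteq> world_E" "card X \<le> M"
    "X \<subseteq> nsets (V \<union> W) k" "lam (V \<union> W) (E \<union> X) < lam V E"
  shows "can_step V E I"
proof (rule can_step_deg[OF assms(1)])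
  show "E \<union> X \<subseteq> nsets (V \<union> W) k" using nsets_grow[OF goodD(7)[OF assms(1)]] assms(8) by simp
  show "card (V \<union> W - V) \<le> M" using card_Diff_le[OF assms(2), of "V \<union> W" V] assms(4) by simp
  show "card (E \<union> X - E) \<le> M" using card_Diff_le[OF assms(5), of "E \<union> X" E] assms(7) by simp
  show "finite (V \<union> W)" using goodD(1)[OF assms(1)] assms(2) by simp
  show "V \<union> W \<subseteq> V \<union> world_V" "E \<union> X \<subseteq> E \<union> world_E" using assms(3,6) by blast+
qed (fact Un_upper1 assms(9))+

lemma can_step_reg_Un:
  assumes "good V E I" "finite W" "W \<subseteq> world_V" "card W \<le> M" "finite X" "X \<subseteq> world_E" "card X \<le> M"
    "X \<subseteq> nsets (V \<union> W) k" "lam (V \<union> W) (E \<union> X) = lam V E"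
    and "\<not> X \<subseteq> E" "g \<in> active_edges E I" "g \<in> E" "X - E \<subseteq> Pow (g \<union> (W - V))"
    and "Y \<subseteq> Pow (Pow (g \<union> (W - V))) \<times> Pow (g \<union> (W - V))"
      "\<And>x. x \<in> Y \<Longrightarrow> rooted_ok (E \<union> X) x \<and> (I = {} \<or> fst x \<inter> E = {})"
      "\<And>x y. x \<in> Y \<Longrightarrow> y \<in> Y \<Longrightarrow> x \<noteq> y \<Longrightarrow> fst x \<inter> fst y = {}"
      "card Y \<ge> 2 \<or> I = {} \<and> card Y \<ge> 1"
  shows "can_step V E I"
proof (rule can_step_reg[OF assms(1), of "V \<union> W" "E \<union> X" g Y])
  show "E \<union> X \<subseteq> nsets (V \<union> W) k" using nsets_grow[OF goodD(7)[OF assms(1)]] assms(8) by simp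
  show "card (V \<union> W - V) \<le> M" using card_Diff_le[OF assms(2), of "V \<union> W" V] assms(4) by simp
  show "card (E \<union> X - E) \<le> M" using card_Diff_le[OF assms(5), of "E \<union> X" E] assms(7) by simp
  show "finite (V \<union> W)" using goodD(1)[OF assms(1)] assms(2) by simp
  show "V \<union> W \<subseteq> V \<union> world_V" "E \<union> X \<subseteq> E \<union> world_E" "E \<subset> E \<union> X" using assms(3,6,10) by blast+
  have d: "V \<union> W - V = W - V" "E \<union> X - E = X - E" by blast+
  show "E \<union> X - E \<subseteq> Pow (g \<union> (V \<union> W - V))" unfolding d by (rule assms(13))
  show "Y \<subseteq> Pow (Pow (g \<union> (V \<union> W - V))) \<times> Pow (g \<union> (V \<union> W - V))"
    unfolding d by (rule assms(14))
qed (use assms(9,11,12,15-17) in blast)+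

lemma attach_A_deg:
  assumes "good V E I" "A \<in> AA" "lam (V \<union> verts A) (E \<union> edges A) < lam V E"
  shows "can_step V E I"
proof -
  have A: "A \<in> HA" using assms AA by auto
  show ?thesis
    by (rule can_step_deg_Un[OF assms(1) HA_fin(1)[OF A] world_AA(1)[OF assms(2)] _ HA_fin(2)[OF A]
          world_AA(2)[OF assms(2)] _ nsets_HA[OF A] assms(3)])
      (use HA_nv[OF A] HA_ne[OF A] in \<open>auto simp: M_def\<close>)
qed

lemma attach_B_deg:
  assumes "good V E I" "B \<in> BB" "lam (V \<union> verts B) (E \<union> edges B) < lam V E"
  shows "can_step V E I"
proof -
  have B: "B \<in> HB" using assms BB by auto
  show ?thesis
    by (rule can_step_deg_Un[OF assms(1) HB_fin(1)[OF B] world_BB(1)[OF assms(2)] _ HB_fin(2)[OF B]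
          world_BB(2)[OF assms(2)] _ nsets_HB[OF B] assms(3)])
      (use HB_nv[OF B] HB_ne[OF B] in \<open>auto simp: M_def\<close>)
qed

lemma attach_AB_deg:
  assumes "good V E I" "A \<in> AA" "B \<in> BB"
    "lam (V \<union> verts A \<union> verts B) (E \<union> edges A \<union> edges B) < lam V E"
  shows "can_step V E I"
proof -
  have A: "A \<in> HA" and B: "B \<in> HB" using assms AA BB by auto
  show ?thesis
  proof (rule can_step_deg_Un[OF assms(1), of "verts A \<union> verts B" "edges A \<union> edges B"])
    show "card (verts A \<union> verts B) \<le> M"
      using card_Un_le[of "verts A" "verts B"] HA_nv[OF A] HB_nv[OF B] by (simp add: M_def)
    show "card (edges A \<union> edges B) \<le> M"
      using card_Un_le[of "edges A" "edges B"] HA_ne[OF A] HB_ne[OF B] by (simp add: M_def)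
    show "edges A \<union> edges B \<subseteq> nsets (V \<union> (verts A \<union> verts B)) k"
      using nsets_HA[OF A, of "V \<union> (verts A \<union> verts B)"] nsets_HB[OF B, of "V \<union> (verts A \<union> verts B)"]
      by blast
    show "lam (V \<union> (verts A \<union> verts B)) (E \<union> (edges A \<union> edges B)) < lam V E"
      using assms(4) by (simp only: Un_assoc)
  qed (use HA_fin(1,2)[OF A] HB_fin(1,2)[OF B] world_AA[OF assms(2)] world_BB[OF assms(3)] in simp_all)
qed

text \<open>Needed when \<open>m = m2\<close>: a copy of H1 glued along one edge then keeps
  \<open>lam\<close>. It is used only when no pair is intact, where a single new pair, rooted at the
  old edge \<open>g\<close>, is enough.\<close>

lemma attach_A_reg:
  assumes "good V E {}" "A \<in> AA" "V \<inter> verts A = g" "E \<inter> edges A = {g}"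
    "lam (V \<union> verts A) (E \<union> edges A) = lam V E"
  shows "can_step V E {}"
proof -
  have A: "A \<in> HA" using assms AA by auto
  note gd = goodD[OF assms(1)]
  have vA: "verts A \<subseteq> g \<union> (verts A - V)" using assms(3) by blast
  have eA: "\<Union>(edges A) \<subseteq> verts A" using HA_fin(4)[OF A] by blast
  show ?thesis
  proof (rule can_step_reg_Un[OF assms(1) HA_fin(1)[OF A] world_AA(1)[OF assms(2)] _ HA_fin(2)[OF A]
        world_AA(2)[OF assms(2)] _ nsets_HA[OF A] assms(5), of g "{(edges A, g)}"])
    show "edges A - E \<subseteq> Pow (g \<union> (verts A - V))"
      "{(edges A, g)} \<subseteq> Pow (Pow (g \<union> (verts A - V))) \<times> Pow (g \<union> (verts A - V))"
      using vA eA by blast+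
    show "g \<in> active_edges E {}" "g \<in> E" using assms(4) by (auto simp: active_edges_def)
    have "\<not> edges A \<subseteq> {g}" using HA_ne[OF A] e1_ge2 card_mono[of "{g}" "edges A"] by auto
    then show "\<not> edges A \<subseteq> E" using assms(4) by blast
    show "rooted_ok (E \<union> edges A) x \<and> ({} = {} \<or> fst x \<inter> E = {})" if "x \<in> {(edges A, g)}" for x
    proof -
      have "h \<in> edges A" if "h \<in> E" "h \<inter> (\<Union>(edges A) - g) \<noteq> {}" for h
        using that gd(3) eA assms(3) by blast
      moreover have "g \<in> edges A" "edges A \<in> edges ` AA" using assms(2,4) by blast+
      ultimately show ?thesis using that unfolding rooted_ok_iff by auto
    qed
  qed (use HA_nv[OF A] HA_ne[OF A] in \<open>auto simp: M_def\<close>)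
qed

end

context ramsey_core
begin

text \<open>If \<open>lam\<close> drops, the step is degenerate. Otherwise the equality case of
  \<open>attach_pair\<close> says that each \<open>Af f\<close> meets everything else in
  \<open>f\<close> only, so each of the \<open>e2 - 1\<close> new edges yields a pair
  \<open>(edges (Af f), f)\<close> whose private vertices no foreign edge touches.\<close>

lemma attach_pair_step:
  assumes gd: "good V E I" and B: "B \<in> BB" and g: "g \<in> active_edges E I" "g \<in> E" "g \<in> edges B"
    and nsub: "\<not> subhypergraph B (V, E)"
    and Af: "\<And>f. f \<in> edges B - E \<Longrightarrow> Af f \<in> AA"
    and AfB: "\<And>f. f \<in> edges B - E \<Longrightarrow> edges (Af f) \<inter> edges B = {f}"
    and disj: "\<And>f. f \<in> edges B - E \<Longrightarrow> edges (Af f) \<inter> E = {}"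
  shows "can_step V E I"
proof -
  let ?R = "edges B - E"
  let ?V = "\<lambda>S. \<Union>f\<in>S. verts (Af f)" and ?E = "\<lambda>S. \<Union>f\<in>S. edges (Af f)"
  let ?W = "verts B \<union> ?V ?R" and ?X = "?E ?R"
  note g' = goodD[OF gd]
  have BH: "B \<in> HB" using B BB by auto
  have AfH: "Af f \<in> HA" if "f \<in> ?R" for f using Af[OF that] AA by auto
  note pair = attach_pair[OF g'(1,2,3) BH g(2,3) nsub AfH AfB disj]
  have fR: "finite ?R" using HB_fin(2)[OF BH] by simp
  have cR: "card ?R \<le> e2" using HB_ne[OF BH] card_mono[OF HB_fin(2)[OF BH], of ?R] by auto
  have finW: "finite ?W" using fR HA_fin(1)[OF AfH] HB_fin(1)[OF BH] by auto
  have finX: "finite ?X" using fR HA_fin(2)[OF AfH] by auto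
  have W: "?W \<subseteq> world_V" using world_BB(1)[OF B] world_AA(1)[OF Af] by blast
  have X: "?X \<subseteq> world_E" using world_AA(2)[OF Af] by blast
  have cW: "card ?W \<le> M"
    using card_Un_le[of "verts B" "?V ?R"] card_VS_le(1)[of ?R Af, OF cR fR AfH] HB_nv[OF BH] by (simp add: M_def)
  have cX: "card ?X \<le> M" using card_VS_le(2)[of ?R Af, OF cR fR AfH] by (simp add: M_def)
  have nX: "?X \<subseteq> nsets (V \<union> ?W) k"
  proof -
    have "edges (Af f) \<subseteq> nsets (V \<union> ?W) k" if "f \<in> ?R" for f
      using that by (intro nsets_HA[OF AfH]) auto
    then show ?thesis by blast
  qed
  have fAf: "f \<in> edges (Af f)" if "f \<in> ?R" for f using AfB[OF that] by blast
  have le: "lam (V \<union> ?W) (E \<union> ?X) \<le> lam V E" using pair(1) by (simp add: Un_assoc)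
  show ?thesis
  proof (cases "lam (V \<union> ?W) (E \<union> ?X) = lam V E")
    case False
    then show ?thesis
      using le can_step_deg_Un[OF gd finW W cW finX X cX nX] by linarith
  next
    case True
    then have VB: "V \<inter> verts B = g" and EB: "E \<inter> edges B = {g}"
      and fresh: "\<And>f. f \<in> ?R \<Longrightarrow> (V \<union> verts B \<union> ?V (?R - {f})) \<inter> verts (Af f) = f"
      using pair(2) by (simp_all add: Un_assoc)
    let ?N = "g \<union> (?W - V)"
    have sub: "f \<subseteq> verts B" "card f = k" "finite f" if "f \<in> ?R" for f
      using HB_fin(3-5)[OF BH] that by auto
    \<comment> \<open>Old vertices of \<open>Af f\<close> lie in \<open>f\<close>, hence in
      \<open>V \<inter> verts B = g\<close>. This places the whole copy on \<open>g\<close> and new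
      vertices, as \<open>reg_step\<close> demands.\<close>
    have VA: "V \<inter> verts (Af f) \<subseteq> g \<inter> f" if f: "f \<in> ?R" for f
      using fresh[OF f] sub(1)[OF f] VB by blast
    have AN: "verts (Af f) \<subseteq> ?N" if f: "f \<in> ?R" for f
      using VA[OF f] f by blast
    have EAN: "edges (Af f) \<subseteq> Pow ?N" if f: "f \<in> ?R" for f
      using AN[OF f] HA_fin(4)[OF AfH[OF f]] by blast
    have fN: "f \<subseteq> ?N" if f: "f \<in> ?R" for f
      using EAN[OF f] fAf[OF f] by blast
    have cardR: "card ?R = e2 - 1"
      using card_Diff_subset_Int[of "edges B" E] EB HB_fin(2)[OF BH] HB_ne[OF BH] by (simp add: Int_commute)
    then have R2: "card ?R \<ge> 2" using e2_ge3 by simp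
    let ?Y = "(\<lambda>f. (edges (Af f), f)) ` ?R"
    have "card ?Y = card ?R" by (intro card_image inj_onI) simp
    then have Y2: "card ?Y \<ge> 2" using R2 by simp
    have "?R \<noteq> {}" using R2 by (metis card.empty not_numeral_le_zero)
    then have nX': "\<not> ?X \<subseteq> E" using fAf disj by blast
    have ok: "rooted_ok (E \<union> ?X) (edges (Af f), f)" if f: "f \<in> ?R" for f
    proof -
      have "h \<in> edges (Af f)" if h: "h \<in> E \<union> ?X" "h \<inter> (\<Union>(edges (Af f)) - f) \<noteq> {}" for h
      proof (rule ccontr)
        assume nh: "h \<notin> edges (Af f)"
        obtain z where z: "z \<in> h" "z \<in> \<Union>(edges (Af f))" "z \<notin> f" using h(2) by blast
        then have zA: "z \<in> verts (Af f)" using HA_fin(4)[OF AfH[OF f]] by blast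
        have "z \<in> V \<union> verts B \<union> ?V (?R - {f})"
        proof (cases "h \<in> E")
          case True
          then show ?thesis using g'(3) z(1) by blast
        next
          case False
          then obtain f' where f': "f' \<in> ?R" "h \<in> edges (Af f')" using h(1) by blast
          then have "f' \<noteq> f" using nh by blast
          moreover have "z \<in> verts (Af f')" using HA_fin(4)[OF AfH[OF f'(1)] f'(2)] z(1) by blast
          ultimately show ?thesis using f'(1) by blast
        qed
        then show False using fresh[OF f] zA z(3) by blast
      qed
      moreover have "edges (Af f) \<subseteq> E \<union> ?X" using f by blast
      moreover have "edges (Af f) \<in> edges ` AA" using Af[OF f] by blast
      ultimately show ?thesis using fAf[OF f] unfolding rooted_ok_iff fst_conv snd_conv by blast
    qed
    have Ydis: "edges (Af f) \<inter> edges (Af f') = {}" if f: "f \<in> ?R" "f' \<in> ?R" "f \<noteq> f'" for f f'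
    proof (rule ccontr)
      assume "edges (Af f) \<inter> edges (Af f') \<noteq> {}"
      then obtain h where h: "h \<in> edges (Af f)" "h \<in> edges (Af f')" by blast
      have hv: "h \<subseteq> verts (Af f)" "h \<subseteq> verts (Af f')" "card h = k"
        using HA_fin(3,4) AfH f h by blast+
      have "h \<subseteq> f"
        using hv(1,2) fresh[OF f(1)] f(2,3) by blast
      moreover have "h \<subseteq> f'"
        using hv(1,2) fresh[OF f(2)] f(1,3) by blast
      ultimately show False
        using sub[OF f(1)] sub[OF f(2)] hv(3) f(3) by (metis card_subset_eq)
    qed
    show ?thesis
    proof (rule can_step_reg_Un[OF gd finW W cW finX X cX nX True nX' g(1,2), of ?Y])
      show "?X - E \<subseteq> Pow ?N" using EAN by blast
      show "?Y \<subseteq> Pow (Pow ?N) \<times> Pow ?N" using EAN fN by blast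
      show "rooted_ok (E \<union> ?X) x \<and> (I = {} \<or> fst x \<inter> E = {})" if "x \<in> ?Y" for x
      proof -
        obtain f where f: "f \<in> ?R" "x = (edges (Af f), f)" using \<open>x \<in> ?Y\<close> by blast
        show ?thesis unfolding f(2) fst_conv using ok[OF f(1)] disj[OF f(1)] by blast
      qed
      show "fst x \<inter> fst y = {}" if "x \<in> ?Y" "y \<in> ?Y" "x \<noteq> y" for x y
      proof -
        obtain f f' where f: "f \<in> ?R" "x = (edges (Af f), f)" "f' \<in> ?R" "y = (edges (Af f'), f')"
          using \<open>x \<in> ?Y\<close> \<open>y \<in> ?Y\<close> by blast
        then have "f \<noteq> f'" using \<open>x \<noteq> y\<close> by blast
        then show ?thesis unfolding f(2,4) fst_conv by (rule Ydis[OF f(1,3)])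
      qed
      show "2 \<le> card ?Y \<or> I = {} \<and> 1 \<le> card ?Y" using Y2 by blast
    qed
  qed
qed

text \<open>The only obstacle to \<open>attach_pair_step\<close> is some \<open>Af f\<close> that
  already meets \<open>E\<close>. As \<open>f\<close> is unexplored, that copy is not contained, and
  \<open>dich\<close> forces \<open>m = m2\<close>. If attaching \<open>B\<close> alone still keeps
  \<open>lam\<close>, then \<open>Af f\<close> is attached before \<open>B\<close>: now
  \<open>B\<close> meets the explored edges in both \<open>g\<close> and \<open>f\<close>, which
  costs a strict decrease.\<close>

lemma compound_step:
  assumes gd: "good V E I" and B: "B \<in> BB" and g: "g \<in> active_edges E I" "g \<in> E" "g \<in> edges B"
    and nsub: "\<not> subhypergraph B (V, E)"
    and dich: "m = m2 \<or> (\<forall>A\<in>AA. edges A \<inter> E \<noteq> {} \<longrightarrow> subhypergraph A (V, E))"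
  shows "can_step V E I"
proof -
  let ?R = "edges B - E"
  note g' = goodD[OF gd]
  have BH: "B \<in> HB" using B BB by auto
  have "\<forall>f\<in>?R. \<exists>A\<in>AA. edges A \<inter> edges B = {f}" using BB_edge[OF B] by blast
  then obtain Af where Af: "\<And>f. f \<in> ?R \<Longrightarrow> Af f \<in> AA" "\<And>f. f \<in> ?R \<Longrightarrow> edges (Af f) \<inter> edges B = {f}"
    by metis
  show ?thesis
  proof (cases "\<forall>f\<in>?R. edges (Af f) \<inter> E = {}")
    case True
    then show ?thesis using attach_pair_step[OF gd B g nsub Af] by blast
  next
    case False
    then obtain f where f: "f \<in> ?R" "edges (Af f) \<inter> E \<noteq> {}" by blast
    have "\<not> subhypergraph (Af f) (V, E)"
      using f Af(2)[OF f(1)] by (auto simp: subhypergraph_def)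
    then have mm: "m = m2" using dich Af(1)[OF f(1)] f(2) by blast
    note at = attach_HB_sym[OF g'(1,2,3) BH g(2,3) nsub mm]
    show ?thesis
    proof (cases "lam (V \<union> verts B) (E \<union> edges B) = lam V E")
      case False
      then show ?thesis using at(1) attach_B_deg[OF gd B] by linarith
    next
      case True
      then have EB: "E \<inter> edges B = {g}" using at(2) by blast
      have AH: "Af f \<in> HA" using Af(1)[OF f(1)] AA by auto
      let ?V = "V \<union> verts (Af f)" and ?E = "E \<union> edges (Af f)"
      have le: "lam ?V ?E \<le> lam V E" by (rule attach_HA(1)[OF AH g'(1,2,3)]) (use f(2) in blast)
      have fin: "finite ?V" "finite ?E" "\<Union>?E \<subseteq> ?V"
        using g'(1,2,3) HA_fin(1,2)[OF AH] HA_fin(4)[OF AH] by (simp, simp, blast)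
      \<comment> \<open>A third edge of \<open>B\<close> witnesses that \<open>B\<close> is still
        not contained after \<open>Af f\<close> has been attached.\<close>
      have "\<not> edges B \<subseteq> {g, f}"
        using e2_ge3 HB_ne[OF BH] card_mono[of "{g, f}" "edges B"] card_insert_le_m1[of 2 "{f}" g]
        by (auto simp: card_insert_if split: if_splits)
      then obtain h where h: "h \<in> edges B" "h \<noteq> g" "h \<noteq> f" by blast
      then have "h \<notin> ?E" using EB Af(2)[OF f(1)] by blast
      then have ns: "\<not> subhypergraph B (?V, ?E)" using h(1) by (auto simp: subhypergraph_def)
      have gE: "g \<in> ?E" using g(2) by simp
      note at' = attach_HB_sym[OF fin BH gE g(3) ns mm]
      have "lam (?V \<union> verts B) (?E \<union> edges B) \<noteq> lam ?V ?E"
      proof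
        assume "lam (?V \<union> verts B) (?E \<union> edges B) = lam ?V ?E"
        then have "?E \<inter> edges B = {g}" using at'(2) by blast
        moreover have "f \<in> ?E \<inter> edges B" "f \<noteq> g" using f(1) Af(2)[OF f(1)] g(2) by blast+
        ultimately show False by blast
      qed
      then show ?thesis using at'(1) le attach_AB_deg[OF gd Af(1)[OF f(1)] B] by linarith
    qed
  qed
qed

text \<open>No member of the families is split by a closed \<open>E\<close>, which is the situation
  of \<open>min_unsat_closed\<close>.\<close>

definition closed_in :: "nat set \<Rightarrow> nat set set \<Rightarrow> bool" where
  "closed_in V E \<longleftrightarrow> (\<forall>C\<in>AA \<union> BB. edges C \<inter> E \<noteq> {} \<longrightarrow> subhypergraph C (V, E))"

text \<open>Since $m_k(H_2) > 1$, removing a vertex of degree one would increase the density of $H_2$.\<close>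

lemma HB_degree:
  assumes B: "B \<in> HB" and g: "g \<in> edges B" "x \<in> g"
  shows "\<exists>h. h \<in> edges B \<and> x \<in> h \<and> h \<noteq> g"
proof (rule ccontr)
  assume "\<not> ?thesis"
  then have only: "\<And>h. h \<in> edges B \<Longrightarrow> h \<noteq> g \<Longrightarrow> x \<notin> h" by blast
  let ?J = "(verts B - {x}, edges B - {g})"
  have xB: "x \<in> verts B" using HB_fin(4)[OF B g(1)] g(2) by blast
  have "subhypergraph ?J B"
    using HB_fin(4)[OF B] only by (auto simp: subhypergraph_def)
  moreover have ne: "ne ?J = e2 - 1" "nv ?J = v2 - 1"
    using HB_ne[OF B] HB_nv[OF B] g xB HB_fin(1,2)[OF B] by simp_all
  moreover have "edges ?J \<noteq> {}" using ne(1) e2_ge3 by (auto simp only: card.empty)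
  ultimately have "real (e2 - 1) - 1 \<le> m2 * (real (v2 - 1) - real k)"
    using HB_sub[OF B] by metis
  then have "real e2 - 1 - 1 \<le> m2 * (real v2 - real k) - m2"
    using e2_ge3 v2_gt_k by (simp add: of_nat_diff algebra_simps)
  then show False using HB_eqn m2_gt1 by linarith
qed

text \<open>The active edge \<open>g\<close> is a non-root edge of an intact copy \<open>A\<close>
  and has a private vertex \<open>z\<close>. A copy \<open>B\<close> with
  \<open>edges A \<inter> edges B = {g}\<close> has a second edge at \<open>z\<close>, by
  \<open>HB_degree\<close>. It is not in \<open>A\<close>, so by intactness it is
  unexplored.\<close>

lemma active_copy:
  assumes gd: "good V E I" and "I \<noteq> {}"
  obtains g B where "g \<in> active_edges E I" "g \<in> E" "B \<in> BB" "g \<in> edges B" "\<not> subhypergraph B (V, E)"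
proof -
  let ?P = "\<lambda>g. \<exists>(Q, f)\<in>I. g \<in> Q \<and> g \<noteq> f"
  define g where "g = (SOME g. ?P g)"
  have "\<exists>g. ?P g"
  proof -
    obtain x where x: "x \<in> I" using assms(2) by auto
    obtain A where A: "A \<in> AA" "fst x = edges A" using rooted_okD(3)[OF goodD(8)[OF gd x]] by auto
    have "A \<in> HA" using A(1) AA by blast
    then have "card (edges A) \<ge> 2" using HA_ne[of A] e1_ge2 by simp
    then have "\<not> edges A \<subseteq> {snd x}" using card_mono[of "{snd x}" "edges A"] by auto
    then show ?thesis using x A(2) by (auto simp: split_beta)
  qed
  then have "?P g" unfolding g_def by (rule someI_ex)
  then have "\<exists>x\<in>I. g \<in> fst x \<and> g \<noteq> snd x" by (simp add: split_beta)
  then obtain x where x: "x \<in> I" "g \<in> fst x" "g \<noteq> snd x" by blast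
  note ok = rooted_okD[OF goodD(8)[OF gd x(1)]]
  obtain A where A: "A \<in> AA" "fst x = edges A" using ok(3) by auto
  obtain B where B: "B \<in> BB" "edges A \<inter> edges B = {g}" using AA_edge[OF A(1)] x(2) A(2) by blast
  have BH: "B \<in> HB" using B BB by auto
  have gE: "g \<in> E" using ok(2) x(2) by blast
  have sE: "snd x \<in> E" using ok(1,2) by blast
  have "\<not> g \<subseteq> snd x"
    using goodD(4,5)[OF gd gE] goodD(4,5)[OF gd sE] x(3) card_subset_eq[of "snd x" g] by auto
  then obtain z where z: "z \<in> g" "z \<notin> snd x" by blast
  obtain h where h: "h \<in> edges B" "z \<in> h" "h \<noteq> g" using HB_degree[OF BH _ z(1)] B(2) by blast
  have "h \<notin> E"
  proof
    assume "h \<in> E"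
    moreover have "h \<inter> (\<Union>(fst x) - snd x) \<noteq> {}" using h(2) z x(2) by blast
    ultimately have "h \<in> fst x" by (rule ok(4))
    then show False using h B(2) A(2) by blast
  qed
  then have "\<not> subhypergraph B (V, E)" using h(1) by (auto simp: subhypergraph_def)
  moreover have "g \<in> active_edges E I" using assms(2) by (simp add: active_edges_def g_def)
  ultimately show ?thesis using that gE B by blast
qed

text \<open>A copy of H1 that lowers \<open>lam\<close> gives a degenerate step. If there is none, a
  partly explored copy of H1 forces \<open>m = m2\<close>, which is the dichotomy required by
  \<open>compound_step\<close>. If no copy of H2 can be used either, then no pair is intact and
  every copy of H2 that meets \<open>E\<close> is contained, so it is a copy of H1 that violates
  closedness.\<close>

theorem progress:
  assumes gd: "good V E I" and nc: "I \<noteq> {} \<or> \<not> closed_in V E"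
  shows "can_step V E I"
proof (cases "\<exists>A\<in>AA. edges A \<inter> E \<noteq> {} \<and> \<not> subhypergraph A (V, E) \<and>
    lam (V \<union> verts A) (E \<union> edges A) \<noteq> lam V E")
  case True
  then obtain A where A: "A \<in> AA" "E \<inter> edges A \<noteq> {}" "lam (V \<union> verts A) (E \<union> edges A) \<noteq> lam V E"
    by blast
  then have "lam (V \<union> verts A) (E \<union> edges A) < lam V E"
    using attach_HA(1)[OF _ goodD(1,2,3)[OF gd] A(2)] AA by fastforce
  then show ?thesis by (rule attach_A_deg[OF gd A(1)])
next
  case False
  have equal: "m = m2 \<and> (\<exists>g. V \<inter> verts A = g \<and> E \<inter> edges A = {g}) \<and> lam (V \<union> verts A) (E \<union> edges A) = lam V E"
    if A: "A \<in> AA" "E \<inter> edges A \<noteq> {}" "\<not> subhypergraph A (V, E)" for A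
  proof -
    have eq: "lam (V \<union> verts A) (E \<union> edges A) = lam V E" using False A by blast
    moreover have "A \<in> HA" using A AA by blast
    ultimately show ?thesis using attach_HA(2)[OF _ goodD(1,2,3)[OF gd] A(2) eq A(3)] by blast
  qed
  then have dich: "m = m2 \<or> (\<forall>A\<in>AA. edges A \<inter> E \<noteq> {} \<longrightarrow> subhypergraph A (V, E))" by blast
  show ?thesis
  proof (cases "\<exists>B\<in>BB. \<exists>g\<in>active_edges E I. g \<in> E \<and> g \<in> edges B \<and> \<not> subhypergraph B (V, E)")
    case True
    then show ?thesis using compound_step[OF gd _ _ _ _ _ dich] by blast
  next
    case F2: False
    then have I: "I = {}" using active_copy[OF gd] by metis
    then have fr: "active_edges E I = E" by (simp add: active_edges_def)
    have "\<exists>A\<in>AA. edges A \<inter> E \<noteq> {} \<and> \<not> subhypergraph A (V, E)"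
      using nc F2 I unfolding closed_in_def fr by blast
    then obtain A where A: "A \<in> AA" "E \<inter> edges A \<noteq> {}" "\<not> subhypergraph A (V, E)" by blast
    then obtain g where "V \<inter> verts A = g" "E \<inter> edges A = {g}" "lam (V \<union> verts A) (E \<union> edges A) = lam V E"
      using equal by blast
    then show ?thesis using attach_A_reg gd A(1) I by blast
  qed
qed

end

section \<open>Counting explorations\<close>

lemma sum_UN_le:
  fixes W :: "'a \<Rightarrow> real"
  assumes "finite S" "\<And>s. s \<in> S \<Longrightarrow> finite (R s)" "\<And>x. W x \<ge> 0"
  shows "sum W (\<Union>s\<in>S. R s) \<le> (\<Sum>s\<in>S. sum W (R s))"
  using assms
proof (induction S rule: finite_induct)
  case (insert s S)
  have "sum W (R s \<union> (\<Union>s\<in>S. R s)) \<le> sum W (R s) + sum W (\<Union>s\<in>S. R s)"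
    using insert by (subst sum_Un) (auto intro!: sum_nonneg)
  then show ?case using insert by auto
qed simp

text \<open>Indexed by the numbers of regular and of degenerate steps, which may come in any order;
  the recursion looks at the last step.\<close>

fun reach :: "'s set \<Rightarrow> ('s \<Rightarrow> 's set) \<Rightarrow> ('s \<Rightarrow> 's set) \<Rightarrow> nat \<Rightarrow> nat \<Rightarrow> 's set" where
  "reach S0 R D 0 0 = S0"
| "reach S0 R D (Suc r) 0 = (\<Union>s\<in>reach S0 R D r 0. R s)"
| "reach S0 R D 0 (Suc d) = (\<Union>s\<in>reach S0 R D 0 d. D s)"
| "reach S0 R D (Suc r) (Suc d) = (\<Union>s\<in>reach S0 R D r (Suc d). R s) \<union> (\<Union>s\<in>reach S0 R D (Suc r) d. D s)"

lemma reach_R: "s \<in> reach S0 R D r d \<Longrightarrow> s' \<in> R s \<Longrightarrow> s' \<in> reach S0 R D (Suc r) d"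
  by (cases d) auto

lemma reach_D: "s \<in> reach S0 R D r d \<Longrightarrow> s' \<in> D s \<Longrightarrow> s' \<in> reach S0 R D r (Suc d)"
  by (cases r) auto

text \<open>The factors 2 pay for the order of the steps: if both kinds occur, the states entered by
  a regular and by a degenerate last step each contribute at most half of the claimed bound.\<close>

lemma reach_weight:
  fixes W :: "'s \<Rightarrow> real"
  assumes S0: "finite S0" and W: "\<And>x. W x \<ge> 0" and q: "q \<ge> 0" "\<delta> \<ge> 0"
    and R: "\<And>s. finite (R s)" "\<And>s. sum W (R s) \<le> q * W s"
    and D: "\<And>s. finite (D s)" "\<And>s. sum W (D s) \<le> \<delta> * W s"
  shows "finite (reach S0 R D r d) \<and> sum W (reach S0 R D r d) \<le> sum W S0 * (2 * q) ^ r * (2 * \<delta>) ^ d"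
proof -
  let ?Z = "sum W S0"
  have Z0: "?Z \<ge> 0" using W by (simp add: sum_nonneg)
  have stepR: "finite (\<Union>s\<in>S. R s) \<and> sum W (\<Union>s\<in>S. R s) \<le> q * sum W S" if "finite S" for S
  proof -
    have "sum W (\<Union>s\<in>S. R s) \<le> (\<Sum>s\<in>S. sum W (R s))" using that R W by (intro sum_UN_le)
    also have "\<dots> \<le> (\<Sum>s\<in>S. q * W s)" using R by (intro sum_mono)
    finally show ?thesis using that R by (simp add: sum_distrib_left)
  qed
  have stepD: "finite (\<Union>s\<in>S. D s) \<and> sum W (\<Union>s\<in>S. D s) \<le> \<delta> * sum W S" if "finite S" for S
  proof -
    have "sum W (\<Union>s\<in>S. D s) \<le> (\<Sum>s\<in>S. sum W (D s))" using that D W by (intro sum_UN_le)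
    also have "\<dots> \<le> (\<Sum>s\<in>S. \<delta> * W s)" using D by (intro sum_mono)
    finally show ?thesis using that D by (simp add: sum_distrib_left)
  qed
  show ?thesis
  proof (induction "r + d" arbitrary: r d rule: less_induct)
    case less
    show ?case
    proof (cases r)
      case r0: 0
      show ?thesis
      proof (cases d)
        case 0
        then show ?thesis using r0 S0 by simp
      next
        case (Suc d')
        have IH: "finite (reach S0 R D 0 d')" "sum W (reach S0 R D 0 d') \<le> ?Z * (2 * \<delta>) ^ d'"
          using less[of 0 d'] Suc r0 by simp_all
        have "\<delta> * sum W (reach S0 R D 0 d') \<le> (2 * \<delta>) * (?Z * (2 * \<delta>) ^ d')"
          using IH(2) q Z0 W by (intro mult_mono) (auto intro!: sum_nonneg)
        then show ?thesis using stepD[OF IH(1)] r0 Suc by (simp add: mult_ac)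
      qed
    next
      case r: (Suc r')
      show ?thesis
      proof (cases d)
        case 0
        have IH: "finite (reach S0 R D r' 0)" "sum W (reach S0 R D r' 0) \<le> ?Z * (2 * q) ^ r'"
          using less[of r' 0] 0 r by simp_all
        have "q * sum W (reach S0 R D r' 0) \<le> (2 * q) * (?Z * (2 * q) ^ r')"
          using IH(2) q Z0 W by (intro mult_mono) (auto intro!: sum_nonneg)
        then show ?thesis using stepR[OF IH(1)] r 0 by (simp add: mult_ac)
      next
        case (Suc d')
        let ?A = "reach S0 R D r' (Suc d')" and ?B = "reach S0 R D (Suc r') d'"
        have IH1: "finite ?A" "sum W ?A \<le> ?Z * (2 * q) ^ r' * (2 * \<delta>) ^ Suc d'"
          using less[of r' "Suc d'"] Suc r by simp_all
        have IH2: "finite ?B" "sum W ?B \<le> ?Z * (2 * q) ^ Suc r' * (2 * \<delta>) ^ d'"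
          using less[of "Suc r'" d'] Suc r by simp_all
        note sR = stepR[OF IH1(1)] and sD = stepD[OF IH2(1)]
        have "sum W (reach S0 R D r d) \<le> sum W (\<Union>s\<in>?A. R s) + sum W (\<Union>s\<in>?B. D s)"
          unfolding r Suc reach.simps using sR sD W by (subst sum_Un) (auto intro!: sum_nonneg)
        also have "\<dots> \<le> q * sum W ?A + \<delta> * sum W ?B" using sR sD by linarith
        also have "\<dots> \<le> q * (?Z * (2 * q) ^ r' * (2 * \<delta>) ^ Suc d') + \<delta> * (?Z * (2 * q) ^ Suc r' * (2 * \<delta>) ^ d')"
          using IH1(2) IH2(2) q by (intro add_mono mult_left_mono)
        also have "\<dots> = ?Z * (2 * q) ^ r * (2 * \<delta>) ^ d"
          unfolding r Suc by (simp add: algebra_simps)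
        finally show ?thesis using sR sD unfolding r Suc by simp
      qed
    qed
  qed
qed

text \<open>There are at most \<open>n ^ a\<close> sets of size \<open>a\<close>, which cancels
  against their weight; only the \<open>K + 1\<close> possible sizes remain.\<close>

lemma sum_small_subsets:
  fixes n :: nat
  assumes "n \<ge> 1"
  shows "(\<Sum>N | N \<subseteq> {1..n} \<and> card N \<le> K. (1 / real n) ^ card N) \<le> real K + 1"
proof -
  let ?F = "\<lambda>a. {N. N \<subseteq> {1..n} \<and> card N = a}"
  have eq: "{N. N \<subseteq> {1..n} \<and> card N \<le> K} = (\<Union>a\<in>{..K}. ?F a)" by auto
  have "(\<Sum>N | N \<subseteq> {1..n} \<and> card N \<le> K. (1 / real n) ^ card N) \<le>
      (\<Sum>a\<le>K. \<Sum>N\<in>?F a. (1 / real n) ^ card N)"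
    unfolding eq by (intro sum_UN_le) auto
  also have "\<dots> = (\<Sum>a\<le>K. real (n choose a) * (1 / real n) ^ a)"
    by (intro sum.cong refl) (simp add: n_subsets)
  also have "\<dots> \<le> (\<Sum>a\<le>K. 1)"
  proof (intro sum_mono)
    fix a
    have "n choose a \<le> n ^ a" by (cases "a \<le> n") (auto simp: binomial_le_pow binomial_eq_0)
    then have "real (n choose a) \<le> real n ^ a" by (metis of_nat_le_iff of_nat_power)
    then show "real (n choose a) * (1 / real n) ^ a \<le> 1"
      using assms by (simp add: power_one_over divide_le_eq)
  qed
  finally show ?thesis by simp
qed

lemma card_small_subsets:
  assumes "finite A" "card A \<le> u" "u \<ge> 1"
  shows "card {X. X \<subseteq> A \<and> card X \<le> K} \<le> (K + 1) * u ^ K"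
proof -
  have "{X. X \<subseteq> A \<and> card X \<le> K} = (\<Union>a\<le>K. {X. X \<subseteq> A \<and> card X = a})" by auto
  then have "card {X. X \<subseteq> A \<and> card X \<le> K} \<le> (\<Sum>a\<le>K. card {X. X \<subseteq> A \<and> card X = a})"
    using card_UN_le[of "{..K}" "\<lambda>a. {X. X \<subseteq> A \<and> card X = a}"] by simp
  also have "\<dots> \<le> (\<Sum>a\<le>K. u ^ K)"
  proof (intro sum_mono)
    fix a assume a: "a \<in> {..K}"
    have "card {X. X \<subseteq> A \<and> card X = a} = card A choose a" using assms(1) by (rule n_subsets)
    also have "\<dots> \<le> card A ^ a" by (cases "a \<le> card A") (auto simp: binomial_le_pow binomial_eq_0)
    also have "\<dots> \<le> u ^ a" using assms(2) by (rule power_mono) simp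
    also have "\<dots> \<le> u ^ K" using assms(3) a by (intro power_increasing) auto
    finally show "card {X. X \<subseteq> A \<and> card X = a} \<le> u ^ K" .
  qed
  finally show ?thesis by simp
qed

lemma powr_minus_nat: "n \<ge> 1 \<Longrightarrow> real n powr (- real a) = (1 / real n) ^ a"
  by (simp add: powr_minus powr_realpow power_one_over inverse_eq_divide)

text \<open>Only finitely many pairs \<open>(a, c)\<close> occur, so a strict loss is a loss of a
  fixed power of \<open>n\<close>. The extra element 1 keeps the set of gaps non-empty.\<close>

lemma density_gap:
  fixes m :: real
  shows "\<exists>\<epsilon>>0. \<forall>a\<le>K. \<forall>c\<le>K. real a < real c / m \<longrightarrow> real a + \<epsilon> \<le> real c / m"
proof -
  let ?S = "insert 1 ((\<lambda>(a, c). real c / m - real a) ` {(a, c). a \<le> K \<and> c \<le> K \<and> real a < real c / m})"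
  have "{(a, c). a \<le> K \<and> c \<le> K \<and> real a < real c / m} \<subseteq> {..K} \<times> {..K}" by auto
  then have "finite {(a, c). a \<le> K \<and> c \<le> K \<and> real a < real c / m}" by (rule finite_subset) simp
  then have fin: "finite ?S" by simp
  have "Min ?S > 0" using fin by (subst Min_gr_iff) auto
  moreover have "real a + Min ?S \<le> real c / m" if "a \<le> K" "c \<le> K" "real a < real c / m" for a c
  proof -
    have "Min ?S \<le> real c / m - real a" by (rule Min_le[OF fin]) (use that in force)
    then show ?thesis by simp
  qed
  ultimately show ?thesis by blast
qed

section \<open>Weighted count of the successors of a state\<close>

definition regs :: "nat \<Rightarrow> real \<Rightarrow> nat \<Rightarrow> nat \<Rightarrow> nat \<Rightarrow> state \<Rightarrow> state set" where
  "regs k m M n K s = {s'. reg_step k m M s s' \<and> fst s' \<subseteq> {1..n} \<and> finite (fst (snd s)) \<and>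
     card (active_edges (fst (snd s)) (snd (snd s))) \<le> K}"

text \<open>Like those of \<open>regs\<close>, the conditions on \<open>s\<close> hold along a
  trajectory and are there to bound the number of successors; finiteness of the edge set also
  excludes that \<open>card\<close> returns its default 0 in the weight.\<close>

definition degs :: "nat \<Rightarrow> real \<Rightarrow> nat \<Rightarrow> nat \<Rightarrow> nat \<Rightarrow> state \<Rightarrow> state set" where
  "degs k m M n w s = {s'. deg_step k m M s s' \<and> fst s' \<subseteq> {1..n} \<and> finite (fst (snd s)) \<and>
     card (fst s) \<le> w}"

text \<open>Bounds the probability that all explored edges are present
  (\<open>prob_contains\<close>), so sums of weights are first moments.\<close>

abbreviation weight :: "real \<Rightarrow> state \<Rightarrow> real" where
  "weight p s \<equiv> p ^ card (fst (snd s))"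

text \<open>The number of choices for the new edges and the new pairs on a ground set of
  \<open>k + M\<close> vertices.\<close>

definition reg_const :: "nat \<Rightarrow> nat \<Rightarrow> nat" where
  "reg_const k M = 2 ^ 2 ^ (k + M) * 2 ^ (2 ^ 2 ^ (k + M) * 2 ^ (k + M))"

text \<open>A successor is determined by the active edge \<open>g\<close>, the new vertices
  \<open>N\<close>, the new edges \<open>X\<close> and the new pairs \<open>Y\<close>. Since
  \<open>lam\<close> is preserved, \<open>p ^ card X\<close> absorbs the choice of \<open>N\<close>.
  As \<open>X\<close> is non-empty, a factor \<open>b\<close> is left over.\<close>

lemma regs_sum:
  fixes p b m :: real
  assumes k: "k \<ge> 1" and p: "p \<ge> 0" and n: "n \<ge> 1" and b: "b \<ge> 0"
    and pb: "\<And>c. c \<ge> 1 \<Longrightarrow> p ^ c \<le> b * real n powr (- real c / m)"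
  shows "finite (regs k m M n K s)"
    and "sum (weight p) (regs k m M n K s) \<le> (real K * (real M + 1) * real (reg_const k M) * b) * weight p s"
proof -
  obtain V E I where s: "s = (V, E, I)" by (cases s)
  define G where "G = {g \<in> active_edges E I. card g = k \<and> finite g}"
  define NN where "NN = {N. N \<subseteq> {1..n} \<and> card N \<le> M}"
  define XY where "XY g N = Pow (Pow (g \<union> N)) \<times> Pow (Pow (Pow (g \<union> N)) \<times> Pow (g \<union> N))" for g N :: "nat set"
  define T0 where "T0 = (SIGMA g:G. SIGMA N:NN. XY g N)"
  define T where "T = {t \<in> T0. case t of (g, N, X, Y) \<Rightarrow> X \<inter> E = {} \<and> X \<noteq> {} \<and> real (card N) = real (card X) / m}"
  define \<phi> :: "nat set \<times> nat set \<times> nat set set \<times> rooted set \<Rightarrow> state"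
    where "\<phi> = (\<lambda>(g, N, X, Y). (V \<union> N, E \<union> X, intact (E \<union> X) I \<union> Y))"
  have main: "finite (regs k m M n K s) \<and>
    sum (weight p) (regs k m M n K s) \<le> (real K * (real M + 1) * real (reg_const k M) * b) * weight p s"
  proof (cases "regs k m M n K s = {}")
    case True
    then show ?thesis using b p by simp
  next
    case False
    then have side: "finite E" "card (active_edges E I) \<le> K" by (auto simp: regs_def s)
    have finF: "finite (active_edges E I)" using side(1) by (simp add: active_edges_def)
    have finG: "finite G" using finF by (simp add: G_def)
    have cG: "card G \<le> K" using card_mono[OF finF, of G] side(2) by (auto simp: G_def)
    have finNN: "finite NN" unfolding NN_def by simp
    have fin: "finite g" "finite N" if "g \<in> G" "N \<in> NN" for g N
      using that by (auto simp: G_def NN_def intro: finite_subset)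
    have finXY: "finite (XY g N)" if "g \<in> G" "N \<in> NN" for g N
      using fin[OF that] by (simp add: XY_def)
    have cXY: "card (XY g N) \<le> reg_const k M" if "g \<in> G" "N \<in> NN" for g N
    proof -
      let ?c = "card (g \<union> N)"
      have "?c \<le> k + M" using card_Un_le[of g N] that by (auto simp: G_def NN_def)
      then have c: "(2::nat) ^ ?c \<le> 2 ^ (k + M)" "(2::nat) ^ 2 ^ ?c \<le> 2 ^ 2 ^ (k + M)" by simp_all
      have "card (XY g N) = 2 ^ 2 ^ ?c * 2 ^ (2 ^ 2 ^ ?c * 2 ^ ?c)"
        using fin[OF that] by (simp add: XY_def card_cartesian_product card_Pow)
      also have "\<dots> \<le> reg_const k M"
        unfolding reg_const_def using c by (intro mult_mono power_increasing) auto
      finally show ?thesis .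
    qed
    have finT0: "finite T0" unfolding T0_def using finG finNN finXY by (intro finite_SigmaI) auto
    then have finT: "finite T" by (simp add: T_def)
    have sub: "regs k m M n K s \<subseteq> \<phi> ` T"
    proof
      fix s' assume s': "s' \<in> regs k m M n K s"
      obtain V' E' I' where s'e: "s' = (V', E', I')" by (cases s')
      have st: "V \<subseteq> V'" "E \<subset> E'" "card (V' - V) \<le> M"
        "real (card (V' - V)) = real (card (E' - E)) / m" "V' \<subseteq> {1..n}"
        using s' by (auto simp: regs_def reg_step_def s s'e)
      obtain g Y where g: "g \<in> active_edges E I" "card g = k" "E' - E \<subseteq> Pow (g \<union> (V' - V))"
        "Y \<subseteq> Pow (Pow (g \<union> (V' - V))) \<times> Pow (g \<union> (V' - V))" "I' = intact E' I \<union> Y"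
        using s' unfolding regs_def reg_step_def s s'e by auto
      have "(g, V' - V, E' - E, Y) \<in> T"
        using st g k card_ge_0_finite[of g] by (auto simp: T_def T0_def G_def NN_def XY_def)
      moreover have "\<phi> (g, V' - V, E' - E, Y) = s'"
        using st(1,2) g(5) by (simp add: \<phi>_def s'e Un_absorb1 psubset_imp_subset)
      ultimately show "s' \<in> \<phi> ` T" by blast
    qed
    have "sum (weight p) (regs k m M n K s) \<le> sum (weight p) (\<phi> ` T)"
      using sub finT p by (intro sum_mono2) auto
    also have "\<dots> \<le> sum (weight p \<circ> \<phi>) T"
      using finT p by (intro sum_image_le) auto
    also have "\<dots> \<le> (\<Sum>(g, N, X, Y)\<in>T. weight p s * b * (1 / real n) ^ card N)"
    proof (intro sum_mono, clarify)
      fix g N X Y assume t: "(g, N, X, Y) \<in> T"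
      then have X: "X \<inter> E = {}" "X \<noteq> {}" "real (card N) = real (card X) / m"
        and gN: "g \<in> G" "N \<in> NN" "X \<subseteq> Pow (g \<union> N)"
        by (auto simp: T_def T0_def XY_def)
      have fX: "finite X" using gN(3) fin[OF gN(1,2)] by (auto intro: finite_subset)
      then have "card X \<ge> 1" using X(2) by (simp add: Suc_le_eq card_gt_0_iff)
      then have "p ^ card X \<le> b * real n powr (- real (card N))" using pb[of "card X"] X(3) by simp
      also have "\<dots> = b * (1 / real n) ^ card N" using n by (simp add: powr_minus_nat)
      finally have "p ^ card X \<le> b * (1 / real n) ^ card N" .
      moreover have "card (E \<union> X) = card E + card X"
        using side(1) fX X(1) by (intro card_Un_disjoint) auto
      ultimately show "(weight p \<circ> \<phi>) (g, N, X, Y) \<le> weight p s * b * (1 / real n) ^ card N"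
        using p by (simp add: \<phi>_def s power_add mult_left_mono mult.assoc)
    qed
    also have "\<dots> \<le> (\<Sum>(g, N, X, Y)\<in>T0. weight p s * b * (1 / real n) ^ card N)"
      using finT0 b p by (intro sum_mono2) (auto simp: T_def)
    also have "\<dots> = (\<Sum>g\<in>G. \<Sum>N\<in>NN. real (card (XY g N)) * (weight p s * b * (1 / real n) ^ card N))"
      unfolding T0_def using finG finNN finXY
      by (subst sum.Sigma[symmetric], simp, simp, intro sum.cong refl)
        (subst sum.Sigma[symmetric], auto simp: case_prod_unfold)
    also have "\<dots> \<le> (\<Sum>g\<in>G. \<Sum>N\<in>NN. real (reg_const k M) * (weight p s * b * (1 / real n) ^ card N))"
      using cXY b p by (intro sum_mono mult_right_mono) auto
    also have "\<dots> = real (card G) * (real (reg_const k M) * (weight p s * b) * (\<Sum>N\<in>NN. (1 / real n) ^ card N))"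
      by (simp add: sum_distrib_left mult_ac)
    also have "\<dots> \<le> real K * (real (reg_const k M) * (weight p s * b) * (real M + 1))"
      using cG sum_small_subsets[OF n, of M] b p unfolding NN_def
      by (intro mult_mono mult_left_mono) (auto intro!: sum_nonneg mult_nonneg_nonneg)
    finally show ?thesis using finite_subset[OF sub] finT by (simp add: mult_ac)
  qed
  then show "finite (regs k m M n K s)"
    "sum (weight p) (regs k m M n K s) \<le> (real K * (real M + 1) * real (reg_const k M) * b) * weight p s"
    by blast+
qed

text \<open>Counts sets of at most \<open>M\<close> edges among at most
  \<open>(w + M + 1) ^ k\<close> candidates.\<close>

definition deg_const :: "nat \<Rightarrow> nat \<Rightarrow> nat \<Rightarrow> nat" where
  "deg_const k M w = (M + 1) * (w + M + 1) ^ (k * M)"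

text \<open>New edges may join arbitrary explored vertices here, so the number of choices grows with
  \<open>w\<close>. The gap \<open>\<epsilon>\<close> left after paying for the new vertices has to
  compensate for this.\<close>

lemma degs_sum:
  fixes p m \<epsilon> :: real
  assumes p: "p \<ge> 0" and n: "n \<ge> 1"
    and pb: "\<And>c. p ^ c \<le> real n powr (- real c / m)"
    and gap: "\<And>a c. a \<le> M \<Longrightarrow> c \<le> M \<Longrightarrow> real a < real c / m \<Longrightarrow> real a + \<epsilon> \<le> real c / m"
  shows "finite (degs k m M n w s)"
    and "sum (weight p) (degs k m M n w s) \<le>
      ((real M + 1) * real (deg_const k M w) * real n powr (- \<epsilon>)) * weight p s"
proof -
  obtain V E I where s: "s = (V, E, I)" by (cases s)
  define NN where "NN = {N. N \<subseteq> {1..n} \<and> card N \<le> M}"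
  define XX where "XX N = {X. X \<subseteq> nsets (V \<union> N) k \<and> card X \<le> M}" for N
  define T0 where "T0 = (SIGMA N:NN. XX N)"
  define T where "T = {t \<in> T0. case t of (N, X) \<Rightarrow> X \<inter> E = {} \<and> real (card N) < real (card X) / m}"
  define \<phi> :: "nat set \<times> nat set set \<Rightarrow> state"
    where "\<phi> = (\<lambda>(N, X). (V \<union> N, E \<union> X, intact (E \<union> X) I))"
  have main: "finite (degs k m M n w s) \<and> sum (weight p) (degs k m M n w s) \<le>
      ((real M + 1) * real (deg_const k M w) * real n powr (- \<epsilon>)) * weight p s"
  proof (cases "degs k m M n w s = {}")
    case True
    then show ?thesis using p by simp
  next
    case False
    then have side: "finite E" "card V \<le> w" "V \<subseteq> {1..n}" by (auto simp: degs_def deg_step_def s)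
    have finV: "finite V" using side(3) finite_subset by blast
    have finNN: "finite NN" unfolding NN_def by simp
    have finN: "finite N" "card N \<le> M" if "N \<in> NN" for N
      using that by (auto simp: NN_def intro: finite_subset)
    have finns: "finite (nsets (V \<union> N) k)" if "N \<in> NN" for N
      using finV finN[OF that] by (intro finite_imp_finite_nsets) simp
    have finXX: "finite (XX N)" if "N \<in> NN" for N
      using finns[OF that] by (simp add: XX_def)
    have cXX: "card (XX N) \<le> deg_const k M w" if N: "N \<in> NN" for N
    proof -
      let ?c = "card (V \<union> N)"
      have c: "?c \<le> w + M + 1" using card_Un_le[of V N] side(2) finN(2)[OF N] by simp
      have "card (nsets (V \<union> N) k) = ?c choose k" by (rule card_nsets)
      also have "\<dots> \<le> ?c ^ k" by (cases "k \<le> ?c") (auto simp: binomial_le_pow binomial_eq_0)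
      also have "\<dots> \<le> (w + M + 1) ^ k" using c by (intro power_mono) auto
      finally have "card (XX N) \<le> (M + 1) * ((w + M + 1) ^ k) ^ M"
        unfolding XX_def by (intro card_small_subsets finns[OF N]) auto
      then show ?thesis by (simp add: deg_const_def power_mult)
    qed
    have finT0: "finite T0" unfolding T0_def using finNN finXX by (intro finite_SigmaI) auto
    then have finT: "finite T" by (simp add: T_def)
    have sub: "degs k m M n w s \<subseteq> \<phi> ` T"
    proof
      fix s' assume s': "s' \<in> degs k m M n w s"
      obtain V' E' I' where s'e: "s' = (V', E', I')" by (cases s')
      have st: "V \<subseteq> V'" "E \<subseteq> E'" "card (V' - V) \<le> M" "card (E' - E) \<le> M" "E' - E \<subseteq> nsets V' k"
        "real (card (V' - V)) < real (card (E' - E)) / m" "V' \<subseteq> {1..n}" "I' = intact E' I"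
        using s' by (auto simp: degs_def deg_step_def s s'e)
      have "V \<union> (V' - V) = V'" using st(1) by blast
      then have "(V' - V, E' - E) \<in> T"
        using st by (auto simp: T_def T0_def NN_def XX_def)
      moreover have "\<phi> (V' - V, E' - E) = s'"
        using st(1,2,8) by (simp add: \<phi>_def s'e Un_absorb1)
      ultimately show "s' \<in> \<phi> ` T" by blast
    qed
    let ?\<rho> = "weight p s * real n powr (- \<epsilon>)"
    have "sum (weight p) (degs k m M n w s) \<le> sum (weight p) (\<phi> ` T)"
      using sub finT p by (intro sum_mono2) auto
    also have "\<dots> \<le> sum (weight p \<circ> \<phi>) T"
      using finT p by (intro sum_image_le) auto
    also have "\<dots> \<le> (\<Sum>(N, X)\<in>T. ?\<rho> * (1 / real n) ^ card N)"
    proof (intro sum_mono, clarify)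
      fix N X assume t: "(N, X) \<in> T"
      then have X: "X \<inter> E = {}" "real (card N) < real (card X) / m" "card X \<le> M" "X \<subseteq> nsets (V \<union> N) k"
        and N: "N \<in> NN" by (auto simp: T_def T0_def XX_def)
      have fX: "finite X" using X(4) finns[OF N] by (rule finite_subset)
      have "p ^ card X \<le> real n powr (- real (card X) / m)" by (rule pb)
      also have "\<dots> \<le> real n powr (- \<epsilon> + - real (card N))"
        using gap[OF finN(2)[OF N] X(3,2)] n by (intro powr_mono) auto
      also have "\<dots> = real n powr (- \<epsilon>) * (1 / real n) ^ card N"
        using n by (simp only: powr_add powr_minus_nat)
      finally have "p ^ card X \<le> real n powr (- \<epsilon>) * (1 / real n) ^ card N" .
      moreover have "card (E \<union> X) = card E + card X"
        using side(1) fX X(1) by (intro card_Un_disjoint) auto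
      ultimately show "(weight p \<circ> \<phi>) (N, X) \<le> ?\<rho> * (1 / real n) ^ card N"
        using p by (simp add: \<phi>_def s power_add mult_left_mono mult.assoc)
    qed
    also have "\<dots> \<le> (\<Sum>(N, X)\<in>T0. ?\<rho> * (1 / real n) ^ card N)"
      using finT0 p by (intro sum_mono2) (auto simp: T_def)
    also have "\<dots> = (\<Sum>N\<in>NN. real (card (XX N)) * (?\<rho> * (1 / real n) ^ card N))"
      unfolding T0_def using finNN finXX by (subst sum.Sigma[symmetric]) auto
    also have "\<dots> \<le> (\<Sum>N\<in>NN. real (deg_const k M w) * (?\<rho> * (1 / real n) ^ card N))"
      using cXX p by (intro sum_mono mult_right_mono) auto
    also have "\<dots> = real (deg_const k M w) * ?\<rho> * (\<Sum>N\<in>NN. (1 / real n) ^ card N)"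
      by (simp add: sum_distrib_left mult_ac)
    also have "\<dots> \<le> real (deg_const k M w) * ?\<rho> * (real M + 1)"
      using sum_small_subsets[OF n, of M] p unfolding NN_def by (intro mult_left_mono) auto
    finally show ?thesis using finite_subset[OF sub] finT by (simp add: mult_ac)
  qed
  then show "finite (degs k m M n w s)" "sum (weight p) (degs k m M n w s) \<le>
      ((real M + 1) * real (deg_const k M w) * real n powr (- \<epsilon>)) * weight p s"
    by blast+
qed

text \<open>All set systems on at most \<open>v\<close> vertices, far more than the copies of H1,
  but still of total weight of order \<open>n ^ v\<close>.\<close>

definition init :: "nat \<Rightarrow> nat \<Rightarrow> state set" where
  "init v n = {(U, X, {}) | U X. U \<subseteq> {1..n} \<and> card U \<le> v \<and> X \<subseteq> Pow U}"

text \<open>The last condition says that \<open>lam\<close> is negative, that is, the density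
  exceeds \<open>m\<close>: these are bounded subgraphs that the random graph is unlikely to
  contain. The form of a state lets \<open>weight\<close> apply.\<close>

definition sparse_bad :: "nat \<Rightarrow> nat \<Rightarrow> real \<Rightarrow> state set" where
  "sparse_bad K n m = {(U, X, {}) | U X. U \<subseteq> {1..n} \<and> card U \<le> K \<and> X \<subseteq> Pow U \<and> real (card U) < real (card X) / m}"

text \<open>Serves \<open>init\<close> with \<open>c\<close> equal to \<open>n ^ v\<close> and
  \<open>sparse_bad\<close> with \<open>c\<close> a negative power of \<open>n\<close>.\<close>

lemma sum_bounded_states:
  fixes f :: "state \<Rightarrow> real"
  assumes n: "n \<ge> 1" and S: "S \<subseteq> init K n" and c: "c \<ge> 0"
    and f: "\<And>U X. (U, X, {}) \<in> S \<Longrightarrow> f (U, X, {}) \<le> c * (1 / real n) ^ card U"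
  shows "finite S" and "sum f S \<le> (real K + 1) * 2 ^ 2 ^ K * c"
proof -
  define NN where "NN = {N. N \<subseteq> {1..n} \<and> card N \<le> K}"
  define T where "T = (SIGMA N:NN. Pow (Pow N))"
  define \<phi> :: "nat set \<times> nat set set \<Rightarrow> state" where "\<phi> = (\<lambda>(N, X). (N, X, {}))"
  have finNN: "finite NN" unfolding NN_def by simp
  have finN: "finite N" if "N \<in> NN" for N using that by (auto simp: NN_def intro: finite_subset)
  have finT: "finite T" unfolding T_def using finNN finN by (intro finite_SigmaI) auto
  have sub: "S \<subseteq> \<phi> ` T"
    using S by (auto simp: init_def \<phi>_def T_def NN_def image_iff)
  then show fS: "finite S" using finT finite_subset by blast
  define g where "g = (\<lambda>s :: state. c * (1 / real n) ^ card (fst s))"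
  have "sum f S \<le> sum g S"
  proof (rule sum_mono)
    fix s assume s: "s \<in> S"
    obtain U X where "s = (U, X, {})" using S s by (auto simp: init_def)
    then show "f s \<le> g s" using f s by (simp add: g_def)
  qed
  also have "\<dots> \<le> sum g (\<phi> ` T)"
    using sub finT c by (intro sum_mono2) (auto simp: g_def)
  also have "\<dots> \<le> sum (g \<circ> \<phi>) T"
    using finT c by (intro sum_image_le) (auto simp: g_def)
  also have "\<dots> = (\<Sum>(N, X)\<in>T. c * (1 / real n) ^ card N)"
    by (intro sum.cong refl) (auto simp: g_def \<phi>_def)
  also have "\<dots> = (\<Sum>N\<in>NN. real (card (Pow (Pow N))) * (c * (1 / real n) ^ card N))"
    unfolding T_def using finNN finN by (subst sum.Sigma[symmetric]) auto
  also have "\<dots> \<le> (\<Sum>N\<in>NN. 2 ^ 2 ^ K * (c * (1 / real n) ^ card N))"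
  proof (intro sum_mono mult_right_mono)
    fix N assume N: "N \<in> NN"
    have "(2::nat) ^ card N \<le> 2 ^ K" using N by (intro power_increasing) (auto simp: NN_def)
    then have "(2::nat) ^ 2 ^ card N \<le> 2 ^ 2 ^ K" by (intro power_increasing) auto
    then have "card (Pow (Pow N)) \<le> 2 ^ 2 ^ K" using finN[OF N] by (simp add: card_Pow)
    then have "real (card (Pow (Pow N))) \<le> real (2 ^ 2 ^ K)" by (simp only: of_nat_le_iff)
    then show "real (card (Pow (Pow N))) \<le> 2 ^ 2 ^ K" by simp
  qed (use c in auto)
  also have "\<dots> = 2 ^ 2 ^ K * c * (\<Sum>N\<in>NN. (1 / real n) ^ card N)"
    by (simp add: sum_distrib_left mult_ac)
  also have "\<dots> \<le> 2 ^ 2 ^ K * c * (real K + 1)"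
    using sum_small_subsets[OF n, of K] c unfolding NN_def by (intro mult_left_mono) auto
  finally show "sum f S \<le> (real K + 1) * 2 ^ 2 ^ K * c" by (simp add: mult_ac)
qed

lemma init_sum:
  assumes "n \<ge> 1" "0 \<le> p" "p \<le> 1"
  shows "finite (init v n)" and "sum (weight p) (init v n) \<le> (real v + 1) * 2 ^ 2 ^ v * real n ^ v"
proof -
  have *: "weight p (U, X, {}) \<le> real n ^ v * (1 / real n) ^ card U" if "(U, X, {}) \<in> init v n" for U X
  proof -
    have "card U \<le> v" using that by (auto simp: init_def)
    then have "real n ^ card U \<le> real n ^ v" using assms(1) by (intro power_increasing) auto
    then have "1 \<le> real n ^ v * (1 / real n) ^ card U"
      using assms(1) by (simp add: power_one_over field_simps)
    moreover have "p ^ card X \<le> 1" using assms(2,3) by (simp add: power_le_one)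
    ultimately show ?thesis by simp
  qed
  show "finite (init v n)" and "sum (weight p) (init v n) \<le> (real v + 1) * 2 ^ 2 ^ v * real n ^ v"
    using sum_bounded_states[OF assms(1) order_refl _ *] by simp_all
qed

lemma sparse_bad_sum:
  fixes p m \<epsilon> :: real
  assumes n: "n \<ge> 1"
    and pb: "\<And>c. p ^ c \<le> real n powr (- real c / m)"
    and gap: "\<And>a c. a \<le> 2 ^ K \<Longrightarrow> c \<le> 2 ^ K \<Longrightarrow> real a < real c / m \<Longrightarrow> real a + \<epsilon> \<le> real c / m"
  shows "finite (sparse_bad K n m)"
    and "sum (weight p) (sparse_bad K n m) \<le> (real K + 1) * 2 ^ 2 ^ K * real n powr (- \<epsilon>)"
proof -
  have sub: "sparse_bad K n m \<subseteq> init K n" by (auto simp: sparse_bad_def init_def)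
  have *: "weight p (U, X, {}) \<le> real n powr (- \<epsilon>) * (1 / real n) ^ card U"
    if "(U, X, {}) \<in> sparse_bad K n m" for U X
  proof -
    have U: "U \<subseteq> {1..n}" "card U \<le> K" "X \<subseteq> Pow U" "real (card U) < real (card X) / m"
      using that by (auto simp: sparse_bad_def)
    then have fU: "finite U" by (auto intro: finite_subset)
    have "card X \<le> 2 ^ card U" using card_mono[OF _ U(3)] fU by (simp add: card_Pow)
    also have "\<dots> \<le> 2 ^ K" using U(2) by (intro power_increasing) auto
    finally have cX: "card X \<le> 2 ^ K" .
    have "K < 2 ^ K" by (rule less_exp)
    then have cU: "card U \<le> 2 ^ K" using U(2) by linarith
    have "p ^ card X \<le> real n powr (- real (card X) / m)" by (rule pb)
    also have "\<dots> \<le> real n powr (- \<epsilon> + - real (card U))"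
      using gap[OF cU cX U(4)] n by (intro powr_mono) auto
    also have "\<dots> = real n powr (- \<epsilon>) * (1 / real n) ^ card U"
      using n by (simp only: powr_add powr_minus_nat)
    finally show ?thesis by simp
  qed
  show "finite (sparse_bad K n m)"
    "sum (weight p) (sparse_bad K n m) \<le> (real K + 1) * 2 ^ 2 ^ K * real n powr (- \<epsilon>)"
    using sum_bounded_states[OF n sub _ *] by simp_all
qed

lemma subhypergraph_mono:
  "subhypergraph J (V, E) \<Longrightarrow> V \<subseteq> V' \<Longrightarrow> E \<subseteq> E' \<Longrightarrow> subhypergraph J (V', E')"
  by (auto simp: subhypergraph_def)

section \<open>Runs of the exploration\<close>

context ramsey_core
begin

text \<open>Without intact copies there have been at most \<open>k * M * d\<close> regular steps.\<close>

lemma closed_size: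
  assumes "r \<le> k * M * d" "d \<le> D"
  shows "M * (r + d + 1) \<le> M * (k * M * D + D + 1)"
proof -
  have "k * M * d \<le> k * M * D" using assms(2) by (rule mult_le_mono2)
  then show ?thesis using assms by (intro mult_le_mono2) linarith
qed

lemma M_pos: "M \<ge> 1"
  using v2_gt_k by (simp add: M_def)

text \<open>Runs that follow \<open>progress\<close> keep \<open>r \<le> card I + k * M * d\<close>.
  So once no pair is intact, \<open>r\<close> is bounded in terms of \<open>d\<close> and the
  explored graph has at most \<open>K\<close> vertices and edges. During the whole run
  \<open>w\<close> bounds the vertices. Each step uses up one of the budgets \<open>L\<close> and
  \<open>D\<close>, which yields termination and the two exits \<open>r = L\<close> and
  \<open>d = D\<close>.\<close>

theorem trajectory:
  fixes n L D :: nat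
  defines "K \<equiv> M * (k * M * D + D + 1)" and "w \<equiv> M * (L + D + 1)"
  defines "S \<equiv> reach (init v1 n) (regs k m M n K) (degs k m M n w)"
  assumes world: "world_V \<subseteq> {1..n}" and ne: "AA \<noteq> {}"
  shows "\<exists>r d V E I. r \<le> L \<and> d \<le> D \<and> (V, E, I) \<in> S r d \<and> E \<subseteq> world_E \<and>
    (r = L \<or> d = D \<or> closed_in V E \<and> V \<subseteq> {1..n} \<and> card V \<le> K \<and> E \<subseteq> nsets V k \<and>
      (\<exists>A\<in>AA. subhypergraph A (V, E)))"
proof -
  define P where "P r d V E I \<longleftrightarrow> good V E I \<and> V \<subseteq> {1..n} \<and> E \<subseteq> world_E \<and>
    (\<exists>A\<in>AA. subhypergraph A (V, E)) \<and> r \<le> card I + k * M * d \<and>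
    card V \<le> M * (r + d + 1) \<and> card E \<le> M * (r + d + 1) \<and> (V, E, I) \<in> S r d" for r d V E I
  have *: "\<exists>r d V E I. r \<le> L \<and> d \<le> D \<and> P r d V E I \<and> (r = L \<or> d = D \<or> closed_in V E \<and> I = {})"
    if "r \<le> L" "d \<le> D" "P r d V E I" for r d V E I
    using that
  proof (induction "(L - r) + (D - d)" arbitrary: r d V E I rule: less_induct)
    case less
    show ?case
    proof (cases "r = L \<or> d = D \<or> closed_in V E \<and> I = {}")
      case True
      then show ?thesis using less.prems by blast
    next
      case False
      then have lt: "r < L" "d < D" using less.prems by auto
      have inv: "good V E I" "V \<subseteq> {1..n}" "E \<subseteq> world_E" "r \<le> card I + k * M * d"
        "card V \<le> M * (r + d + 1)" "card E \<le> M * (r + d + 1)" "(V, E, I) \<in> S r d"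
        using less.prems(3) by (auto simp: P_def)
      obtain A where A: "A \<in> AA" "subhypergraph A (V, E)" using less.prems(3) by (auto simp: P_def)
      have "can_step V E I" using progress[OF inv(1)] False by blast
      then obtain V' E' I' where st: "good V' E' I'" "V \<subseteq> V'" "E \<subseteq> E'" "V' \<subseteq> V \<union> world_V" "E' \<subseteq> E \<union> world_E"
        "card (V' - V) \<le> M" "card (E' - E) \<le> M"
        "reg_step k m M (V, E, I) (V', E', I') \<and> card I + 1 \<le> card I' \<or>
         deg_step k m M (V, E, I) (V', E', I') \<and> card I \<le> card I' + k * M"
        unfolding can_step_def by blast
      have V': "V' \<subseteq> {1..n}" using st(4) inv(2) world by blast
      have E': "E' \<subseteq> world_E" using st(5) inv(3) by blast
      have A': "\<exists>A\<in>AA. subhypergraph A (V', E')"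
        using A(1) subhypergraph_mono[OF A(2) st(2,3)] by blast
      have finE: "finite E" using goodD(2)[OF inv(1)] .
      have "card V' = card V + card (V' - V)"
        using card_mono[OF goodD(1)[OF st(1)] st(2)] goodD(1)[OF inv(1)] st(2) by (simp add: card_Diff_subset)
      then have cV: "card V' \<le> M * (r + d + 2)" using st(6) inv(5) by simp
      have "card E' = card E + card (E' - E)"
        using card_mono[OF goodD(2)[OF st(1)] st(3)] finE st(3) by (simp add: card_Diff_subset)
      then have cE: "card E' \<le> M * (r + d + 2)" using st(7) inv(6) by simp
      show ?thesis
      proof (cases "reg_step k m M (V, E, I) (V', E', I') \<and> card I + 1 \<le> card I'")
        case True
        have "card (active_edges E I) \<le> K"
        proof (cases "I = {}")
          case True
          then have "r \<le> k * M * d" using inv(4) by simp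
          then have "card E \<le> K"
            unfolding K_def by (rule order_trans[OF inv(6) closed_size[OF _ less.prems(2)]])
          then show ?thesis using True by (simp add: active_edges_def)
        next
          case False
          have "1 * 1 \<le> K" unfolding K_def using M_pos by (intro mult_le_mono) auto
          then show ?thesis using False by (simp add: active_edges_def)
        qed
        then have "(V', E', I') \<in> regs k m M n K (V, E, I)"
          using True V' finE by (simp add: regs_def)
        then have "(V', E', I') \<in> S (Suc r) d" using inv(7) reach_R unfolding S_def by metis
        then have "P (Suc r) d V' E' I'"
          using st(1) V' E' A' True inv(4) cV cE by (simp add: P_def)
        then show ?thesis using lt less.hyps[of "Suc r" d] by simp
      next
        case False
        then have ds: "deg_step k m M (V, E, I) (V', E', I')" "card I \<le> card I' + k * M" using st(8) by blast+
        have "M * (r + d + 1) \<le> w" unfolding w_def using lt by (intro mult_le_mono2) simp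
        then have "(V', E', I') \<in> degs k m M n w (V, E, I)"
          using ds V' finE inv(5) by (simp add: degs_def)
        then have "(V', E', I') \<in> S r (Suc d)" using inv(7) reach_D unfolding S_def by metis
        then have "P r (Suc d) V' E' I'"
          using st(1) V' E' A' ds(2) inv(4) cV cE by (simp add: P_def algebra_simps)
        then show ?thesis using lt less.hyps[of r "Suc d"] by simp
      qed
    qed
  qed
  obtain A where A: "A \<in> AA" using ne by auto
  then have AH: "A \<in> HA" using AA by auto
  note fin = HA_fin[OF AH] HA_nv[OF AH] HA_ne[OF AH]
  have vA: "verts A \<subseteq> {1..n}" using world world_AA(1)[OF A] by blast
  have "P 0 0 (verts A) (edges A) {}"
    unfolding P_def
  proof (intro conjI)
    have "edges A \<noteq> {}" using fin(7) e1_ge2 by auto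
    then show "good (verts A) (edges A) {}"
      using fin nsets_HA[OF AH order_refl] by (auto simp: good_def)
    show "edges A \<subseteq> world_E" using world_AA(2)[OF A] .
    have "subhypergraph A (verts A, edges A)" using fin(4) by (auto simp: subhypergraph_def)
    then show "\<exists>A'\<in>AA. subhypergraph A' (verts A, edges A)" using A by blast
    have "(verts A, edges A, {}) \<in> init v1 n" using vA fin(4,6) by (auto simp: init_def)
    then show "(verts A, edges A, {}) \<in> S 0 0" by (simp add: S_def)
  qed (use fin vA in \<open>auto simp: M_def\<close>)
  then obtain r d V E I where st: "r \<le> L" "d \<le> D" "P r d V E I"
    "r = L \<or> d = D \<or> closed_in V E \<and> I = {}"
    using *[of 0 0] by blast
  have "card V \<le> K" if "I = {}"
  proof -
    have V: "card V \<le> M * (r + d + 1)" "r \<le> k * M * d" using st(3) that by (simp_all add: P_def)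
    show ?thesis unfolding K_def by (rule order_trans[OF V(1) closed_size[OF V(2) st(2)]])
  qed
  moreover have "E \<subseteq> nsets V k" "(V, E, I) \<in> S r d" "E \<subseteq> world_E" "V \<subseteq> {1..n}"
    "\<exists>A\<in>AA. subhypergraph A (V, E)"
    using st(3) by (simp_all add: P_def good_def)
  ultimately show ?thesis using st(1,2,4) by (intro exI[of _ r] exI[of _ d] exI[of _ V] exI[of _ E] exI[of _ I]) auto
qed

end

section \<open>The first moment bound\<close>

lemma prob_contains:
  assumes "finite E" "0 \<le> p" "p \<le> 1"
  shows "measure_pmf.prob (random_kgraph k n p) {G. E \<subseteq> edges G} \<le> p ^ card E"
proof (cases "E \<subseteq> nsets {1..n} k")
  case True
  let ?N = "nsets {1..n} k"
  let ?B = "\<lambda>e. if e \<in> E then {True} else UNIV"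
  have fin: "finite ?N" by (rule finite_imp_finite_nsets) simp
  have "measure_pmf.prob (random_kgraph k n p) {G. E \<subseteq> edges G} =
    measure_pmf.prob (Pi_pmf ?N False (\<lambda>_. bernoulli_pmf p)) (Pi ?N ?B)"
    unfolding random_kgraph_def measure_map_pmf
    using True by (intro arg_cong[where f = "measure_pmf.prob _"]) (auto simp: Pi_def)
  also have "\<dots> = (\<Prod>e\<in>?N. measure_pmf.prob (bernoulli_pmf p) (?B e))"
    by (rule measure_Pi_pmf_Pi[OF fin])
  also have "\<dots> = (\<Prod>e\<in>?N. if e \<in> E then p else 1)"
    using assms by (intro prod.cong refl) (auto simp: measure_pmf_single)
  also have "\<dots> = p ^ card E"
    using True fin by (simp add: prod.If_cases Int_absorb1)
  finally show ?thesis by simp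
next
  case False
  have "measure_pmf.prob (random_kgraph k n p) {G. E \<subseteq> edges G} = 0"
  proof -
    have "(\<lambda>X. ({1..n}, {e \<in> nsets {1..n} k. X e})) -` {G. E \<subseteq> edges G} = {}"
      using False by auto
    then show ?thesis unfolding random_kgraph_def measure_map_pmf by (simp only: measure_empty)
  qed
  then show ?thesis using assms by simp
qed

lemma prob_union_states:
  assumes "finite S" "\<And>s. s \<in> S \<Longrightarrow> finite (fst (snd s))" "0 \<le> p" "p \<le> 1"
    and sub: "\<And>G. G \<in> set_pmf (random_kgraph k n p) \<Longrightarrow> G \<in> Ev \<Longrightarrow> \<exists>s\<in>S. fst (snd s) \<subseteq> edges G"
  shows "measure_pmf.prob (random_kgraph k n p) Ev \<le> sum (weight p) S"
proof -
  have "measure_pmf.prob (random_kgraph k n p) Ev =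
    measure_pmf.prob (random_kgraph k n p) (Ev \<inter> set_pmf (random_kgraph k n p))"
    by (simp add: measure_Int_set_pmf)
  also have "\<dots> \<le> measure_pmf.prob (random_kgraph k n p) (\<Union>s\<in>S. {G. fst (snd s) \<subseteq> edges G})"
    by (rule measure_pmf.finite_measure_mono) (use sub in auto)
  also have "\<dots> \<le> (\<Sum>s\<in>S. measure_pmf.prob (random_kgraph k n p) {G. fst (snd s) \<subseteq> edges G})"
    using assms(1) by (rule measure_UNION_le) simp
  also have "\<dots> \<le> sum (weight p) S"
    using assms by (intro sum_mono prob_contains) auto
  finally show ?thesis .
qed

lemma polylog_bound:
  fixes \<epsilon> a :: real and c v j :: nat
  assumes "\<epsilon> > 0"
  shows "\<forall>\<^sub>F n::nat in sequentially. a * (real c * real (v * nat \<lceil>log 2 (real n)\<rceil>) + real c) ^ j \<le> real n powr \<epsilon>"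
proof -
  \<comment> \<open>One half of \<open>\<epsilon>\<close> pays for the constant \<open>a\<close>,
    the other for the power \<open>j\<close>; adding 1 avoids a zero denominator.\<close>
  define \<eta> where "\<eta> = \<epsilon> / (2 * (real j + 1))"
  have \<eta>: "\<eta> > 0" "\<eta> * real j \<le> \<epsilon> / 2"
    using assms by (auto simp: \<eta>_def field_simps)
  define C where "C = real c * real v + real c"
  have "((\<lambda>n::nat. (log 2 (real n) + 2) / real n powr \<eta>) \<longlongrightarrow> 0) sequentially"
    using \<eta>(1) by real_asymp
  then have "((\<lambda>n::nat. C * ((log 2 (real n) + 2) / real n powr \<eta>)) \<longlongrightarrow> 0) sequentially"
    using tendsto_mult_right_zero by blast
  then have ev1: "\<forall>\<^sub>F n in sequentially. C * ((log 2 (real n) + 2) / real n powr \<eta>) < 1"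
    by (rule order_tendstoD) simp
  have "filterlim (\<lambda>n::nat. real n powr (\<epsilon> / 2)) at_top sequentially"
    using assms by real_asymp
  then have ev2: "\<forall>\<^sub>F n in sequentially. \<bar>a\<bar> \<le> real n powr (\<epsilon> / 2)"
    by (simp add: filterlim_at_top)
  show ?thesis
    using ev1 ev2 eventually_ge_at_top[of 1]
  proof eventually_elim
    case (elim n)
    let ?l = "nat \<lceil>log 2 (real n)\<rceil>"
    have l0: "log 2 (real n) \<ge> 0" using elim(3) by simp
    then have l: "real ?l \<le> log 2 (real n) + 1" by linarith
    have np: "real n powr \<eta> > 0" using elim(3) by simp
    have "real c * real (v * ?l) + real c = (real c * real v) * real ?l + real c" by simp
    also have "\<dots> \<le> (real c * real v) * (log 2 (real n) + 1) + real c"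
      using l by (intro add_mono mult_left_mono) auto
    also have "\<dots> \<le> C * (log 2 (real n) + 2)"
      using l0 by (simp add: C_def algebra_simps)
    also have "\<dots> \<le> real n powr \<eta>" using elim(1) np by (simp add: field_simps)
    finally have X: "real c * real (v * ?l) + real c \<le> real n powr \<eta>" .
    have "a * (real c * real (v * ?l) + real c) ^ j \<le> \<bar>a\<bar> * (real c * real (v * ?l) + real c) ^ j"
      by (intro mult_right_mono) auto
    also have "\<dots> \<le> real n powr (\<epsilon> / 2) * (real n powr \<eta>) ^ j"
      using elim(2) X by (intro mult_mono power_mono) auto
    also have "(real n powr \<eta>) ^ j = real n powr (\<eta> * real j)"
      using elim(3) by (simp add: powr_powr flip: powr_realpow)
    also have "\<dots> \<le> real n powr (\<epsilon> / 2)" using elim(3) \<eta>(2) by (intro powr_mono) auto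
    finally show ?case using elim(3) by (simp flip: powr_add)
  qed
qed

lemma finite_reach_edges:
  assumes "k \<ge> 1" "(V', E', I') \<in> reach (init v n) (regs k m M n K) (degs k m M n w) r d"
  shows "finite E'"
proof -
  consider "(V', E', I') \<in> init v n" | s where "(V', E', I') \<in> regs k m M n K s"
    | s where "(V', E', I') \<in> degs k m M n w s"
    using assms(2) by (cases r; cases d) auto
  then show ?thesis
  proof cases
    case 1
    then have "E' \<subseteq> Pow {1..n}" by (auto simp: init_def)
    then show ?thesis by (rule finite_subset) simp
  next
    case (2 s)
    obtain V E I where s: "s = (V, E, I)" by (cases s)
    obtain g where g: "card g = k" "E' - E \<subseteq> Pow (g \<union> (V' - V))" "V' \<subseteq> {1..n}" "finite E"
      using 2 by (auto simp: regs_def reg_step_def s)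
    have "finite g" using g(1) assms(1) card_ge_0_finite[of g] by simp
    moreover have "finite V'" using g(3) finite_subset by blast
    ultimately have "finite (E' - E)" using g(2) by (auto intro: finite_subset)
    then show ?thesis using g(4) by simp
  next
    case (3 s)
    obtain V E I where s: "s = (V, E, I)" by (cases s)
    have g: "E' - E \<subseteq> nsets V' k" "V' \<subseteq> {1..n}" "finite E"
      using 3 by (auto simp: degs_def deg_step_def s)
    then have "finite (nsets V' k)" by (intro finite_imp_finite_nsets) (auto intro: finite_subset)
    then have "finite (E' - E)" using g(1) finite_subset by blast
    then show ?thesis using g(3) by simp
  qed
qed

context ramsey_pair
begin

text \<open>The number \<open>L\<close> of regular steps is logarithmic, so that \<open>2 ^ L\<close> beats the number of
  starting copies; \<open>D\<close> degenerate steps lose a power \<open>D * \<epsilon>\<close> of \<open>n\<close>, which beats it as well.\<close>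

theorem cores_unlikely:
  fixes Ev :: "nat \<Rightarrow> nat hypergraph set"
  assumes cores: "\<And>n G. G \<in> Ev n \<Longrightarrow> kgraph k G \<Longrightarrow> verts G = {1..n} \<Longrightarrow>
    \<exists>AA BB. ramsey_core k v1 e1 v2 e2 m m2 HA HB AA BB \<and> AA \<noteq> {} \<and>
      (\<forall>C\<in>AA \<union> BB. subhypergraph C G) \<and>
      (\<forall>V E. kgraph k (V, E) \<longrightarrow> (\<exists>A\<in>AA. subhypergraph A (V, E)) \<longrightarrow>
        (\<forall>C\<in>AA \<union> BB. edges C \<inter> E \<noteq> {} \<longrightarrow> subhypergraph C (V, E)) \<longrightarrow>
        (\<exists>J. subhypergraph J (V, E) \<and> real (nv J) < real (ne J) / m))"
  shows "\<exists>b::real. b > 0 \<and> (\<forall>p :: nat \<Rightarrow> real. (\<forall>n. 0 \<le> p n \<and> p n \<le> 1) \<longrightarrow>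
       (\<forall>n\<ge>1. p n \<le> b * real n powr (- 1 / m)) \<longrightarrow>
       (\<lambda>n. measure_pmf.prob (random_kgraph k n (p n)) (Ev n)) \<longlonglongrightarrow> 0)"
proof -
  obtain \<epsilon> where eps: "\<epsilon> > 0"
    "\<And>a c. a \<le> M \<Longrightarrow> c \<le> M \<Longrightarrow> real a < real c / m \<Longrightarrow> real a + \<epsilon> \<le> real c / m"
    using density_gap[of M m] by blast
  \<comment> \<open>Half of \<open>\<epsilon>\<close> in each degenerate step is spent on its
    polylogarithmically many choices. The other half, over \<open>D\<close> steps, beats the
    \<open>n ^ v1\<close> starting states with a factor \<open>n\<close> to spare for the sum over
    \<open>r\<close>.\<close>
  obtain D :: nat where D: "real v1 + 1 \<le> \<epsilon> / 2 * real D"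
    using real_arch_simple[of "(real v1 + 1) / (\<epsilon> / 2)"] eps(1) by (auto simp: field_simps)
  define K where "K = M * (k * M * D + D + 1)"
  \<comment> \<open>A second gap is needed because a set system on \<open>K\<close> vertices may
    have up to \<open>2 ^ K\<close> edges.\<close>
  obtain \<epsilon>' where eps': "\<epsilon>' > 0"
    "\<And>a c. a \<le> 2 ^ K \<Longrightarrow> c \<le> 2 ^ K \<Longrightarrow> real a < real c / m \<Longrightarrow> real a + \<epsilon>' \<le> real c / m"
    using density_gap[of "2 ^ K" m] by blast
  define q0 where "q0 = real K * (real M + 1) * real (reg_const k M)"
  have q0: "q0 \<ge> 0" by (simp add: q0_def)
  \<comment> \<open>Including the factor 2 of \<open>reach_weight\<close>, every regular step now at
    least halves the weight; the summand 1 keeps the denominator positive and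
    \<open>b \<le> 1\<close>.\<close>
  define b where "b = 1 / (4 * q0 + 1)"
  have b: "b > 0" "b \<le> 1" "2 * (q0 * b) \<le> 1 / 2"
    using q0 by (auto simp: b_def field_simps)
  define L where "L n = (v1 + 1) * nat \<lceil>log 2 (real n)\<rceil>" for n :: nat
  define w where "w n = M * (L n + D + 1)" for n
  define \<delta> where "\<delta> n = (real M + 1) * real (deg_const k M (w n)) * real n powr (- \<epsilon>)" for n :: nat
  define C0 where "C0 = (real v1 + 1) * 2 ^ 2 ^ v1"
  define C1 where "C1 = (real K + 1) * 2 ^ 2 ^ K"
  define S where "S n = reach (init v1 n) (regs k m M n K) (degs k m M n (w n))" for n
  define bound where "bound n = (real D * C0 + real (L n + 1) * C0) / real n + C1 * real n powr (- \<epsilon>')" for n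
  have C0: "C0 \<ge> 0" by (simp add: C0_def)

  have ev\<delta>: "\<forall>\<^sub>F n in sequentially. 2 * \<delta> n \<le> real n powr (- (\<epsilon> / 2))"
  proof -
    let ?c = "M * (D + 1) + M + 1" and ?a = "2 * (real M + 1) * (real M + 1)"
    have "\<forall>\<^sub>F n in sequentially. ?a * (real ?c * real (L n) + real ?c) ^ (k * M) \<le> real n powr (\<epsilon> / 2)"
      unfolding L_def using eps(1) by (intro polylog_bound) simp
    then show ?thesis
      using eventually_ge_at_top[of 1]
    proof eventually_elim
      case (elim n)
      have "w n + M + 1 \<le> ?c * L n + ?c" unfolding w_def by (simp add: algebra_simps)
      then have "real (w n + M + 1) \<le> real ?c * real (L n) + real ?c"
        by (metis of_nat_add of_nat_le_iff of_nat_mult)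
      then have "real (w n + M + 1) ^ (k * M) \<le> (real ?c * real (L n) + real ?c) ^ (k * M)"
        by (intro power_mono) auto
      then have "?a * real (w n + M + 1) ^ (k * M) \<le> ?a * (real ?c * real (L n) + real ?c) ^ (k * M)"
        by (intro mult_left_mono) auto
      also have "\<dots> \<le> real n powr (\<epsilon> / 2)" by (rule elim(1))
      finally have "?a * real (w n + M + 1) ^ (k * M) * real n powr (- \<epsilon>) \<le>
          real n powr (\<epsilon> / 2) * real n powr (- \<epsilon>)"
        by (intro mult_right_mono) auto
      also have "\<dots> = real n powr (- (\<epsilon> / 2))" by (simp flip: powr_add)
      finally have "?a * real (w n + M + 1) ^ (k * M) * real n powr (- \<epsilon>) \<le> real n powr (- (\<epsilon> / 2))" .
      moreover have "real (deg_const k M (w n)) = (real M + 1) * real (w n + M + 1) ^ (k * M)"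
        by (simp add: deg_const_def algebra_simps)
      ultimately show ?case by (simp only: \<delta>_def mult_ac)
    qed
  qed

  have lim: "bound \<longlonglongrightarrow> 0"
  proof -
    have "(\<lambda>n. real n powr (- \<epsilon>')) \<longlonglongrightarrow> 0" using eps'(1) by real_asymp
    then have l1: "(\<lambda>n. C1 * real n powr (- \<epsilon>')) \<longlonglongrightarrow> 0" by (rule tendsto_mult_right_zero)
    have "(\<lambda>n. (log 2 (real n) + 3) / real n) \<longlonglongrightarrow> 0" by real_asymp
    then have "(\<lambda>n. ((real D + real v1 + 1) * C0) * ((log 2 (real n) + 3) / real n)) \<longlonglongrightarrow> 0"
      by (rule tendsto_mult_right_zero)
    moreover have "\<forall>\<^sub>F n in sequentially. norm ((real D * C0 + real (L n + 1) * C0) / real n) \<le>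
      ((real D + real v1 + 1) * C0) * ((log 2 (real n) + 3) / real n)"
      using eventually_ge_at_top[of 1]
    proof eventually_elim
      case (elim n)
      let ?l = "log 2 (real n)"
      have l0: "?l \<ge> 0" using elim by simp
      then have "real (nat \<lceil>?l\<rceil>) \<le> ?l + 1" by linarith
      then have "real (L n) \<le> (real v1 + 1) * (?l + 1)"
        unfolding L_def of_nat_mult by (intro mult_mono) auto
      then have "real D + real (L n + 1) \<le> real D * 1 + ((real v1 + 1) * (?l + 1) + 1)" by simp
      also have "\<dots> \<le> real D * (?l + 3) + ((real v1 + 1) * (?l + 1) + (real v1 + 1) * 2)"
        using l0 by (intro add_mono mult_left_mono) auto
      also have "\<dots> = (real D + real v1 + 1) * (?l + 3)" by (simp add: algebra_simps)
      finally have "(real D + real (L n + 1)) * C0 \<le> (real D + real v1 + 1) * (?l + 3) * C0"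
        using C0 by (rule mult_right_mono)
      then have "(real D * C0 + real (L n + 1) * C0) / real n \<le> ((real D + real v1 + 1) * (?l + 3) * C0) / real n"
        by (intro divide_right_mono) (auto simp: distrib_right)
      then show ?case using C0 by (simp add: mult_ac)
    qed
    ultimately have "(\<lambda>n. (real D * C0 + real (L n + 1) * C0) / real n) \<longlonglongrightarrow> 0"
      by (rule Lim_null_comparison[rotated])
    then show ?thesis using tendsto_add[OF _ l1] unfolding bound_def by fastforce
  qed

  have "(\<lambda>n. measure_pmf.prob (random_kgraph k n (p n)) (Ev n)) \<longlonglongrightarrow> 0"
    if p01: "\<forall>n. 0 \<le> p n \<and> p n \<le> 1" and pb: "\<forall>n\<ge>1. p n \<le> b * real n powr (- 1 / m)" for p
  proof -
    have "\<forall>\<^sub>F n in sequentially. measure_pmf.prob (random_kgraph k n (p n)) (Ev n) \<le> bound n"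
      using ev\<delta> eventually_ge_at_top[of 1]
    proof eventually_elim
      case (elim n)
      have p: "0 \<le> p n" "p n \<le> 1" using p01 by auto
      have n: "n \<ge> 1" by fact
      have pc: "p n ^ c \<le> b ^ c * real n powr (- real c / m)" for c
      proof -
        have "p n ^ c \<le> (b * real n powr (- 1 / m)) ^ c" using pb n p by (intro power_mono) auto
        also have "\<dots> = b ^ c * real n powr (- real c / m)"
          using n by (simp add: power_mult_distrib powr_powr flip: powr_realpow)
        finally show ?thesis .
      qed
      have pc1: "p n ^ c \<le> b * real n powr (- real c / m)" if "c \<ge> 1" for c
      proof -
        have "b ^ c \<le> b ^ 1" using b that by (intro power_decreasing) auto
        then show ?thesis using pc[of c] mult_right_mono[of "b ^ c" b "real n powr (- real c / m)"] by simp
      qed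
      have pc2: "p n ^ c \<le> real n powr (- real c / m)" for c
        using pc[of c] mult_right_mono[of "b ^ c" 1 "real n powr (- real c / m)"] b
        by (simp add: power_le_one)
      let ?W = "weight (p n)"
      have k1: "k \<ge> 1" using k_ge2 by simp
      have b0: "0 \<le> b" using b(1) by simp
      have \<delta>0: "\<delta> n \<ge> 0" by (simp add: \<delta>_def)
      have sumS: "finite (S n r d) \<and> sum ?W (S n r d) \<le> C0 * real n ^ v1 * ((1 / 2) ^ r * (2 * \<delta> n) ^ d)" for r d
      proof -
        have "finite (S n r d) \<and> sum ?W (S n r d) \<le> sum ?W (init v1 n) * (2 * (q0 * b)) ^ r * (2 * \<delta> n) ^ d"
          unfolding S_def
          using regs_sum[OF k1 p(1) n b0 pc1] degs_sum[OF p(1) n pc2 eps(2)] init_sum[OF n p] q0 b0 \<delta>0 p(1)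
          by (intro reach_weight) (auto simp: q0_def \<delta>_def)
        moreover have "sum ?W (init v1 n) * (2 * (q0 * b)) ^ r * (2 * \<delta> n) ^ d \<le>
          (C0 * real n ^ v1) * (1 / 2) ^ r * (2 * \<delta> n) ^ d"
          using init_sum(2)[OF n p, of v1] b(3) q0 b0 \<delta>0 p(1) C0
          by (intro mult_mono power_mono) (auto simp: C0_def intro!: sum_nonneg)
        ultimately show ?thesis by (simp only: mult.assoc) (meson order_trans)
      qed
      \<comment> \<open>The possible outcomes of \<open>trajectory\<close>: the budget of regular
        steps is used up, or that of degenerate steps, or a bounded closed graph is reached, which
        contains a member of \<open>B3\<close>.\<close>
      define B1 where "B1 = (\<Union>d<D. S n (L n) d)"
      define B2 where "B2 = (\<Union>r\<le>L n. S n r D)"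
      define B3 where "B3 = sparse_bad K n m"
      have fin: "finite B1" "finite B2" "finite B3"
        using sumS sparse_bad_sum(1)[OF n pc2 eps'(2)] by (auto simp: B1_def B2_def B3_def)
      have "2 * \<delta> n \<le> 1"
      proof -
        have "real n powr (- (\<epsilon> / 2)) \<le> real n powr 0" using n eps(1) by (intro powr_mono) auto
        then show ?thesis using elim(1) n by simp
      qed
      have half: "(1 / 2 :: real) ^ L n \<le> 1 / real n ^ (v1 + 1)"
      proof -
        have "real n = 2 powr (log 2 (real n))" using n by simp
        also have "\<dots> \<le> 2 powr (real (nat \<lceil>log 2 (real n)\<rceil>))" by (intro powr_mono) (auto, linarith)
        also have "\<dots> = 2 ^ nat \<lceil>log 2 (real n)\<rceil>" by (simp add: powr_realpow)
        finally have "real n ^ (v1 + 1) \<le> (2 ^ nat \<lceil>log 2 (real n)\<rceil>) ^ (v1 + 1)" by (intro power_mono) auto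
        also have "\<dots> = 2 ^ L n" unfolding L_def by (simp only: power_mult[symmetric] mult.commute)
        finally show ?thesis using n by (simp add: power_one_over frac_le)
      qed
      have "sum ?W B1 \<le> (\<Sum>d<D. sum ?W (S n (L n) d))"
        unfolding B1_def using sumS p by (intro sum_UN_le) auto
      also have "\<dots> \<le> (\<Sum>d<D. C0 / real n)"
      proof (intro sum_mono)
        fix d
        have "(2 * \<delta> n) ^ d \<le> 1" using \<open>2 * \<delta> n \<le> 1\<close> \<delta>0 by (intro power_le_one) auto
        then have "(1 / 2) ^ L n * (2 * \<delta> n) ^ d \<le> 1 / real n ^ (v1 + 1) * 1"
          using half \<delta>0 by (intro mult_mono) auto
        then have "C0 * real n ^ v1 * ((1 / 2) ^ L n * (2 * \<delta> n) ^ d) \<le> C0 * real n ^ v1 * (1 / real n ^ (v1 + 1))"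
          using C0 by (intro mult_left_mono) auto
        also have "\<dots> = C0 / real n" using n by simp
        finally show "sum ?W (S n (L n) d) \<le> C0 / real n" using sumS[of "L n" d] by linarith
      qed
      finally have s1: "sum ?W B1 \<le> real D * C0 / real n" by simp
      have "sum ?W B2 \<le> (\<Sum>r\<le>L n. sum ?W (S n r D))"
        unfolding B2_def using sumS p by (intro sum_UN_le) auto
      also have "\<dots> \<le> (\<Sum>r\<le>L n. C0 / real n)"
      proof (intro sum_mono)
        fix r
        have "(2 * \<delta> n) ^ D \<le> (real n powr (- (\<epsilon> / 2))) ^ D" using elim(1) \<delta>0 by (intro power_mono) auto
        also have "\<dots> = real n powr (- (\<epsilon> / 2 * real D))"
          using n by (simp add: powr_powr flip: powr_realpow)
        also have "\<dots> \<le> real n powr (- real (v1 + 1))" using D n by (intro powr_mono) auto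
        also have "\<dots> = 1 / real n ^ (v1 + 1)" using n by (simp only: powr_minus_nat power_one_over)
        finally have d: "(2 * \<delta> n) ^ D \<le> 1 / real n ^ (v1 + 1)" .
        have "(1 / 2) ^ r * (2 * \<delta> n) ^ D \<le> 1 * (1 / real n ^ (v1 + 1))"
          using d \<delta>0 by (intro mult_mono) (auto intro: power_le_one)
        then have "C0 * real n ^ v1 * ((1 / 2) ^ r * (2 * \<delta> n) ^ D) \<le> C0 * real n ^ v1 * (1 / real n ^ (v1 + 1))"
          using C0 by (intro mult_left_mono) auto
        also have "\<dots> = C0 / real n" using n by simp
        finally show "sum ?W (S n r D) \<le> C0 / real n" using sumS[of r D] by linarith
      qed
      finally have s2: "sum ?W B2 \<le> real (L n + 1) * C0 / real n" by simp
      have s3: "sum ?W B3 \<le> C1 * real n powr (- \<epsilon>')"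
        unfolding B3_def C1_def by (rule sparse_bad_sum(2)[OF n pc2 eps'(2)])
      have "measure_pmf.prob (random_kgraph k n (p n)) (Ev n) \<le> sum ?W (B1 \<union> B2 \<union> B3)"
      proof (rule prob_union_states)
        show "finite (B1 \<union> B2 \<union> B3)" using fin by simp
        show "finite (fst (snd s))" if s: "s \<in> B1 \<union> B2 \<union> B3" for s
        proof (cases "s \<in> B3")
          case True
          then obtain U X where "s = (U, X, {})" "U \<subseteq> {1..n}" "X \<subseteq> Pow U"
            unfolding B3_def sparse_bad_def by blast
          then have "fst (snd s) \<subseteq> Pow {1..n}" by fastforce
          then show ?thesis by (rule finite_subset) simp
        next
          case False
          then obtain r d where "s \<in> S n r d" using s unfolding B1_def B2_def by blast
          then show ?thesis using finite_reach_edges[OF k1] unfolding S_def by (cases s) auto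
        qed
        show "\<exists>s\<in>B1 \<union> B2 \<union> B3. fst (snd s) \<subseteq> edges G"
          if "G \<in> set_pmf (random_kgraph k n (p n))" and GE: "G \<in> Ev n" for G
        proof -
          have G: "verts G = {1..n}" "kgraph k G"
            using that(1) by (auto simp: random_kgraph_def kgraph_def)
          obtain AA BB where core: "ramsey_core k v1 e1 v2 e2 m m2 HA HB AA BB" and ne: "AA \<noteq> {}"
            and subG: "\<And>C. C \<in> AA \<union> BB \<Longrightarrow> subhypergraph C G"
            and dense: "\<And>V E. kgraph k (V, E) \<Longrightarrow> \<exists>A\<in>AA. subhypergraph A (V, E) \<Longrightarrow>
              \<forall>C\<in>AA \<union> BB. edges C \<inter> E \<noteq> {} \<longrightarrow> subhypergraph C (V, E) \<Longrightarrow>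
              \<exists>J. subhypergraph J (V, E) \<and> real (nv J) < real (ne J) / m"
            using cores[OF GE G(2,1)] by metis
          interpret ramsey_core k v1 e1 v2 e2 m m2 HA HB AA BB by fact
          have wV: "world_V \<subseteq> {1..n}" and wE: "world_E \<subseteq> edges G"
            using subG G(1) unfolding world_V_def world_E_def subhypergraph_def by blast+
          obtain r d V E I where tr: "r \<le> L n" "d \<le> D" "(V, E, I) \<in> S n r d" "E \<subseteq> world_E"
            "r = L n \<or> d = D \<or> closed_in V E \<and> V \<subseteq> {1..n} \<and> card V \<le> K \<and> E \<subseteq> nsets V k \<and>
              (\<exists>A\<in>AA. subhypergraph A (V, E))"
            using trajectory[OF wV ne, of "L n" D] unfolding S_def K_def w_def by blast
          have EG: "E \<subseteq> edges G" using tr(4) wE by blast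
          show ?thesis
          proof (cases "r = L n \<or> d = D")
            case True
            then have "(V, E, I) \<in> B1 \<union> B2"
              using tr(1-3) unfolding B1_def B2_def by (cases "d = D") auto
            moreover have "fst (snd (V, E, I)) \<subseteq> edges G" using EG by simp
            ultimately show ?thesis by blast
          next
            case False
            then have cl: "closed_in V E" "V \<subseteq> {1..n}" "card V \<le> K" "E \<subseteq> nsets V k"
              "\<exists>A\<in>AA. subhypergraph A (V, E)" using tr(5) by blast+
            have fV: "finite V" using cl(2) finite_subset by blast
            obtain J where J: "subhypergraph J (V, E)" "real (nv J) < real (ne J) / m"
              using dense[of V E] cl fV unfolding closed_in_def kgraph_def by auto
            have JV: "verts J \<subseteq> V" "edges J \<subseteq> E" "edges J \<subseteq> Pow (verts J)"
              using J(1) by (auto simp: subhypergraph_def)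
            have "card (verts J) \<le> K" using card_mono[OF fV JV(1)] cl(3) by linarith
            moreover have "verts J \<subseteq> {1..n}" using JV(1) cl(2) by blast
            ultimately have "(verts J, edges J, {}) \<in> B3"
              unfolding B3_def sparse_bad_def using JV(3) J(2) by blast
            moreover have "fst (snd (verts J, edges J, {})) \<subseteq> edges G" using JV(2) EG by simp
            ultimately show ?thesis by blast
          qed
        qed
      qed (use p in auto)
      also have "\<dots> \<le> sum ?W B1 + sum ?W B2 + sum ?W B3"
      proof -
        have "sum ?W (B1 \<union> B2 \<union> B3) \<le> sum ?W (B1 \<union> B2) + sum ?W B3"
          using fin p by (subst sum_Un) (auto intro!: sum_nonneg)
        moreover have "sum ?W (B1 \<union> B2) \<le> sum ?W B1 + sum ?W B2"
          using fin p by (subst sum_Un) (auto intro!: sum_nonneg)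
        ultimately show ?thesis by linarith
      qed
      also have "\<dots> \<le> bound n" using s1 s2 s3 by (simp add: bound_def add_divide_distrib)
      finally show ?case .
    qed
    then show ?thesis
      by (intro tendsto_sandwich[OF _ _ tendsto_const lim]) auto
  qed
  then show ?thesis using b(1) by blast
qed

end

section \<open>Densities of copies\<close>

lemma kgraph_sub: "kgraph k H \<Longrightarrow> subhypergraph J H \<Longrightarrow> kgraph k J"
  by (auto simp: kgraph_def subhypergraph_def nsets_def intro: finite_subset)

lemma kgraph_edges:
  assumes "kgraph k H"
  shows "finite (verts H)" "finite (edges H)" "\<Union>(edges H) \<subseteq> verts H"
    "\<And>e. e \<in> edges H \<Longrightarrow> card e = k"
proof -
  show "finite (verts H)" "\<Union>(edges H) \<subseteq> verts H" "\<And>e. e \<in> edges H \<Longrightarrow> card e = k"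
    using assms by (auto simp: kgraph_def nsets_def)
  then show "finite (edges H)" by (auto intro: finite_subset[of _ "Pow (verts H)"])
qed

lemma kgraph_nv_ge: "kgraph k H \<Longrightarrow> edges H \<noteq> {} \<Longrightarrow> nv H \<ge> k"
  using kgraph_edges[of k H] by (metis Sup_upper card_mono ex_in_conv order_trans)

lemma kgraph_single_edge:
  assumes "kgraph k H" "edges H \<noteq> {}" "nv H = k"
  shows "edges H = {verts H}"
proof -
  have "e = verts H" if "e \<in> edges H" for e
    using that kgraph_edges[OF assms(1)] assms(3) by (metis Sup_le_iff card_subset_eq)
  then show ?thesis using assms(2) by blast
qed

lemma finite_density_set:
  assumes "kgraph k H"
  shows "finite {d J | J. subhypergraph J H}" "{d J | J. subhypergraph J H} \<noteq> {}"
  unfolding setcompr_eq_image using finite_subhypergraphs[OF assms] subhypergraph_empty[of H] by blast+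

text \<open>Subhypergraphs of a copy are pulled back along the inverse bijection. The last clause of
  the third claim is what transfers the equality cases of strict balancedness.\<close>

lemma hg_iso_image:
  assumes "hg_iso H A" "kgraph k H"
  shows "nv A = nv H" "ne A = ne H"
    and "subhypergraph J A \<Longrightarrow> \<exists>J'. subhypergraph J' H \<and> nv J' = nv J \<and> ne J' = ne J \<and> (J' = H \<longrightarrow> J = A)"
proof -
  obtain f where f: "bij_betw f (verts H) (verts A)" and E: "edges A = (\<lambda>e. f ` e) ` edges H"
    using assms(1) by (auto simp: hg_iso_def)
  have sH: "e \<subseteq> verts H" if "e \<in> edges H" for e using kgraph_edges(3)[OF assms(2)] that by blast
  have inj: "inj_on f (verts H)" and im: "f ` verts H = verts A" using f by (auto simp: bij_betw_def)
  show "nv A = nv H" using bij_betw_same_card[OF f] by simp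
  have "inj_on (\<lambda>e. f ` e) (edges H)"
    using inj sH by (intro inj_onI) (metis inj_on_image_eq_iff)
  then show "ne A = ne H" unfolding E by (rule card_image)
  assume J: "subhypergraph J A"
  define g where "g = inv_into (verts H) f"
  have gf: "g ` f ` X = X" if "X \<subseteq> verts H" for X
    using inv_into_image_cancel[OF inj that] by (simp add: g_def)
  have fg: "f ` g ` X = X" if "X \<subseteq> verts A" for X
    using image_inv_into_cancel[OF im that] by (simp add: g_def)
  have JA: "verts J \<subseteq> verts A" "edges J \<subseteq> edges A" "\<Union>(edges J) \<subseteq> verts J"
    using J by (auto simp: subhypergraph_def)
  have eJ: "e \<subseteq> verts A" if "e \<in> edges J" for e using that JA by blast
  let ?J' = "(g ` verts J, (\<lambda>e. g ` e) ` edges J)"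
  have gv: "g ` verts J \<subseteq> verts H"
    using JA(1) im by (auto simp: g_def intro!: inv_into_into)
  have ge: "(\<lambda>e. g ` e) ` edges J \<subseteq> edges H"
  proof
    fix e' assume "e' \<in> (\<lambda>e. g ` e) ` edges J"
    then obtain e where e: "e \<in> edges J" "e' = g ` e" by blast
    then obtain e0 where "e0 \<in> edges H" "e = f ` e0" using JA(2) E by blast
    then show "e' \<in> edges H" using gf[OF sH] e(2) by simp
  qed
  have "\<Union>((\<lambda>e. g ` e) ` edges J) \<subseteq> g ` verts J" using JA(3) by blast
  then have "subhypergraph ?J' H" using gv ge by (simp add: subhypergraph_def)
  moreover have "inj_on g (verts J)"
    using inj_on_inv_into[of "verts J" f "verts H"] JA(1) im by (simp add: g_def)
  then have "nv ?J' = nv J" by (simp add: card_image)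
  moreover have "inj_on (\<lambda>e. g ` e) (edges J)"
    by (rule inj_onI) (metis fg eJ)
  then have "ne ?J' = ne J" by (simp add: card_image)
  moreover have "J = A" if JH: "?J' = H"
  proof -
    have HJ: "verts H = g ` verts J" "edges H = (\<lambda>e. g ` e) ` edges J"
      using JH by (metis fst_conv, metis snd_conv)
    have "verts J = verts A" using fg[OF JA(1)] im HJ(1) by simp
    moreover have "edges J = edges A"
    proof
      show "edges A \<subseteq> edges J"
      proof
        fix e assume "e \<in> edges A"
        then obtain e0 where e0: "e0 \<in> edges H" "e = f ` e0" using E by blast
        then obtain e1 where "e1 \<in> edges J" "e0 = g ` e1" using HJ(2) by blast
        then show "e \<in> edges J" using fg[OF eJ] e0(2) by simp
      qed
    qed (rule JA(2))
    ultimately show ?thesis by (simp add: prod_eq_iff)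
  qed
  ultimately show "\<exists>J'. subhypergraph J' H \<and> nv J' = nv J \<and> ne J' = ne J \<and> (J' = H \<longrightarrow> J = A)" by blast
qed

text \<open>By strictness only \<open>H\<close> itself attains the maximum, and as this exceeds 1,
  hence \<open>1 / k\<close>, it comes from the quotient in \<open>kdens\<close>. With denominators
  cleared, a single edge fits in: both sides vanish.\<close>

lemma strictly_k_balanced_facts:
  assumes H: "kgraph k H" and bal: "strictly_k_balanced k H" and \<mu>: "max_kdens k H > 1" and k: "k \<ge> 1"
  shows "nv H > k" "real (ne H) - 1 = max_kdens k H * (real (nv H) - real k)"
    and "subhypergraph J H \<Longrightarrow> edges J \<noteq> {} \<Longrightarrow>
      real (ne J) - 1 \<le> max_kdens k H * (real (nv J) - real k)"
    and "subhypergraph J H \<Longrightarrow> edges J \<noteq> {} \<Longrightarrow>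
      real (ne J) - 1 = max_kdens k H * (real (nv J) - real k) \<Longrightarrow> J = H \<or> nv J = k"
proof -
  let ?\<mu> = "max_kdens k H"
  have "?\<mu> \<in> {kdens k J | J. subhypergraph J H}"
    unfolding max_kdens_def by (rule Max_in[OF finite_density_set[OF H]])
  then obtain J0 where J0: "subhypergraph J0 H" "kdens k J0 = ?\<mu>" by auto
  then have "J0 = H"
    using bal unfolding strictly_k_balanced_def proper_subhypergraph_def by (metis less_irrefl)
  then have kd: "kdens k H = ?\<mu>" using J0 by simp
  have "1 / real k \<le> 1" using k by simp
  then have c: "nv H \<ge> k + 1" "(real (ne H) - 1) / (real (nv H) - real k) = ?\<mu>"
    using kd \<mu> by (auto simp: kdens_def split: if_splits)
  then show "nv H > k" by simp
  show eqH: "real (ne H) - 1 = ?\<mu> * (real (nv H) - real k)"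
    using c by (simp add: field_simps)
  have main: "real (ne J) - 1 \<le> ?\<mu> * (real (nv J) - real k) \<and>
     (real (ne J) - 1 = ?\<mu> * (real (nv J) - real k) \<longrightarrow> J = H \<or> nv J = k)"
    if J: "subhypergraph J H" "edges J \<noteq> {}"
  proof (cases "J = H \<or> nv J = k")
    case True
    then show ?thesis
      using eqH kgraph_single_edge[OF kgraph_sub[OF H J(1)] J(2)] by auto
  next
    case False
    then have nv: "nv J \<ge> k + 1" using kgraph_nv_ge[OF kgraph_sub[OF H J(1)] J(2)] by simp
    have "kdens k J < ?\<mu>"
      using bal J(1) False unfolding strictly_k_balanced_def proper_subhypergraph_def by blast
    then have "(real (ne J) - 1) / (real (nv J) - real k) < ?\<mu>"
      using nv J(2) by (simp add: kdens_def)
    then have "real (ne J) - 1 < ?\<mu> * (real (nv J) - real k)"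
      using nv by (simp add: divide_less_eq)
    then show ?thesis by simp
  qed
  then show "subhypergraph J H \<Longrightarrow> edges J \<noteq> {} \<Longrightarrow>
      real (ne J) - 1 \<le> ?\<mu> * (real (nv J) - real k)"
    "subhypergraph J H \<Longrightarrow> edges J \<noteq> {} \<Longrightarrow>
      real (ne J) - 1 = ?\<mu> * (real (nv J) - real k) \<Longrightarrow> J = H \<or> nv J = k" by blast+
qed

text \<open>For at least \<open>k\<close> vertices, \<open>kdens2 k J H2 \<le> m\<close> is
  equivalent to a lower bound on \<open>lam\<close>, with the same equality cases. A single edge has
  \<open>kdens2\<close> equal to \<open>m2\<close>, whence \<open>m2 \<le> m\<close>. For equal
  k-densities it attains the maximum too, which is the exceptional alternative in the last
  claim.\<close>

lemma heart_facts:
  fixes H1 :: "'v hypergraph" and H2 :: "'w hypergraph"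
  assumes H1: "kgraph k H1" "nonempty_hg H1" and H2: "nonempty_hg H2" and k: "k \<ge> 1"
    and heart: "max_kdens k H1 \<ge> max_kdens k H2"
      "max_kdens k H1 = max_kdens k H2 \<longrightarrow> strictly_k_balanced k H1"
      "max_kdens k H1 > max_kdens k H2 \<longrightarrow> strictly_balanced_wrt k H1 H2"
    and gt1: "max_kdens k H2 > 1"
  defines "m \<equiv> max_kdens2 k H1 H2" and "m2 \<equiv> max_kdens k H2"
  shows "m2 \<le> m" "ne H1 \<ge> 2" "real (nv H1) - real (ne H1) / m = real k - 1 / m2"
    and "subhypergraph J H1 \<Longrightarrow> nv J \<ge> k \<Longrightarrow> real (nv J) - real (ne J) / m \<ge> real k - 1 / m2"
    and "subhypergraph J H1 \<Longrightarrow> nv J \<ge> k \<Longrightarrow> real (nv J) - real (ne J) / m = real k - 1 / m2 \<Longrightarrow>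
      J = H1 \<or> nv J = k \<and> ne J = 1 \<and> m = m2"
proof -
  have m2: "m2 > 1" "m2 > 0" using gt1 by (auto simp: m2_def)
  let ?S = "{kdens2 k J H2 | J. subhypergraph J H1}"
  have fin: "finite ?S" "?S \<noteq> {}"
    using finite_density_set[OF H1(1), of "\<lambda>J. kdens2 k J H2"] by blast+
  have le_m: "kdens2 k J H2 \<le> m" if "subhypergraph J H1" for J
    unfolding m_def max_kdens2_def by (rule Max_ge[OF fin(1)]) (use that in blast)
  have "m \<in> ?S" unfolding m_def max_kdens2_def by (rule Max_in[OF fin])
  then obtain J0 where J0: "subhypergraph J0 H1" "kdens2 k J0 H2 = m" by auto
  have kd: "kdens2 k J H2 = real (ne J) / (real (nv J) - real k + 1 / m2)" if "nv J \<ge> k" for J :: "'v hypergraph"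
    using that H2 by (simp add: kdens2_def m2_def)
  have den: "real (nv J) - real k + 1 / m2 > 0" if "nv J \<ge> k" for J :: "'v hypergraph"
    using that m2 by (simp add: add_nonneg_pos)
  obtain e where e: "e \<in> edges H1" using H1(2) by auto
  have eK: "subhypergraph (e, {e}) H1" "card e = k"
    using e kgraph_edges(3,4)[OF H1(1)] by (auto simp: subhypergraph_def)
  have "kdens2 k (e, {e}) H2 = m2" using kd[of "(e, {e})"] eK(2) m2 by simp
  then show mm: "m2 \<le> m" using le_m[OF eK(1)] by simp
  then have mp: "m > 0" using m2 by simp
  have equiv: "kdens2 k J H2 = m \<longleftrightarrow> real (nv J) - real (ne J) / m = real k - 1 / m2"
    "kdens2 k J H2 \<le> m \<longleftrightarrow> real (nv J) - real (ne J) / m \<ge> real k - 1 / m2"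
    if "nv J \<ge> k" for J :: "'v hypergraph"
  proof -
    let ?d = "real (nv J) - real k + 1 / m2"
    have "kdens2 k J H2 = m \<longleftrightarrow> real (ne J) = m * ?d"
      using kd[OF that] den[OF that] by (metis less_irrefl nonzero_eq_divide_eq)
    also have "\<dots> \<longleftrightarrow> real (ne J) / m = ?d" using mp by (metis less_irrefl mult.commute nonzero_divide_eq_eq)
    also have "\<dots> \<longleftrightarrow> real (nv J) - real (ne J) / m = real k - 1 / m2" by linarith
    finally show "kdens2 k J H2 = m \<longleftrightarrow> real (nv J) - real (ne J) / m = real k - 1 / m2" .
    have "kdens2 k J H2 \<le> m \<longleftrightarrow> real (ne J) \<le> m * ?d"
      using kd[OF that] den[OF that] by (metis pos_divide_le_eq)
    also have "\<dots> \<longleftrightarrow> real (ne J) / m \<le> ?d" using mp by (metis mult.commute pos_divide_le_eq)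
    also have "\<dots> \<longleftrightarrow> real (nv J) - real (ne J) / m \<ge> real k - 1 / m2" by linarith
    finally show "kdens2 k J H2 \<le> m \<longleftrightarrow> real (nv J) - real (ne J) / m \<ge> real k - 1 / m2" .
  qed
  show "subhypergraph J H1 \<Longrightarrow> nv J \<ge> k \<Longrightarrow> real (nv J) - real (ne J) / m \<ge> real k - 1 / m2"
    using le_m equiv(2) by blast
  have nvH1: "nv H1 \<ge> k" using kgraph_nv_ge[OF H1(1)] H1(2) by simp
  show "ne H1 \<ge> 2"
  proof -
    have "max_kdens k H1 \<in> {kdens k J | J. subhypergraph J H1}"
      unfolding max_kdens_def by (rule Max_in[OF finite_density_set[OF H1(1)]])
    then obtain J1 where J1: "subhypergraph J1 H1" "kdens k J1 = max_kdens k H1" by auto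
    have g: "kdens k J1 > 1" using J1(2) heart(1) gt1 by simp
    \<comment> \<open>Rules out the single-edge case of \<open>kdens\<close>, so \<open>J1\<close>
      has more than \<open>k\<close> vertices.\<close>
    have "1 / real k \<le> 1" using k by simp
    then have "nv J1 \<ge> k + 1" "(real (ne J1) - 1) / (real (nv J1) - real k) > 1"
      using g by (auto simp: kdens_def split: if_splits)
    then have "real (ne J1) - 1 > real (nv J1) - real k" "real (nv J1) - real k \<ge> 1"
      by (auto simp: less_divide_eq)
    then have "ne J1 \<ge> 2" by linarith
    moreover have "ne J1 \<le> ne H1"
      using J1(1) kgraph_edges(2)[OF H1(1)] by (intro card_mono) (auto simp: subhypergraph_def)
    ultimately show ?thesis by simp
  qed
  have *: "kdens2 k H1 H2 = m \<and> (\<forall>J. subhypergraph J H1 \<longrightarrow> nv J \<ge> k \<longrightarrow> kdens2 k J H2 = m \<longrightarrow>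
      J = H1 \<or> nv J = k \<and> ne J = 1 \<and> m = m2)"
  proof (cases "max_kdens k H1 = max_kdens k H2")
    case True
    note b = strictly_k_balanced_facts[OF H1(1) heart(2)[rule_format, OF True] _ k]
    have mk: "max_kdens k H1 = m2" "max_kdens k H1 > 1" using True gt1 by (simp_all add: m2_def)
    have eq: "real (nv J) - real k + 1 / m2 = (m2 * (real (nv J) - real k) + 1) / m2" for J :: "'v hypergraph"
      using m2 by (simp add: field_simps)
    \<comment> \<open>Here \<open>kdens2 k J H2 \<le> m2\<close> is the inequality of k-balancedness
      of H1 rewritten, so the maximum collapses to \<open>m = m2\<close>.\<close>
    have le2: "kdens2 k J H2 \<le> m2" if J: "subhypergraph J H1" for J
    proof (cases "nv J \<ge> k \<and> edges J \<noteq> {}")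
      case True
      have "real (ne J) \<le> m2 * (real (nv J) - real k) + 1"
        using b(3)[OF mk(2) J] True mk(1) by simp
      also have "\<dots> = m2 * (real (nv J) - real k + 1 / m2)" using m2 by (simp add: eq)
      finally show ?thesis using kd[of J] den[of J] True by (simp add: pos_divide_le_eq)
    next
      case False
      then show ?thesis using m2 by (auto simp: kdens2_def)
    qed
    then have mm': "m = m2" using mm J0 by fastforce
    have iff: "kdens2 k J H2 = m \<longleftrightarrow> real (ne J) - 1 = m2 * (real (nv J) - real k)" if "nv J \<ge> k" for J :: "'v hypergraph"
    proof -
      have "kdens2 k J H2 = m \<longleftrightarrow> real (ne J) = m2 * (real (nv J) - real k + 1 / m2)"
        using kd[OF that] den[OF that] mm' by (metis less_irrefl nonzero_eq_divide_eq)
      also have "m2 * (real (nv J) - real k + 1 / m2) = m2 * (real (nv J) - real k) + 1"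
        using m2 by (simp add: eq)
      finally show ?thesis by linarith
    qed
    have "J = H1 \<or> nv J = k \<and> ne J = 1 \<and> m = m2"
      if J: "subhypergraph J H1" "nv J \<ge> k" "kdens2 k J H2 = m" for J
    proof -
      have neJ: "edges J \<noteq> {}" using kd[OF J(2)] J(3) mp by auto
      then have "J = H1 \<or> nv J = k" using b(4)[OF mk(2) J(1)] iff[OF J(2)] J(3) mk(1) by simp
      then show ?thesis
        using kgraph_single_edge[OF kgraph_sub[OF H1(1) J(1)] neJ] mm' by auto
    qed
    moreover have "kdens2 k H1 H2 = m" using iff[OF nvH1] b(2)[OF mk(2)] mk(1) by simp
    ultimately show ?thesis by blast
  next
    case False
    then have "strictly_balanced_wrt k H1 H2" using heart(1,3) by simp
    then have "J = H1" if "subhypergraph J H1" "kdens2 k J H2 = m" for J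
      using that unfolding strictly_balanced_wrt_def proper_subhypergraph_def m_def by (metis less_irrefl)
    then show ?thesis using J0 by blast
  qed
  show "real (nv H1) - real (ne H1) / m = real k - 1 / m2"
    using conjunct1[OF *] equiv(1)[OF nvH1] by simp
  show "J = H1 \<or> nv J = k \<and> ne J = 1 \<and> m = m2"
    if J: "subhypergraph J H1" "nv J \<ge> k" "real (nv J) - real (ne J) / m = real k - 1 / m2"
    using conjunct2[OF *, rule_format, OF J(1,2)] equiv(1)[OF J(2)] J(3) by simp
qed

section \<open>Minimal families of copies\<close>

text \<open>\<open>unsat A B\<close>: no set \<open>R\<close> of red edges avoids both a red member of \<open>A\<close> and a blue
  member of \<open>B\<close>.\<close>

definition unsat :: "'v hypergraph set \<Rightarrow> 'v hypergraph set \<Rightarrow> bool" where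
  "unsat A B \<longleftrightarrow> (\<forall>R. (\<exists>C\<in>A. edges C \<subseteq> R) \<or> (\<exists>C\<in>B. edges C \<inter> R = {}))"

definition min_unsat :: "'v hypergraph set \<Rightarrow> 'v hypergraph set \<Rightarrow> bool" where
  "min_unsat A B \<longleftrightarrow> unsat A B \<and> (\<forall>A' B'. A' \<subseteq> A \<longrightarrow> B' \<subseteq> B \<longrightarrow> unsat A' B' \<longrightarrow> A' = A \<and> B' = B)"

lemma unsatE:
  assumes "unsat A B"
  obtains C where "C \<in> A" "edges C \<subseteq> R" | C where "C \<in> B" "edges C \<inter> R = {}"
  using assms unfolding unsat_def by metis

lemma not_unsatE:
  assumes "\<not> unsat A B"
  obtains R where "\<forall>C\<in>A. \<not> edges C \<subseteq> R" "\<forall>C\<in>B. edges C \<inter> R \<noteq> {}"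
  using assms unfolding unsat_def by metis

lemma min_unsat_exists:
  assumes "finite A0" "finite B0" "unsat A0 B0"
  obtains A B where "A \<subseteq> A0" "B \<subseteq> B0" "min_unsat A B"
proof -
  let ?P = "\<lambda>(A, B). A \<subseteq> A0 \<and> B \<subseteq> B0 \<and> unsat A B"
  let ?f = "\<lambda>(A, B). card A + card B"
  have "?P (A0, B0)" using assms(3) by simp
  then obtain x where x: "?P x" "\<And>y. ?P y \<Longrightarrow> ?f x \<le> ?f y"
    using ex_has_least_nat[of ?P "(A0, B0)" ?f] by blast
  obtain A B where xe: "x = (A, B)" by (cases x)
  have AB: "A \<subseteq> A0" "B \<subseteq> B0" "unsat A B" using x(1) by (auto simp: xe)
  have fin: "finite A" "finite B" using AB assms finite_subset by blast+
  have "A' = A \<and> B' = B" if s: "A' \<subseteq> A" "B' \<subseteq> B" "unsat A' B'" for A' B'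
  proof -
    have "card A + card B \<le> card A' + card B'" using x(2)[of "(A', B')"] s AB by (auto simp: xe)
    moreover have "card A' \<le> card A" "card B' \<le> card B" using s fin by (auto intro: card_mono)
    ultimately have "card A \<le> card A'" "card B \<le> card B'" by linarith+
    then show ?thesis using s fin by (metis card_seteq)
  qed
  then show ?thesis using that[OF AB(1,2)] AB(3) unfolding min_unsat_def by simp
qed

lemma min_unsatD:
  assumes "min_unsat A B"
  shows "unsat A B" "C \<in> A \<Longrightarrow> \<not> unsat (A - {C}) B" "C \<in> B \<Longrightarrow> \<not> unsat A (B - {C})"
proof -
  have min: "A' = A \<and> B' = B" if "A' \<subseteq> A" "B' \<subseteq> B" "unsat A' B'" for A' B'
    using assms that unfolding min_unsat_def by simp
  show "unsat A B" using assms by (simp add: min_unsat_def)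
  show "\<not> unsat (A - {C}) B" if "C \<in> A"
    using min[OF Diff_subset order_refl, of "{C}"] that by auto
  show "\<not> unsat A (B - {C})" if "C \<in> B"
    using min[OF order_refl Diff_subset, of "{C}"] that by auto
qed

text \<open>Take \<open>R\<close> avoiding all conflicts once \<open>C\<close> is dropped; then
  \<open>C\<close> is red under \<open>R\<close>. Recolouring \<open>e\<close> blue destroys the red
  \<open>C\<close> and creates no other red member, so some \<open>D\<close> becomes entirely blue.
  It was not before, hence \<open>e\<close> is its only red edge, while all edges of
  \<open>C\<close> are red.\<close>

lemma min_unsat_A:
  assumes "min_unsat A B" "C \<in> A" "e \<in> edges C"
  shows "\<exists>D\<in>B. edges C \<inter> edges D = {e}"
proof -
  have "\<not> unsat (A - {C}) B" using min_unsatD(2)[OF assms(1,2)] .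
  then obtain R where R': "\<forall>C'\<in>A - {C}. \<not> edges C' \<subseteq> R" "\<forall>D\<in>B. edges D \<inter> R \<noteq> {}"
    by (rule not_unsatE)
  note R = bspec[OF R'(1)] bspec[OF R'(2)]
  have un: "unsat A B" using assms(1) by (simp add: min_unsat_def)
  have CR: "edges C \<subseteq> R"
  proof (rule unsatE[OF un, of R])
    show ?thesis if "C' \<in> A" "edges C' \<subseteq> R" for C' using R(1)[of C'] that by (cases "C' = C") simp_all
    show ?thesis if "D \<in> B" "edges D \<inter> R = {}" for D using R(2) that by simp
  qed
  have no: "\<not> edges C' \<subseteq> R - {e}" if "C' \<in> A" for C'
    using R(1)[of C'] assms(3) that by blast
  obtain D where D: "D \<in> B" "edges D \<inter> (R - {e}) = {}"
    by (rule unsatE[OF un, of "R - {e}"]) (metis no)+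
  moreover have "edges D \<inter> R \<noteq> {}" using R(2) D(1) by simp
  ultimately have "edges C \<inter> edges D = {e}" using CR assms(3) by blast
  then show ?thesis using D(1) by blast
qed

text \<open>The dual argument: \<open>e\<close> is recoloured red.\<close>

lemma min_unsat_B:
  assumes "min_unsat A B" "D \<in> B" "e \<in> edges D"
  shows "\<exists>C\<in>A. edges C \<inter> edges D = {e}"
proof -
  have "\<not> unsat A (B - {D})" using min_unsatD(3)[OF assms(1,2)] .
  then obtain R where R': "\<forall>C\<in>A. \<not> edges C \<subseteq> R" "\<forall>D'\<in>B - {D}. edges D' \<inter> R \<noteq> {}"
    by (rule not_unsatE)
  note R = bspec[OF R'(1)] bspec[OF R'(2)]
  have un: "unsat A B" using assms(1) by (simp add: min_unsat_def)
  have DR: "edges D \<inter> R = {}"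
  proof (rule unsatE[OF un, of R])
    show ?thesis if "C \<in> A" "edges C \<subseteq> R" for C using R(1) that by simp
    show ?thesis if "D' \<in> B" "edges D' \<inter> R = {}" for D' using R(2)[of D'] that by (cases "D' = D") simp_all
  qed
  have no: "edges D' \<inter> insert e R \<noteq> {}" if "D' \<in> B" for D'
    using R(2)[of D'] assms(3) that by blast
  obtain C where C: "C \<in> A" "edges C \<subseteq> insert e R"
    by (rule unsatE[OF un, of "insert e R"]) (metis no)+
  moreover have "\<not> edges C \<subseteq> R" using R(1) C(1) by simp
  ultimately have "edges C \<inter> edges D = {e}" using DR assms(3) by blast
  then show ?thesis using C(1) by blast
qed

text \<open>Otherwise some \<open>R1\<close> satisfies all members inside \<open>E\<close>. Dropping
  \<open>C0\<close>, which lies inside \<open>E\<close>, gives an \<open>R2\<close> that satisfies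
  every member outside \<open>E\<close>. No member is split by \<open>E\<close>, so
  \<open>R1\<close> on \<open>E\<close> and \<open>R2\<close> off \<open>E\<close> combine to a
  colouring that satisfies all members, a contradiction.\<close>

lemma min_unsat_closed:
  assumes min: "min_unsat A B" and dich: "\<And>C. C \<in> A \<union> B \<Longrightarrow> edges C \<inter> E \<noteq> {} \<Longrightarrow> edges C \<subseteq> E"
    and C0: "C0 \<in> A" "edges C0 \<subseteq> E"
    and ne: "\<And>C. C \<in> A \<union> B \<Longrightarrow> edges C \<noteq> {}"
  shows "unsat {C \<in> A. edges C \<subseteq> E} {C \<in> B. edges C \<subseteq> E}"
proof (rule ccontr)
  assume "\<not> ?thesis"
  moreover define A' where "A' = {C \<in> A. edges C \<subseteq> E}"
  moreover define B' where "B' = {C \<in> B. edges C \<subseteq> E}"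
  ultimately have "\<not> unsat A' B'" by simp
  then obtain R1 where R1': "\<forall>C\<in>A'. \<not> edges C \<subseteq> R1" "\<forall>C\<in>B'. edges C \<inter> R1 \<noteq> {}"
    by (rule not_unsatE)
  have R1: "\<not> edges C \<subseteq> R1" if "C \<in> A" "edges C \<subseteq> E" for C
    using bspec[OF R1'(1), of C] that by (simp add: A'_def)
  have R1B: "edges C \<inter> R1 \<noteq> {}" if "C \<in> B" "edges C \<subseteq> E" for C
    using bspec[OF R1'(2), of C] that by (simp add: B'_def)
  have "\<not> unsat (A - {C0}) B" using min_unsatD(2)[OF min C0(1)] .
  then obtain R2 where R2': "\<forall>C\<in>A - {C0}. \<not> edges C \<subseteq> R2" "\<forall>C\<in>B. edges C \<inter> R2 \<noteq> {}"
    by (rule not_unsatE)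
  note R2 = bspec[OF R2'(1)] bspec[OF R2'(2)]
  let ?R = "(R1 \<inter> E) \<union> (R2 - E)"
  have "unsat A B" using min by (simp add: min_unsat_def)
  then consider C where "C \<in> A" "edges C \<subseteq> ?R" | C where "C \<in> B" "edges C \<inter> ?R = {}"
    by (rule unsatE)
  then show False
  proof cases
    case (1 C)
    show False
    proof (cases "edges C \<inter> E = {}")
      case True
      then have "edges C \<subseteq> R2" "C \<noteq> C0" using 1 C0(2) ne[of C] by blast+
      then show False using R2(1)[of C] 1(1) by blast
    next
      case False
      then have CE: "edges C \<subseteq> E" using dich 1(1) by blast
      then have "edges C \<subseteq> R1" using 1(2) by blast
      then show False using R1[OF 1(1) CE] by simp
    qed
  next
    case (2 C)
    show False
    proof (cases "edges C \<inter> E = {}")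
      case True
      then have "edges C \<inter> R2 = {}" using 2 by blast
      then show False using R2(2)[OF 2(1)] by simp
    next
      case False
      then have CE: "edges C \<subseteq> E" using dich 2(1) by blast
      then have "edges C \<inter> R1 = {}" using 2(2) by blast
      then show False using R1B[OF 2(1) CE] by simp
    qed
  qed
qed

text \<open>Reduces \<open>r\<close> colours to two: a colouring that uses only 1 and 2 has no copy
  of any other \<open>H i\<close> in colour \<open>i\<close>, because those are non-empty.\<close>

lemma arrows_unsat:
  fixes G :: "'w hypergraph" and H :: "nat \<Rightarrow> 'v hypergraph"
  assumes "arrows G r H" "r \<ge> 2" and ne: "\<And>i. i \<in> {1..r} \<Longrightarrow> nonempty_hg (H i)"
  shows "unsat {C. copy_of C (H 1) G} {C. copy_of C (H 2) G}"
  unfolding unsat_def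
proof
  fix R :: "'w set set"
  let ?c = "\<lambda>e. if e \<in> R then 1 else (2::nat)"
  have "?c ` edges G \<subseteq> {1..r}" using assms(2) by auto
  then obtain i J where J: "i \<in> {1..r}" "copy_of J (H i) G" "\<forall>e\<in>edges J. ?c e = i"
    using assms(1) unfolding arrows_def by blast
  have "edges J \<noteq> {}" using J(2) ne[OF J(1)] by (auto simp: copy_of_def hg_iso_def)
  then have "i = 1 \<or> i = 2" using J(3) by (metis all_not_in_conv)
  then show "(\<exists>C\<in>{C. copy_of C (H 1) G}. edges C \<subseteq> R) \<or> (\<exists>C\<in>{C. copy_of C (H 2) G}. edges C \<inter> R = {})"
  proof
    assume i: "i = 1"
    then have "edges J \<subseteq> R" using J(3) by (force split: if_splits)
    then show ?thesis using J(2) i by blast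
  next
    assume i: "i = 2"
    then have "edges J \<inter> R = {}" using J(3) by (force split: if_splits)
    then show ?thesis using J(2) i by blast
  qed
qed

lemma unsat_arrows:
  assumes "unsat {C \<in> A. edges C \<subseteq> E} {C \<in> B. edges C \<subseteq> E}"
    and "\<And>C. C \<in> A \<Longrightarrow> edges C \<subseteq> E \<Longrightarrow> copy_of C (H 1) (V, E)"
    and "\<And>C. C \<in> B \<Longrightarrow> edges C \<subseteq> E \<Longrightarrow> copy_of C (H 2) (V, E)"
  shows "arrows (V, E) 2 H"
  unfolding arrows_def
proof (intro allI impI)
  fix c :: "'a set \<Rightarrow> nat" assume "c ` edges (V, E) \<subseteq> {1..2}"
  then have "c e \<in> {1..2}" if "e \<in> E" for e using that by auto
  then have c: "c e = 1 \<or> c e = 2" if "e \<in> E" for e using that by fastforce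
  define A' where "A' = {C \<in> A. edges C \<subseteq> E}"
  define B' where "B' = {C \<in> B. edges C \<subseteq> E}"
  have un: "unsat A' B'" unfolding A'_def B'_def by (rule assms(1))
  show "\<exists>i\<in>{1..2}. \<exists>J. copy_of J (H i) (V, E) \<and> (\<forall>e\<in>edges J. c e = i)"
  proof (rule unsatE[OF un, of "{e. c e = 1}"])
    fix C assume C: "C \<in> A'" "edges C \<subseteq> {e. c e = 1}"
    have "copy_of C (H 1) (V, E)" using C(1) by (intro assms(2)) (simp_all add: A'_def)
    moreover have "\<forall>e\<in>edges C. c e = 1" using C(2) by auto
    ultimately show ?thesis by (intro bexI[of _ 1] exI[of _ C] conjI) simp_all
  next
    fix C assume C: "C \<in> B'" "edges C \<inter> {e. c e = 1} = {}"
    have CE: "edges C \<subseteq> E" using C(1) by (simp add: B'_def)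
    have "copy_of C (H 2) (V, E)" using C(1) by (intro assms(3)) (simp_all add: B'_def)
    moreover have "c e = 2" if "e \<in> edges C" for e
      using c[of e] CE C(2) that by blast
    ultimately show ?thesis by (intro bexI[of _ 2] exI[of _ C] conjI) simp_all
  qed
qed

theorem theorem1p8:
  fixes k r :: nat and H :: "nat \<Rightarrow> 'v hypergraph"
  assumes "k \<ge> 2" and "r \<ge> 2"
    and "\<forall>i\<in>{1..r}. kgraph k (H i) \<and> nonempty_hg (H i)"
    and "\<forall>i\<in>{1..<r}. max_kdens k (H i) \<ge> max_kdens k (H (i + 1))"
    and "max_kdens k (H 2) > 1"
    and "heart k (H 1) (H 2)"
    and "\<forall>G :: nat hypergraph. kgraph k G \<longrightarrow>
           max_dens G \<le> max_kdens2 k (H 1) (H 2) \<longrightarrow> \<not> arrows G 2 H"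
  shows "\<exists>b::real. b > 0 \<and>
    (\<forall>p :: nat \<Rightarrow> real.
       (\<forall>n. 0 \<le> p n \<and> p n \<le> 1) \<longrightarrow>
       (\<forall>n\<ge>1. p n \<le> b * real n powr (- 1 / max_kdens2 k (H 1) (H 2))) \<longrightarrow>
       (\<lambda>n. measure_pmf.prob (random_kgraph k n (p n)) {G. arrows G r H}) \<longlonglongrightarrow> 0)"
proof -
  define m where "m = max_kdens2 k (H 1) (H 2)"
  define m2 where "m2 = max_kdens k (H 2)"
  define HA where "HA = {A :: nat hypergraph. kgraph k A \<and> hg_iso (H 1) A}"
  define HB where "HB = {B :: nat hypergraph. kgraph k B \<and> hg_iso (H 2) B}"
  have H1: "kgraph k (H 1)" "nonempty_hg (H 1)" and H2: "kgraph k (H 2)" "nonempty_hg (H 2)"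
    using assms(2,3) by auto
  have k1: "k \<ge> 1" using assms(1) by simp
  have hearts: "max_kdens k (H 1) \<ge> max_kdens k (H 2)" "strictly_k_balanced k (H 2)"
    "max_kdens k (H 1) = max_kdens k (H 2) \<longrightarrow> strictly_k_balanced k (H 1)"
    "max_kdens k (H 1) > max_kdens k (H 2) \<longrightarrow> strictly_balanced_wrt k (H 1) (H 2)"
    using assms(6) by (simp_all add: heart_def)
  note A = heart_facts[OF H1 H2(2) k1 hearts(1,3,4) assms(5), folded m_def m2_def]
  note B = strictly_k_balanced_facts[OF H2(1) hearts(2) assms(5) k1, folded m2_def]
  interpret ramsey_pair k "nv (H 1)" "ne (H 1)" "nv (H 2)" "ne (H 2)" m m2 HA HB
  proof
    show "k \<ge> 2" by (rule assms(1))
    show "1 < m2" using assms(5) by (simp add: m2_def)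
    show "kgraph k C" "nv C = nv (H 1)" "ne C = ne (H 1)" if "C \<in> HA" for C
      using that hg_iso_image(1,2)[of "H 1" C k] H1(1) unfolding HA_def by simp_all
    show "kgraph k C" "nv C = nv (H 2)" "ne C = ne (H 2)" if "C \<in> HB" for C
      using that hg_iso_image(1,2)[of "H 2" C k] H2(1) unfolding HB_def by simp_all
    show "real (nv J) - real (ne J) / m \<ge> real k - 1 / m2"
      if C: "C \<in> HA" "subhypergraph J C" "k \<le> nv J" for C J
    proof -
      obtain J' where "subhypergraph J' (H 1)" "nv J' = nv J" "ne J' = ne J"
        using hg_iso_image(3)[of "H 1" C k J] H1(1) C unfolding HA_def by blast
      then show ?thesis using A(4)[of J'] C(3) by simp
    qed
    show "J = C \<or> nv J = k \<and> ne J = 1 \<and> m = m2"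
      if C: "C \<in> HA" "subhypergraph J C" "k \<le> nv J" "real (nv J) - real (ne J) / m = real k - 1 / m2" for C J
    proof -
      obtain J' where "subhypergraph J' (H 1)" "nv J' = nv J" "ne J' = ne J" "J' = H 1 \<longrightarrow> J = C"
        using hg_iso_image(3)[of "H 1" C k J] H1(1) C unfolding HA_def by blast
      then show ?thesis using A(5)[of J'] C(3,4) by auto
    qed
    have ne_edges: "edges J' \<noteq> {}" if "ne J' = ne J" "edges J \<noteq> {}" "C \<in> HB" "subhypergraph J C"
      for J' :: "'v hypergraph" and J C :: "nat hypergraph"
    proof -
      have "finite (edges J)" using kgraph_edges(2)[OF kgraph_sub[of k C J]] that(3,4) by (simp add: HB_def)
      then show ?thesis using that(1,2) by auto
    qed
    show "real (ne J) - 1 \<le> m2 * (real (nv J) - real k)"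
      if C: "C \<in> HB" "subhypergraph J C" "edges J \<noteq> {}" for C J
    proof -
      obtain J' where J': "subhypergraph J' (H 2)" "nv J' = nv J" "ne J' = ne J"
        using hg_iso_image(3)[of "H 2" C k J] H2(1) C unfolding HB_def by blast
      show ?thesis using B(3)[OF J'(1) ne_edges[OF J'(3) C(3,1,2)]] J'(2,3) by simp
    qed
    show "J = C \<or> nv J = k"
      if C: "C \<in> HB" "subhypergraph J C" "edges J \<noteq> {}" "real (ne J) - 1 = m2 * (real (nv J) - real k)" for C J
    proof -
      obtain J' where J': "subhypergraph J' (H 2)" "nv J' = nv J" "ne J' = ne J" "J' = H 2 \<longrightarrow> J = C"
        using hg_iso_image(3)[of "H 2" C k J] H2(1) C unfolding HB_def by blast
      show ?thesis using B(4)[OF J'(1) ne_edges[OF J'(3) C(3,1,2)]] J'(2-4) C(4) by auto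
    qed
    show "m2 \<le> m" "ne (H 1) \<ge> 2" "real (nv (H 1)) - real (ne (H 1)) / m = real k - 1 / m2"
      by (rule A(1-3))+
    show "k < nv (H 2)" "real (ne (H 2)) - 1 = m2 * (real (nv (H 2)) - real k)"
      by (rule B(1,2))+
  qed
  have m_pos: "m > 0" using m_pos .
  show ?thesis
    unfolding m_def[symmetric]
  proof (rule cores_unlikely)
    fix n and G :: "nat hypergraph"
    assume G: "G \<in> {G. arrows G r H}" "kgraph k G" "verts G = {1..n}"
    let ?A0 = "{C. copy_of C (H 1) G}" and ?B0 = "{C. copy_of C (H 2) G}"
    have "finite {J. subhypergraph J G}" by (rule finite_subhypergraphs[OF G(2)])
    then have fin: "finite ?A0" "finite ?B0"
      by (auto simp: copy_of_def intro: rev_finite_subset)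
    have "unsat ?A0 ?B0" using arrows_unsat[of G r H] G(1) assms(2,3) by simp
    then obtain AA BB where AB: "AA \<subseteq> ?A0" "BB \<subseteq> ?B0" and min: "min_unsat AA BB"
      using min_unsat_exists[OF fin] by metis
    have A_G: "subhypergraph C G" "hg_iso (H 1) C" if "C \<in> AA" for C
      using that AB(1) by (auto simp: copy_of_def)
    have B_G: "subhypergraph C G" "hg_iso (H 2) C" if "C \<in> BB" for C
      using that AB(2) by (auto simp: copy_of_def)
    have ne: "edges C \<noteq> {}" if "C \<in> AA \<union> BB" for C
      using that A_G(2)[of C] B_G(2)[of C] H1(2) H2(2) by (auto simp: hg_iso_def)
    have core: "ramsey_core k (nv (H 1)) (ne (H 1)) (nv (H 2)) (ne (H 2)) m m2 HA HB AA BB"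
    proof
      show "AA \<subseteq> HA" using A_G kgraph_sub[OF G(2)] by (auto simp: HA_def)
      show "BB \<subseteq> HB" using B_G kgraph_sub[OF G(2)] by (auto simp: HB_def)
      show "\<exists>B\<in>BB. edges C \<inter> edges B = {e}" if "C \<in> AA" "e \<in> edges C" for C e
        using min_unsat_A[OF min that] .
      show "\<exists>A\<in>AA. edges A \<inter> edges C = {e}" if "C \<in> BB" "e \<in> edges C" for C e
        using min_unsat_B[OF min that] .
    qed
    have "AA \<noteq> {}"
    proof
      assume "AA = {}"
      then show False
        \<comment> \<open>With every edge red, some member of \<open>BB\<close> would have to be
          edgeless.\<close>
        using min_unsatD(1)[OF min] ne unfolding unsat_def by (metis Int_UNIV_right UnI2 empty_iff)
    qed
    moreover have "\<exists>J. subhypergraph J (V, E) \<and> real (nv J) < real (ne J) / m"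
      if VE: "kgraph k (V, E)" and some: "\<exists>A\<in>AA. subhypergraph A (V, E)"
        and closed: "\<forall>C\<in>AA \<union> BB. edges C \<inter> E \<noteq> {} \<longrightarrow> subhypergraph C (V, E)" for V E
    proof -
      have sub: "subhypergraph C (V, E)" if "C \<in> AA \<union> BB" "edges C \<subseteq> E" for C
        using closed that ne[OF that(1)] by blast
      obtain C0 where C0: "C0 \<in> AA" "edges C0 \<subseteq> E" using some by (auto simp: subhypergraph_def)
      have "unsat {C \<in> AA. edges C \<subseteq> E} {C \<in> BB. edges C \<subseteq> E}"
        using closed by (intro min_unsat_closed[OF min _ C0 ne]) (auto simp: subhypergraph_def)
      then have "arrows (V, E) 2 H"
        by (rule unsat_arrows) (use sub A_G B_G in \<open>auto simp: copy_of_def\<close>)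
      \<comment> \<open>The hypothesis on all graphs, read contrapositively: a graph that arrows the
        pair has density above \<open>m\<close>.\<close>
      then have "max_dens (V, E) > m" using assms(7) VE unfolding m_def by (meson not_le)
      moreover have "max_dens (V, E) \<in> {dens J | J. subhypergraph J (V, E)}"
        unfolding max_dens_def by (rule Max_in[OF finite_density_set[OF VE]])
      ultimately obtain J where J: "subhypergraph J (V, E)" "dens J > m" by auto
      then have "nv J \<ge> 1" "real (ne J) / real (nv J) > m"
        using m_pos by (auto simp: dens_def split: if_splits)
      then have "real (nv J) < real (ne J) / m" using m_pos by (simp add: field_simps)
      then show ?thesis using J(1) by blast
    qed
    ultimately show "\<exists>AA BB. ramsey_core k (nv (H 1)) (ne (H 1)) (nv (H 2)) (ne (H 2)) m m2 HA HB AA BB \<and> AA \<noteq> {} \<and>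
      (\<forall>C\<in>AA \<union> BB. subhypergraph C G) \<and>
      (\<forall>V E. kgraph k (V, E) \<longrightarrow> (\<exists>A\<in>AA. subhypergraph A (V, E)) \<longrightarrow>
        (\<forall>C\<in>AA \<union> BB. edges C \<inter> E \<noteq> {} \<longrightarrow> subhypergraph C (V, E)) \<longrightarrow>
        (\<exists>J. subhypergraph J (V, E) \<and> real (nv J) < real (ne J) / m))"
      using core A_G(1) B_G(1) by blast
  qed
qed

end
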